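(* Every simple finite-dimensional $YQ(1)$-module is isomorphic to $V(\mathbf s)\otimes\Gamma_f$ or to $\Pi V(\mathbf s)\otimes\Gamma_f$ for some $n$, some regular typical $\mathbf s\in\mathbb C^n$ and some $f(u)=1+\sum_{k>0}f_{2k}u^{-2k}$ ($f_{2k}\in\mathbb C$). Furthermore, $V(\mathbf s)\otimes\Gamma_f$ and $V(\mathbf s')\otimes\Gamma_g$ are isomorphic up to change of parity if and only if $\mathbf s'$ is obtained from $\mathbf s$ by a permutation of coordinates and $f(u)=g(u)$.
   Context: $YQ(1)$ is the associative unital superalgebra over $\mathbb C$ generated by $T_{i,j}^{(m)}$, $m\geq1$, $i,j\in\{1,-1\}$, of parity $p(i)+p(j)$ where $p(1)=0$, $p(-1)=1$. With $T_{i,j}(u)=\delta_{ij}+\sum_{m\ge1}T^{(m)}_{i,j}u^{-m}$, the defining relations are, for all $i,j,k,l$: $(u^2-v^2)[T_{i,j}(u),T_{k,l}(v)](-1)^{p(i)p(k)+p(i)p(l)+p(k)p(l)}=(u+v)(T_{k,j}(u)T_{i,l}(v)-T_{k,j}(v)T_{i,l}(u))-(u-v)(T_{-k,j}(u)T_{-i,l}(v)-T_{k,-j}(v)T_{i,-l}(u))(-1)^{p(k)+p(l)}$ (brackets are supercommutators), and $T_{i,j}(-u)=T_{-i,-j}(u)$. It is a Hopf superalgebra with $\Delta(T^{(r)}_{i,j})=\sum_{s=0}^r\sum_k(-1)^{(p(i)+p(k))(p(j)+p(k))}T^{(s)}_{i,k}\otimes T^{(r-s)}_{k,j}$ ($T^{(0)}_{i,j}=\delta_{ij}$);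 tensor products of modules are defined via $\Delta$. Let $U(\mathfrak h_n)$ be the superalgebra generated by odd $\xi_1,\dots,\xi_n$ with $\xi_i\xi_j+\xi_j\xi_i=0$ ($i\ne j$), $x_i=\xi_i^2$. There is a surjective homomorphism $\varphi_n$ from $YQ(1)$ onto the principal finite $W$-algebra $W^n\subset U(\mathfrak h_n)$ of $Q(n)$ with $\varphi_n(T^{(k)}_{1,1})=(-1)^k[\Sigma_k]_{even}$, $\varphi_n(T^{(k)}_{-1,1})=(-1)^k[\Sigma_k]_{odd}$, where $\Sigma_k=\sum_{1\le i_1<\dots<i_k\le n}\prod_{j=1}^k(x_{i_j}+(-1)^{k-j}\xi_{i_j})$ (ordered product), and $\Sigma_k=0$ for $k>n$. For $\mathbf s\in\mathbb C^n$, $V(\mathbf s)$ is a simple $\mathbb Z_2$-graded $U(\mathfrak h_n)$-module on which $x_i$ acts by $s_i$ (unique up to isomorphism and parity change), made a $YQ(1)$-module by restriction to $W^n$ and pullback via $\varphi_n$. $\mathbf s$ is regular if all $s_i\ne0$, typical if $s_i+s_j\neq0$ for $i\ne j$. For $n=0$, $V(\mathbf s)$ is the trivial one-dimensional module. For $f(u)=1+\sum_{k>0}f_{2k}u^{-2k}$, $\Gamma_f$ is the one-dimensional even $YQ(1)$-module on which all odd generators and all $T^{(2k+1)}_{1,1}$ act by $0$ and $T^{(2k)}_{1,1}$ acts by $f_{2k}$ (this is a well-defined module). *)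

theory Defs
  imports "Jordan_Normal_Form.Matrix" "HOL-Library.Multiset"
begin

text \<open>A finite-dimensional super vector space is modelled as complex^N with a homogeneous
basis; par a = True means that the a-th basis vector is odd.  The field act m i j is the
matrix by which the generator T_{i,j}^{(m)} (m >= 1, i,j in {1,-1}) acts.\<close>

record smod =
  dim :: nat
  par :: "nat \<Rightarrow> bool"
  act :: "nat \<Rightarrow> int \<Rightarrow> int \<Rightarrow> complex mat"

definition pp :: "int \<Rightarrow> nat" where
  "pp i = (if i = 1 then 0 else 1)"

definition sgn1 :: "nat \<Rightarrow> complex" where
  "sgn1 e = (-1) ^ e"

definition idx :: "int set" where
  "idx = {1, -1}"

text \<open>T r i j: coefficient of u^{-r} in T_{i,j}(u), r an integer; zero for r < 0,
delta_{ij} for r = 0.\<close>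
definition Tc :: "smod \<Rightarrow> int \<Rightarrow> int \<Rightarrow> int \<Rightarrow> complex mat" where
  "Tc M r i j = (if r < 0 then 0\<^sub>m (dim M) (dim M)
               else if r = 0 then (if i = j then 1\<^sub>m (dim M) else 0\<^sub>m (dim M) (dim M))
               else act M (nat r) i j)"

definition scomm :: "nat \<Rightarrow> complex mat \<Rightarrow> nat \<Rightarrow> complex mat \<Rightarrow> complex mat" where
  "scomm pa A pb B = A * B - sgn1 (pa * pb) \<cdot>\<^sub>m (B * A)"

text \<open>Coefficient of u^p v^q of the left hand side of the defining relation.\<close>
definition rel_lhs :: "smod \<Rightarrow> int \<Rightarrow> int \<Rightarrow> int \<Rightarrow> int \<Rightarrow> int \<Rightarrow> int \<Rightarrow> complex mat" where
  "rel_lhs M i j k l p q =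
     sgn1 (pp i * pp k + pp i * pp l + pp k * pp l) \<cdot>\<^sub>m
      (scomm (pp i + pp j) (Tc M (2 - p) i j) (pp k + pp l) (Tc M (- q) k l)
       - scomm (pp i + pp j) (Tc M (- p) i j) (pp k + pp l) (Tc M (2 - q) k l))"

text \<open>Coefficient of u^a v^b of T_{k,j}(u)T_{i,l}(v) - T_{k,j}(v)T_{i,l}(u).\<close>
definition relC :: "smod \<Rightarrow> int \<Rightarrow> int \<Rightarrow> int \<Rightarrow> int \<Rightarrow> int \<Rightarrow> int \<Rightarrow> complex mat" where
  "relC M i j k l a b = Tc M (- a) k j * Tc M (- b) i l - Tc M (- b) k j * Tc M (- a) i l"

text \<open>Coefficient of u^a v^b of T_{-k,j}(u)T_{-i,l}(v) - T_{k,-j}(v)T_{i,-l}(u).\<close>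
definition relD :: "smod \<Rightarrow> int \<Rightarrow> int \<Rightarrow> int \<Rightarrow> int \<Rightarrow> int \<Rightarrow> int \<Rightarrow> complex mat" where
  "relD M i j k l a b = Tc M (- a) (- k) j * Tc M (- b) (- i) l - Tc M (- b) k (- j) * Tc M (- a) i (- l)"

text \<open>Coefficient of u^p v^q of the right hand side of the defining relation.\<close>
definition rel_rhs :: "smod \<Rightarrow> int \<Rightarrow> int \<Rightarrow> int \<Rightarrow> int \<Rightarrow> int \<Rightarrow> int \<Rightarrow> complex mat" where
  "rel_rhs M i j k l p q =
     (relC M i j k l (p - 1) q + relC M i j k l p (q - 1))
     - sgn1 (pp k + pp l) \<cdot>\<^sub>m (relD M i j k l (p - 1) q - relD M i j k l p (q - 1))"

definition homog :: "nat \<Rightarrow> (nat \<Rightarrow> bool) \<Rightarrow> bool \<Rightarrow> complex mat \<Rightarrow> bool" where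
  "homog N pr isodd A \<longleftrightarrow> A \<in> carrier_mat N N \<and>
     (\<forall>a<N. \<forall>b<N. A $$ (a, b) \<noteq> 0 \<longrightarrow> (pr a \<longleftrightarrow> pr b) = (\<not> isodd))"

definition is_YQ1_module :: "smod \<Rightarrow> bool" where
  "is_YQ1_module M \<longleftrightarrow>
     (\<forall>m\<ge>1. \<forall>i\<in>idx. \<forall>j\<in>idx. homog (dim M) (par M) (i \<noteq> j) (act M m i j)) \<and>
     (\<forall>m\<ge>1. \<forall>i\<in>idx. \<forall>j\<in>idx. sgn1 m \<cdot>\<^sub>m act M m i j = act M m (- i) (- j)) \<and>
     (\<forall>i\<in>idx. \<forall>j\<in>idx. \<forall>k\<in>idx. \<forall>l\<in>idx. \<forall>p q.
        rel_lhs M i j k l p q = rel_rhs M i j k l p q)"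

definition even_proj :: "nat \<Rightarrow> (nat \<Rightarrow> bool) \<Rightarrow> complex vec \<Rightarrow> complex vec" where
  "even_proj N pr w = vec N (\<lambda>a. if pr a then 0 else w $ a)"

definition graded_inv_subspace ::
  "nat \<Rightarrow> (nat \<Rightarrow> bool) \<Rightarrow> complex mat set \<Rightarrow> complex vec set \<Rightarrow> bool" where
  "graded_inv_subspace N pr ops W \<longleftrightarrow>
     W \<subseteq> carrier_vec N \<and> 0\<^sub>v N \<in> W \<and>
     (\<forall>v\<in>W. \<forall>w\<in>W. v + w \<in> W) \<and> (\<forall>c. \<forall>w\<in>W. c \<cdot>\<^sub>v w \<in> W) \<and>
     (\<forall>w\<in>W. even_proj N pr w \<in> W) \<and>
     (\<forall>A\<in>ops. \<forall>w\<in>W. A *\<^sub>v w \<in> W)"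

definition simple_graded :: "nat \<Rightarrow> (nat \<Rightarrow> bool) \<Rightarrow> complex mat set \<Rightarrow> bool" where
  "simple_graded N pr ops \<longleftrightarrow> N > 0 \<and>
     (\<forall>W. graded_inv_subspace N pr ops W \<longrightarrow> W = {0\<^sub>v N} \<or> W = carrier_vec N)"

definition simple_YQ1 :: "smod \<Rightarrow> bool" where
  "simple_YQ1 M \<longleftrightarrow> simple_graded (dim M) (par M)
      {act M m i j | m i j. m \<ge> 1 \<and> i \<in> idx \<and> j \<in> idx}"

definition iso_YQ1 :: "smod \<Rightarrow> smod \<Rightarrow> bool" where
  "iso_YQ1 M M' \<longleftrightarrow> (\<exists>P. P \<in> carrier_mat (dim M') (dim M) \<and> invertible_mat P \<and>
     (\<forall>a<dim M'. \<forall>b<dim M. P $$ (a, b) \<noteq> 0 \<longrightarrow> (par M' a \<longleftrightarrow> par M b)) \<and>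
     (\<forall>m\<ge>1. \<forall>i\<in>idx. \<forall>j\<in>idx. P * act M m i j = act M' m i j * P))"

definition parity_change :: "smod \<Rightarrow> smod" where
  "parity_change M = M\<lparr>par := (\<lambda>a. \<not> par M a)\<rparr>"

definition iso_up_to_parity :: "smod \<Rightarrow> smod \<Rightarrow> bool" where
  "iso_up_to_parity M M' \<longleftrightarrow> iso_YQ1 M M' \<or> iso_YQ1 M (parity_change M')"

text \<open>Tensor product via the coproduct, with the Koszul sign rule
(X tensor Y)(v tensor w) = (-1)^{|Y||v|} Xv tensor Yw.  Basis index of e_a tensor e_b is
a * dim M2 + b.\<close>
definition tensor :: "smod \<Rightarrow> smod \<Rightarrow> smod" where
  "tensor M1 M2 = (let N2 = dim M2 in
     \<lparr> dim = dim M1 * N2,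
       par = (\<lambda>x. par M1 (x div N2) \<noteq> par M2 (x mod N2)),
       act = (\<lambda>r i j. mat (dim M1 * N2) (dim M1 * N2) (\<lambda>(x, y).
          \<Sum>s\<in>{0..r}. \<Sum>k\<in>idx.
            sgn1 ((pp i + pp k) * (pp j + pp k)) *
            sgn1 ((pp k + pp j) * (if par M1 (y div N2) then 1 else 0)) *
            Tc M1 (int s) i k $$ (x div N2, y div N2) *
            Tc M2 (int (r - s)) k j $$ (x mod N2, y mod N2))) \<rparr>)"

text \<open>A Z2-graded U(h_n)-module: odd operators xi 0, ..., xi (n-1).\<close>
record hmod =
  hdim :: nat
  hpar :: "nat \<Rightarrow> bool"
  xi :: "nat \<Rightarrow> complex mat"

definition simple_h_module :: "complex list \<Rightarrow> hmod \<Rightarrow> bool" where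
  "simple_h_module s H \<longleftrightarrow>
     (\<forall>i<length s. homog (hdim H) (hpar H) True (xi H i)) \<and>
     (\<forall>i<length s. \<forall>j<length s. i \<noteq> j \<longrightarrow> xi H i * xi H j + xi H j * xi H i = 0\<^sub>m (hdim H) (hdim H)) \<and>
     (\<forall>i<length s. xi H i * xi H i = (s ! i) \<cdot>\<^sub>m 1\<^sub>m (hdim H)) \<and>
     simple_graded (hdim H) (hpar H) {xi H i | i. i < length s}"

definition mprod :: "nat \<Rightarrow> complex mat list \<Rightarrow> complex mat" where
  "mprod N As = foldr (*) As (1\<^sub>m N)"

definition Sigma_op :: "complex list \<Rightarrow> hmod \<Rightarrow> nat \<Rightarrow> complex mat" where
  "Sigma_op s H k = mat (hdim H) (hdim H) (\<lambda>ab.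
     \<Sum>S\<in>{S. S \<subseteq> {0..<length s} \<and> card S = k}.
       mprod (hdim H) (map (\<lambda>(j, i). (s ! i) \<cdot>\<^sub>m 1\<^sub>m (hdim H) + sgn1 (k - Suc j) \<cdot>\<^sub>m xi H i)
                 (enumerate 0 (sorted_list_of_set S))) $$ ab)"

definition even_part :: "nat \<Rightarrow> (nat \<Rightarrow> bool) \<Rightarrow> complex mat \<Rightarrow> complex mat" where
  "even_part N pr A = mat N N (\<lambda>(a, b). if pr a = pr b then A $$ (a, b) else 0)"

definition odd_part :: "nat \<Rightarrow> (nat \<Rightarrow> bool) \<Rightarrow> complex mat \<Rightarrow> complex mat" where
  "odd_part N pr A = mat N N (\<lambda>(a, b). if pr a = pr b then 0 else A $$ (a, b))"

text \<open>V(s) as a YQ(1)-module via phi_n:  T_{1,1}^{(k)} = (-1)^k [Sigma_k]_even,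
T_{-1,1}^{(k)} = (-1)^k [Sigma_k]_odd, and T_{-i,-j}^{(k)} = (-1)^k T_{i,j}^{(k)}.\<close>
definition V_mod :: "complex list \<Rightarrow> hmod \<Rightarrow> smod" where
  "V_mod s H = \<lparr> dim = hdim H, par = hpar H,
     act = (\<lambda>m i j.
        let E = even_part (hdim H) (hpar H) (Sigma_op s H m);
            Od = odd_part (hdim H) (hpar H) (Sigma_op s H m) in
        if i = 1 \<and> j = 1 then sgn1 m \<cdot>\<^sub>m E
        else if i = -1 \<and> j = -1 then E
        else if i = -1 \<and> j = 1 then sgn1 m \<cdot>\<^sub>m Od
        else Od) \<rparr>"

text \<open>Gamma_f, where f k is the coefficient f_{2k} of u^{-2k} (k > 0) in f(u).\<close>
definition Gamma_mod :: "(nat \<Rightarrow> complex) \<Rightarrow> smod" where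
  "Gamma_mod f = \<lparr> dim = 1, par = (\<lambda>_. False),
     act = (\<lambda>m i j. mat 1 1 (\<lambda>_. if i = j \<and> even m then f (m div 2) else 0)) \<rparr>"

definition regular :: "complex list \<Rightarrow> bool" where
  "regular s \<longleftrightarrow> (\<forall>i<length s. s ! i \<noteq> 0)"

definition typical :: "complex list \<Rightarrow> bool" where
  "typical s \<longleftrightarrow> (\<forall>i<length s. \<forall>j<length s. i \<noteq> j \<longrightarrow> s ! i + s ! j \<noteq> 0)"

end

theory Submission
  imports Defs "HOL-Computational_Algebra.Formal_Power_Series" "HOL-Computational_Algebra.Polynomial_FPS"
    "Jordan_Normal_Form.Spectral_Radius"
begin

text \<open>Let \<open>e\<close> be the coefficient of \<open>u\<^sup>-\<^sup>2\<close> in \<open>T\<^sub>1\<^sub>,\<^sub>1(u)\<close>, \<open>w\<close> the coefficient of \<open>u\<^sup>-\<^sup>1\<close> in \<open>T\<^sub>-\<^sub>1\<^sub>,\<^sub>1(u)\<close> and \<open>D = [e, \<cdot>]\<close>.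
  On a simple module the span \<open>W\<close> of all \<open>D\<^sup>n w\<close> has scalar anticommutators (by Schur's lemma), and the
  resulting bilinear form on \<open>W\<close> is nondegenerate. Peeling off eigenvectors of the rank one
  perturbation \<open>D + {\<sigma>, \<cdot>} \<sigma>\<close>, \<open>\<sigma> = - w\<close>, gives an orthogonal basis \<open>\<xi>\<^sub>i\<close> of \<open>W\<close> with \<open>\<xi>\<^sub>i\<^sup>2 = s\<^sub>i\<close> and
  \<open>\<sigma> = \<Sum> \<xi>\<^sub>i\<close>; skewness of \<open>D\<close> together with nondegeneracy forces \<open>s\<close> to be regular and typical.
  The series of \<open>V(s)\<close> built from the \<open>\<xi>\<^sub>i\<close> then differ from those of the module by a central even
  series \<open>f\<close>.

  Conversely the scalars \<open>{w, D\<^sup>n w}\<close> are isomorphism invariants whose generating series \<open>g\<close> satisfies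
  \<open>(1 + g) \<Prod>(1 - 2 s\<^sub>i X) = (1 - g) \<Prod>(1 + 2 s\<^sub>i X)\<close>, which determines a typical \<open>s\<close> up to permutation, and
  the traces of the \<open>T\<^sub>1\<^sub>,\<^sub>1\<close> coefficients determine \<open>f\<close>. Adjacent entries of \<open>s\<close> are interchanged by a linear
  substitution of two Clifford generators that preserves all series, and simple graded Clifford
  modules are unique up to parity.\<close>

section \<open>Consequences of the defining relations\<close>

text \<open>The hard point is that anticommutators of elements of \<open>W\<close> are central. The
  whole action is generated by \<open>w\<close> and the coefficients of the even-degree part
  \<open>A\<close> of T_{1,1}, so three commutations have to be checked. With \<open>e\<close>: two
  auxiliary series satisfy a closed linear system that forces them to vanish degree by degree. With
  \<open>w\<close>: this reduces to \<open>w * w\<close> commuting with \<open>W\<close>. With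
  \<open>A\<close>: on \<open>W\<close>, conjugation by \<open>A\<close> is a Cayley-type transform
  of the skew operator \<open>D\<close>, hence an isometry of the form. Simplicity of the module
  enters through Schur's lemma and through the radical of the form, which consists of anticommuting
  odd operators: their common kernel is a nonzero graded submodule, so they vanish. The rank one
  perturbation comes from computing in a Clifford tuple: there it is triangular with diagonal
  entries 2 s_i, and the generator of the last tensor factor is an eigenvector. This is why its
  eigenvalues give the weights and why sums of two eigenvalues control regularity and
  typicality.\<close>

no_notation vec_index (infixl "$" 100)
unbundle fps_syntax

text \<open>Written as repeated sums, numeral coefficients no longer sit as factors inside
  noncommutative products.\<close>

lemma numeral_times_expand:
  fixes x :: "'r::ring_1"
  shows "2 * x = x + x" "4 * x = x + x + (x + x)" "8 * x = x + x + (x + x) + (x + x + (x + x))"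
    "16 * x = 8 * x + 8 * x"
proof -
  show 2: "2 * x = x + x" for x :: 'r by (rule mult_2)
  have "4 * x = 2 * (2 * x)" by (simp flip: mult.assoc)
  then show 4: "4 * x = x + x + (x + x)" by (simp add: 2)
  have "8 * x = 2 * (4 * x)" by (simp flip: mult.assoc)
  then show 8: "8 * x = x + x + (x + x) + (x + x + (x + x))" by (simp add: 2 4)
  have "16 * x = 2 * (8 * x)" by (simp flip: mult.assoc)
  then show "16 * x = 8 * x + 8 * x" by (simp only: 2)
qed

text \<open>\<open>F\<close> measures the failure of \<open>z\<close> to commute with
  \<open>e\<close>, and \<open>G\<close> that of \<open>p * p\<close>. Their commutators with
  \<open>e\<close> form a closed linear system. Eliminating \<open>G\<close> writes
  \<open>16 * F\<close> as \<open>X * X\<close> times an expression in \<open>F\<close>, so for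
  power series all coefficients of \<open>F\<close> must vanish.\<close>

lemma commutator_recursion_elimination:
  fixes X e w p q z F G :: "'r::ring_1"
  assumes X: "\<And>y. y * X = X * y"
    and eq: "X * (e * q - q * e) = - (p + p)"
    and ep: "X * (e * p - p * e) = X * (w + w) + X * (p + p) - (q + q)"
    and wp: "w * p + p * w = - (p * p + p * p)"
    and z: "z = w * q + q * w"
    and ez: "X * (e * z - z * e) = 4 * (p * p + q * q) - 2 * (X * z)"
    and F: "F = 2 * (p * p + q * q) - X * z"
    and G: "G = p * q + q * p"
  shows "X * (e * z - z * e) = 2 * F"
    and "X * (e * (p * p) - (p * p) * e) = - 2 * G"
    and "X * (e * F - F * e) = - 8 * G - 2 * (X * F)"
    and "X * (e * G - G * e) = 2 * (X * G) - 2 * F"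
    and "16 * F = X * (X * (e * (e * F - F * e) - (e * F - F * e) * e)) - 4 * (X * (X * F))"
proof -
  have X': "\<And>a b. a * (X * b) = X * (a * b)" by (metis X mult.assoc)
  note Xs = X'[of e] X'[of p] X'[of q] X'[of w] X'[of z] X'[of F] X'[of G]
  have d: "X * (e * (a * b) - a * b * e) = X * (e * a - a * e) * b + a * (X * (e * b - b * e))" for a b
    by (simp add: algebra_simps X'[of e] X'[of a] X'[of b])
  show 1: "X * (e * z - z * e) = 2 * F"
    unfolding ez F by (simp add: algebra_simps)
  have pp: "X * (e * (p * p) - p * p * e) = X * ((w * p + p * w) + (w * p + p * w)) + 4 * (X * (p * p)) - 2 * G"
    unfolding d ep G
    by (simp add: algebra_simps Xs numeral_times_expand)
  \<comment> \<open>By \<open>wp\<close>, the doubled anticommutator of \<open>w\<close> and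
    \<open>p\<close> equals \<open>- 4 * (p * p)\<close> and cancels the middle term.\<close>
  then show 2: "X * (e * (p * p) - p * p * e) = - 2 * G"
    unfolding wp by (simp add: algebra_simps Xs numeral_times_expand)
  have qq: "X * (e * (q * q) - q * q * e) = - 2 * G"
    unfolding d eq G by (simp add: algebra_simps numeral_times_expand)
  have "X * (e * F - F * e) = 2 * (X * (e * (p * p) - p * p * e)) + 2 * (X * (e * (q * q) - q * q * e)) 
     - X * (X * (e * z - z * e))"
    unfolding F by (simp add: algebra_simps Xs numeral_times_expand)
  then show 3: "X * (e * F - F * e) = - 8 * G - 2 * (X * F)"
    unfolding 1 2 qq by (simp add: algebra_simps Xs numeral_times_expand)
  have "X * (e * G - G * e) = X * (e * (p*q) - p*q * e) + X * (e * (q*p) - q*p * e)"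
    unfolding G by (simp add: algebra_simps)
  also have "\<dots> = 2 * (X * G) - 2 * F"
    unfolding d eq ep unfolding F G z
    by (simp add: algebra_simps Xs numeral_times_expand)
  finally show 4: "X * (e * G - G * e) = 2 * (X * G) - 2 * F" .
  have "X * (X * (e * (e * F - F * e) - (e * F - F * e) * e))
      = X * (e * (X * (e * F - F * e)) - (X * (e * F - F * e)) * e)"
    by (simp add: algebra_simps Xs)
  also have "\<dots> = X * (e * (- 8 * G - 2 * (X * F)) - (- 8 * G - 2 * (X * F)) * e)"
    by (simp only: 3)
  also have "\<dots> = - 8 * (X * (e * G - G * e)) - 2 * (X * (X * (e * F - F * e)))"
    by (simp add: algebra_simps Xs numeral_times_expand)
  also have "\<dots> = 16 * F + 4 * (X * (X * F))"
    unfolding 4 arg_cong[OF 3, of "(*) X"] by (simp add: algebra_simps Xs numeral_times_expand)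
  finally show "16 * F = X * (X * (e * (e * F - F * e) - (e * F - F * e) * e)) - 4 * (X * (X * F))"
    by simp
qed

text \<open>Coefficients do not commute here, so the left and the right inverse come from separate
  recursions and are identified by associativity.\<close>

lemma fps_two_sided_inverse:
  fixes f :: "'a::ring_1 fps"
  assumes "f $ 0 = 1"
  shows "\<exists>g. g * f = 1 \<and> f * g = 1"
proof -
  have l: "fps_left_inverse f 1 * f = 1"
    by (rule fps_left_inverse) (simp add: assms)
  have r: "f * fps_right_inverse f 1 = 1"
    by (rule fps_right_inverse) (simp add: assms)
  have "fps_left_inverse f 1 = fps_left_inverse f 1 * (f * fps_right_inverse f 1)"
    by (simp add: r)
  also have "\<dots> = fps_right_inverse f 1" by (simp only: mult.assoc[symmetric] l mult_1_left)
  finally show ?thesis using l r by metis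
qed

text \<open>A complex algebra is encoded as a ring with a central unital map \<open>sc\<close>, so
  that the locale \<open>vector_space\<close> supplies spans, bases and dimensions for it.\<close>

locale calg =
  fixes sc :: "complex \<Rightarrow> 'a::ring_1"
  assumes sc_add: "sc (a + b) = sc a + sc b"
    and sc_mult: "sc (a * b) = sc a * sc b"
    and sc_one [simp]: "sc 1 = 1"
    and sc_comm: "x * sc c = sc c * x"
begin

sublocale vs: vector_space "\<lambda>c x. sc c * x"
  by unfold_locales (simp_all add: sc_add sc_mult algebra_simps)

lemma sc_zero [simp]: "sc 0 = 0"
  using sc_add[of 0 0] by simp

lemma sc_minus: "sc (- a) = - sc a"
  using sc_add[of "- a" a] by (simp add: eq_neg_iff_add_eq_0)

lemma sc_diff: "sc (a - b) = sc a - sc b"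
  using sc_add[of a "- b"] by (simp add: sc_minus)

lemma sc_sum: "sc (sum f S) = (\<Sum>x\<in>S. sc (f x))"
  by (induction S rule: infinite_finite_induct) (simp_all add: sc_add)

lemma sc_left_comm: "x * (sc c * y) = sc c * (x * y)"
  by (metis sc_comm mult.assoc)

lemma double_eq_iff: "x + x = y + y \<longleftrightarrow> x = (y::'a)"
proof
  assume "x + x = y + y"
  moreover have "u = sc (1/2) * (u + u)" for u
  proof -
    have "sc (1/2) * (u + u) = (sc (1/2) + sc (1/2)) * u" by (simp add: algebra_simps)
    also have "sc (1/2) + sc (1/2) = 1" by (simp flip: sc_add)
    finally show ?thesis by simp
  qed
  ultimately show "x = y" by metis
qed simp

lemma double_zero_iff: "x + x = 0 \<longleftrightarrow> x = (0::'a)"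
  using double_eq_iff[of x 0] by simp

lemma fps_double_eq_iff: "x + x = y + y \<longleftrightarrow> x = (y::'a fps)"
  by (metis double_eq_iff fps_add_nth fps_ext)

lemma fps_double_zero_iff: "x + x = 0 \<longleftrightarrow> x = (0::'a fps)"
  using fps_double_eq_iff[of x 0] by simp

end

lemma fps_X_central: "f * fps_X = fps_X * (f :: 'a::ring_1 fps)"
  by (simp add: fps_mult_fps_X_commute)

lemma fps_X_left_comm: "f * (fps_X * g) = fps_X * (f * (g :: 'a::ring_1 fps))"
  by (metis fps_X_central mult.assoc)

text \<open>With \<open>fps_X\<close> in the role of u^{-1}, \<open>A\<close> and \<open>B\<close>
  are the even- and odd-degree parts of T_{1,1}, and \<open>P\<close> and \<open>Q\<close> those of
  T_{-1,1}. The assumptions are the defining relations in which one of the two factors is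
  \<open>w\<close> or \<open>e\<close>.\<close>

locale yq = calg sc for sc :: "complex \<Rightarrow> 'a::ring_1" +
  fixes A B P Q :: "'a fps" and e w :: 'a
  assumes A0: "A $ 0 = 1"
    and AO: "A * fps_const w - fps_const w * A = - (P + P)"
    and QO: "Q * fps_const w + fps_const w * Q = - (B + B)"
    and PO: "P * fps_const w + fps_const w * P = 0"
    and eQ: "fps_X * (fps_const e * Q - Q * fps_const e) = - (P + P)"
    and eP: "fps_X * (fps_const e * P - P * fps_const e)
             = fps_X * (A * fps_const w + fps_const w * A) - (Q + Q)"
    and eA: "fps_const e * A = A * fps_const e"
    and eB: "fps_const e * B - B * fps_const e = Q * fps_const w - fps_const w * Q"
begin

definition Ai :: "'a fps" where "Ai = (SOME g. g * A = 1 \<and> A * g = 1)"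

lemma Ai: "Ai * A = 1" "A * Ai = 1"
  using someI_ex[OF fps_two_sided_inverse[OF A0]] unfolding Ai_def by auto

lemma Ai': "Ai * (A * y) = y" "A * (Ai * y) = y"
  by (simp_all add: Ai flip: mult.assoc)

lemma A_cancel: "A * x = A * y \<longleftrightarrow> x = y"
  by (metis Ai'(1))

text \<open>Dividing by \<open>A\<close> removes an unknown common factor: \<open>p\<close> and
  \<open>q\<close> do not change when all four series are multiplied by one invertible central
  series. This is exactly the freedom contributed by a factor \<Gamma>_f.\<close>

definition p where "p = Ai * P"
definition q where "q = Ai * Q"

lemma P_eq: "P = A * p" and Q_eq: "Q = A * q"
  by (simp_all add: p_def q_def Ai')

lemma relations_pq:
  shows AO': "A * fps_const w - fps_const w * A = - (A * p + A * p)"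
    and QO': "A * q * fps_const w + fps_const w * (A * q) = - (B + B)"
    and PO': "A * p * fps_const w + fps_const w * (A * p) = 0"
    and eQ': "fps_X * (fps_const e * (A * q) - A * q * fps_const e) = - (A * p + A * p)"
    and eP': "fps_X * (fps_const e * (A * p) - A * p * fps_const e)
             = fps_X * (A * fps_const w + fps_const w * A) - (A * q + A * q)"
    and eB': "fps_const e * B - B * fps_const e = A * q * fps_const w - fps_const w * (A * q)"
  by (simp_all only: P_eq[symmetric] Q_eq[symmetric] AO QO PO eQ eP eB)

lemma wA: "fps_const w * A = A * (fps_const w + (p + p))"
  using AO' by (simp add: algebra_simps)

lemma wA': "fps_const w * (A * y) = A * (fps_const w * y + (p * y + p * y))"
  by (simp add: wA algebra_simps flip: mult.assoc)

lemma eA': "fps_const e * (A * y) = A * (fps_const e * y)"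
  by (simp only: eA flip: mult.assoc)

lemma eq: "fps_X * (fps_const e * q - q * fps_const e) = - (p + p)"
proof -
  have "A * (fps_X * (fps_const e * q - q * fps_const e)) = A * (- (p + p))"
    using eQ' by (simp add: eA' fps_X_left_comm[of A] algebra_simps)
  then show ?thesis by (simp only: A_cancel)
qed

lemma ep: "fps_X * (fps_const e * p - p * fps_const e)
   = fps_X * (fps_const w + fps_const w) + fps_X * (p + p) - (q + q)"
proof -
  have "A * (fps_X * (fps_const e * p - p * fps_const e)) = 
     A * (fps_X * (fps_const w + fps_const w) + fps_X * (p + p) - (q + q))"
    using eP' unfolding wA by (simp add: eA' fps_X_left_comm[of A] algebra_simps del: fps_const_add)
  then show ?thesis by (simp only: A_cancel)
qed

lemma wp: "fps_const w * p + p * fps_const w = - (p * p + p * p)"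
proof -
  have "A * (fps_const w * p + p * fps_const w) = A * (- (p * p + p * p))"
    using PO' by (simp add: wA' algebra_simps) (metis add.commute add.left_commute add_eq_0_iff)
  then show ?thesis by (simp only: A_cancel)
qed

lemmas fps_Xs = fps_X_left_comm[of A] fps_X_left_comm[of p] fps_X_left_comm[of q]
  fps_X_left_comm[of "fps_const e"] fps_X_left_comm[of "fps_const w"]

definition z where "z = fps_const w * q + q * fps_const w"

text \<open>\<open>B\<close> is eliminated: \<open>QO'\<close> expresses \<open>B + B\<close>
  through \<open>z\<close> and \<open>p * q\<close>, and substituting this into \<open>eB'\<close>
  leaves a relation for the commutator of \<open>e\<close> and \<open>z\<close> alone.\<close>

lemma ez: "fps_X * (fps_const e * z - z * fps_const e) = 4 * (p * p + q * q) - 2 * (fps_X * z)"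
proof -
  let ?e = "fps_const e" and ?w = "fps_const w"
  have B: "B + B = - (A * (z + (p * q + p * q)))"
    using QO' unfolding z_def by (simp add: wA' algebra_simps eq_neg_iff_add_eq_0)
  have "?e * (B + B) - (B + B) * ?e = (A * q * ?w - ?w * (A * q)) + (A * q * ?w - ?w * (A * q))"
    using eB' by (simp add: algebra_simps)
  then have "A * (?e * z - z * ?e + ((?e * (p * q) - p * q * ?e) + (?e * (p * q) - p * q * ?e)))
     = A * (- ((q * ?w - ?w * q - (p * q + p * q)) + (q * ?w - ?w * q - (p * q + p * q))))"
    unfolding B by (simp add: wA' eA' algebra_simps)
  then have *: "?e * z - z * ?e + ((?e * (p * q) - p * q * ?e) + (?e * (p * q) - p * q * ?e))
     = - ((q * ?w - ?w * q - (p * q + p * q)) + (q * ?w - ?w * q - (p * q + p * q)))"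
    by (simp only: A_cancel)
  have d: "fps_X * (?e * (p * q) - p * q * ?e) 
     = fps_X * (?e * p - p * ?e) * q + p * (fps_X * (?e * q - q * ?e))"
    by (simp add: algebra_simps fps_Xs)
  have "fps_X * (?e * z - z * ?e) = 
      - (fps_X * (?e * (p * q) - p * q * ?e) + fps_X * (?e * (p * q) - p * q * ?e))
     - fps_X * ((q * ?w - ?w * q - (p * q + p * q)) + (q * ?w - ?w * q - (p * q + p * q)))"
    using arg_cong[OF *, of "(*) fps_X"] by (simp add: algebra_simps)
  also have "\<dots> = 4 * (p * p + q * q) - 2 * (fps_X * z)"
    unfolding d ep eq unfolding z_def
    by (simp add: algebra_simps fps_Xs numeral_times_expand del: fps_const_add)
  finally show ?thesis .
qed

lemma fps_X_mult_eq_0: "fps_X * f = 0 \<Longrightarrow> f = (0::'a fps)"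
proof (rule fps_ext)
  fix n
  assume "fps_X * f = 0"
  then have "(fps_X * f) $ Suc n = 0" by simp
  then show "f $ n = 0 $ n" by simp
qed

lemma pq_relations:
  shows z_comm: "fps_const e * z = z * fps_const e"
    and pp_comm: "fps_const e * (p * p) = p * p * fps_const e"
proof -
  define F where "F = 2 * (p * p + q * q) - fps_X * z"
  define G where "G = p * q + q * p"
  note rec = commutator_recursion_elimination[OF fps_X_central eq ep wp z_def ez F_def G_def]
  \<comment> \<open>Degrees 0 and 1 vanish because the recursion has the factor
    \<open>fps_X * fps_X\<close>; degree \<open>n\<close> reduces to degree
    \<open>n - 2\<close>.\<close>
  have "F $ n = 0" for n
  proof (induction n rule: less_induct)
    case (less n)
    have "(16 * F) $ n = 0"
    proof (cases "n < 2")
      case True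
      then have "n = 0 \<or> n = 1" by auto
      then show ?thesis unfolding rec(5) 
        by (auto simp: numeral_times_expand fps_X_mult_nth)
    next
      case False
      then obtain m where n: "n = Suc (Suc m)" by (metis add_2_eq_Suc le_Suc_ex not_less)
      have "F $ m = 0" using less n by simp
      then show ?thesis unfolding rec(5) 
        by (simp add: numeral_times_expand fps_X_mult_nth n)
    qed
    then show ?case by (simp add: numeral_times_expand double_zero_iff)
  qed
  then have F: "F = 0" by (simp add: fps_eq_iff)
  have "8 * G = 0" using rec(3) F by simp
  then have "G = 0" by (simp add: numeral_times_expand fps_double_zero_iff)
  show "fps_const e * z = z * fps_const e"
    using fps_X_mult_eq_0[of "fps_const e * z - z * fps_const e"] rec(1) F by simp
  show "fps_const e * (p * p) = p * p * fps_const e"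
    using fps_X_mult_eq_0[of "fps_const e * (p * p) - p * p * fps_const e"] rec(2) \<open>G = 0\<close> by simp
qed

end

section \<open>Anticommutators, the inner derivation \<open>der e\<close> and its cyclic
  subspaces\<close>

definition acomm :: "'r::ring_1 \<Rightarrow> 'r \<Rightarrow> 'r" where
  "acomm x y = x * y + y * x"

lemma acomm_simps:
  "acomm (x + x') y = acomm x y + acomm x' y" "acomm x (y + y') = acomm x y + acomm x y'"
  "acomm (x - x') y = acomm x y - acomm x' y" "acomm x (y - y') = acomm x y - acomm x y'"
  "acomm (- x) y = - acomm x y" "acomm x (- y) = - acomm x y"
  "acomm 0 y = 0" "acomm x 0 = 0"
  by (simp_all add: acomm_def algebra_simps)

lemma acomm_sym: "acomm x y = acomm y x"
  by (simp add: acomm_def add.commute)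

lemma acomm_central:
  assumes "\<And>y. y * c = c * y"
  shows "acomm (c * x) y = c * acomm x y" "acomm x (c * y) = c * acomm x y"
proof -
  have "y * (c * x) = c * (y * x)" for x y by (metis assms mult.assoc)
  then show "acomm (c * x) y = c * acomm x y" "acomm x (c * y) = c * acomm x y"
    by (simp_all add: acomm_def algebra_simps)
qed

lemma acomm_fps_nth:
  "acomm f g $ n = (\<Sum>i=0..n. acomm (f $ i) (g $ (n - i)))" for f g :: "'a::ring_1 fps"
proof -
  have "(g * f) $ n = (\<Sum>i=0..n. g $ (n - i) * f $ i)"
    unfolding fps_mult_nth by (subst sum.atLeastAtMost_rev) simp
  then show ?thesis by (simp add: acomm_def fps_mult_nth sum.distrib)
qed

context calg
begin

lemma sc_double_in_subspace:
  assumes "vs.subspace S" "x + x \<in> S"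
  shows "x \<in> S"
proof -
  have "sc (1/2) * (x + x) = (sc (1/2) + sc (1/2)) * x" by (simp add: algebra_simps)
  also have "sc (1/2) + sc (1/2) = 1" by (simp flip: sc_add)
  finally show ?thesis using vs.subspace_scale[OF assms, of "1/2"] by simp
qed

lemma acomm_sc: "acomm (sc c * x) y = sc c * acomm x y" "acomm x (sc c * y) = sc c * acomm x y"
  by (rule acomm_central; rule sc_comm)+

definition der :: "'a \<Rightarrow> 'a \<Rightarrow> 'a" where
  "der e y = e * y - y * e"

lemma der_simps:
  "der e (x + y) = der e x + der e y" "der e (x - y) = der e x - der e y"
  "der e (- x) = - der e x" "der e 0 = 0" "der e (sc c * x) = sc c * der e x"
  by (simp_all add: der_def algebra_simps sc_left_comm)

lemma der_acomm: "der e (acomm x y) = acomm (der e x) y + acomm x (der e y)"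
  by (simp add: der_def acomm_def algebra_simps)

definition cyc :: "'a \<Rightarrow> 'a \<Rightarrow> 'a set" where
  "cyc e w = vs.span (range (\<lambda>i. (der e ^^ i) w))"

lemma cyc_subspace: "vs.subspace (cyc e w)"
  unfolding cyc_def by (rule vs.subspace_span)

lemma cyc_gen: "(der e ^^ i) w \<in> cyc e w"
  unfolding cyc_def by (rule vs.span_base) simp

lemma cyc_base: "w \<in> cyc e w"
  using cyc_gen[where i = 0] by simp

lemma cyc_induct [consumes 1, case_names subspace base]:
  assumes "x \<in> cyc e w" "vs.subspace {x. Pr x}" "\<And>i. Pr ((der e ^^ i) w)"
  shows "Pr x"
  using assms unfolding cyc_def by (auto intro: vs.span_induct)

lemma cyc_der: "x \<in> cyc e w \<Longrightarrow> der e x \<in> cyc e w"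
proof (induction rule: cyc_induct)
  case subspace
  then show ?case using cyc_subspace[of e w]
    by (auto simp: vs.subspace_def der_simps)
next
  case (base i)
  then show ?case using cyc_gen[where i = "Suc i"] by simp
qed

lemma cyc_least:
  assumes "vs.subspace S" "w \<in> S" "\<And>x. x \<in> S \<Longrightarrow> der e x \<in> S"
  shows "cyc e w \<subseteq> S"
proof -
  have "(der e ^^ i) w \<in> S" for i by (induction i) (auto simp: assms)
  then show ?thesis unfolding cyc_def by (intro vs.span_minimal assms(1)) auto
qed

lemma commutant_subspace: "vs.subspace {x. c * x = x * c}"
  by (auto simp: vs.subspace_def algebra_simps sc_left_comm)

lemma cyc_commutant:
  assumes "c * e = e * c" "c * w = w * c" "x \<in> cyc e w"
  shows "c * x = x * c"
proof -
  have "cyc e w \<subseteq> {x. c * x = x * c}"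
  proof (rule cyc_least[OF commutant_subspace])
    fix x assume "x \<in> {x. c * x = x * c}"
    then have x: "c * x = x * c" by simp
    have "c * (e * x) = e * x * c" by (metis assms(1) x mult.assoc)
    moreover have "c * (x * e) = x * e * c" by (metis assms(1) x mult.assoc)
    ultimately show "der e x \<in> {x. c * x = x * c}" by (simp add: der_def algebra_simps)
  qed (use assms in simp)
  then show ?thesis using assms(3) by auto
qed

end

context yq
begin

abbreviation "D \<equiv> der e"
abbreviation "W \<equiv> cyc e w"

text \<open>The relations \<open>eq\<close> and \<open>ep\<close>, read coefficientwise, are a
  recursion that determines \<open>p\<close> and \<open>q\<close> from \<open>w\<close> and the
  restriction of \<open>D\<close> to \<open>W\<close>. Two families with the same \<open>w\<close>
  and the same restricted derivation therefore share \<open>p\<close> and \<open>q\<close>.\<close>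

lemma pq_nth:
  shows p0: "p $ 0 = 0" and q0: "q $ 0 = 0"
    and D_q: "D (q $ n) = - (p $ Suc n + p $ Suc n)"
    and D_p: "D (p $ n) = (if n = 0 then w + w else 0) + (p $ n + p $ n) - (q $ Suc n + q $ Suc n)"
proof -
  show "p $ 0 = 0" using arg_cong[OF eq, of "\<lambda>f. f $ 0"] by (simp add: double_zero_iff eq_commute[of 0] add_eq_0_iff2 flip: minus_add_distrib)
  show "q $ 0 = 0" using arg_cong[OF ep, of "\<lambda>f. f $ 0"] double_zero_iff[of "q $ 0"] by simp (metis add.right_inverse)
  show "D (q $ n) = - (p $ Suc n + p $ Suc n)"
    using arg_cong[OF eq, of "\<lambda>f. f $ Suc n"] by (simp add: der_def)
  show "D (p $ n) = (if n = 0 then w + w else 0) + (p $ n + p $ n) - (q $ Suc n + q $ Suc n)"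
    using arg_cong[OF ep, of "\<lambda>f. f $ Suc n"] by (simp add: der_def algebra_simps split: if_splits)
qed

lemma q1: "q $ Suc 0 = w"
proof -
  have "q $ Suc 0 + q $ Suc 0 = w + w" using D_p[of 0] by (simp add: p0 der_simps)
  then show ?thesis by (simp add: double_eq_iff)
qed

lemma pq_in_W: "p $ n \<in> W \<and> q $ n \<in> W"
proof (induction n)
  case 0
  show ?case by (simp add: p0 q0 vs.subspace_0[OF cyc_subspace])
next
  case (Suc n)
  note sub = cyc_subspace[of e w]
  have "p $ Suc n + p $ Suc n = - D (q $ n)" by (simp add: D_q)
  then have "p $ Suc n + p $ Suc n \<in> W"
    using Suc by (simp only:) (intro vs.subspace_neg[OF sub] cyc_der, simp)
  moreover have "q $ Suc n + q $ Suc n = (if n = 0 then w + w else 0) + (p $ n + p $ n) - D (p $ n)"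
    by (simp add: D_p)
  then have "q $ Suc n + q $ Suc n \<in> W"
    using Suc by (simp only:) (intro vs.subspace_diff[OF sub] vs.subspace_add[OF sub] cyc_der,
      auto intro!: vs.subspace_add[OF sub] vs.subspace_0[OF sub] cyc_base)
  ultimately show ?case by (auto intro: sc_double_in_subspace[OF sub])
qed

text \<open>Identities between the series \<open>p\<close>, \<open>q\<close> and \<open>z\<close>
  can reach all of \<open>W\<close> only because their coefficients already span it.\<close>

lemma W_span_pq: "W \<subseteq> vs.span (range (($) p) \<union> range (($) q))"
proof (rule cyc_least)
  let ?S = "vs.span (range (($) p) \<union> range (($) q))"
  have qS: "q $ n \<in> ?S" and pS: "p $ n \<in> ?S" for n by (auto intro: vs.span_base)
  show "w \<in> ?S" using qS[of "Suc 0"] by (simp add: q1)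
  then have wS: "w \<in> ?S" .
  have sub: "vs.subspace {x. D x \<in> ?S}"
    by (auto simp: vs.subspace_def der_simps intro: vs.span_add vs.span_scale vs.span_zero)
  show "D x \<in> ?S" if "x \<in> ?S" for x
    using that
  proof (rule vs.span_induct[OF _ sub])
    fix x assume "x \<in> range (($) p) \<union> range (($) q)"
    then consider n where "x = p $ n" | n where "x = q $ n" by blast
    then show "D x \<in> ?S"
      by cases (auto simp: D_p D_q simp del: minus_add_distrib 
          intro!: vs.span_add vs.span_diff vs.span_neg qS pS wS vs.span_zero)
  qed
qed simp

text \<open>On the spanning coefficients, the anticommutator with \<open>w\<close> is by
  \<open>wp\<close> a coefficient of \<open>- (p * p + p * p)\<close>, or else a coefficient of
  \<open>z\<close>; both series commute with \<open>e\<close>.\<close>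

lemma D_acomm_w: "y \<in> W \<Longrightarrow> D (acomm w y) = 0"
proof -
  assume "y \<in> W"
  then have "y \<in> vs.span (range (($) p) \<union> range (($) q))" using W_span_pq by blast
  then show ?thesis
  proof (rule vs.span_induct)
    show "vs.subspace {y. D (acomm w y) = 0}"
      by (auto simp: vs.subspace_def acomm_simps der_simps acomm_sc)
    fix y assume "y \<in> range (($) p) \<union> range (($) q)"
    then consider n where "y = p $ n" | n where "y = q $ n" by blast
    then show "D (acomm w y) = 0"
    proof cases
      case 1
      have "fps_const e * (fps_const w * p + p * fps_const w) = (fps_const w * p + p * fps_const w) * fps_const e"
        unfolding wp by (simp only: minus_mult_right[symmetric] minus_mult_left[symmetric] distrib_left distrib_right pp_comm)
      from arg_cong[OF this, of "\<lambda>f. f $ n"] show ?thesis unfolding 1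
        by (simp add: der_def acomm_def)
    next
      case 2
      from arg_cong[OF z_comm, of "\<lambda>f. f $ n"] show ?thesis unfolding 2
        by (simp add: der_def acomm_def z_def)
    qed
  qed
qed

text \<open>The Leibniz rule for \<open>acomm\<close> trades one application of \<open>D\<close> on
  the left argument for one on the right.\<close>

lemma acomm_D_skew_gen: "y \<in> W \<Longrightarrow> D (acomm ((D ^^ i) w) y) = 0"
proof (induction i arbitrary: y)
  case 0
  then show ?case by (simp add: D_acomm_w)
next
  case (Suc i)
  have "acomm ((D ^^ Suc i) w) y = D (acomm ((D ^^ i) w) y) - acomm ((D ^^ i) w) (D y)"
    by (simp add: der_acomm)
  then show ?case using Suc.IH[OF Suc.prems] Suc.IH[OF cyc_der[OF Suc.prems]] by (simp add: der_simps)
qed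

lemma D_acomm: "x \<in> W \<Longrightarrow> y \<in> W \<Longrightarrow> D (acomm x y) = 0"
  by (induction rule: cyc_induct)
    (auto simp: vs.subspace_def acomm_simps der_simps acomm_sc acomm_D_skew_gen)

lemma skew: "x \<in> W \<Longrightarrow> y \<in> W \<Longrightarrow> acomm (D x) y = - acomm x (D y)"
  using D_acomm[of x y] by (simp add: der_acomm eq_neg_iff_add_eq_0)

text \<open>For \<open>i = 0\<close>, \<open>w * w\<close> commutes with \<open>e\<close> and
  \<open>w\<close>, hence with \<open>W\<close>, and expanding \<open>acomm w y\<close> then
  suffices. For larger \<open>i\<close>, skewness moves each \<open>D\<close> over to
  \<open>y\<close>.\<close>

lemma acomm_comm_w_gen: "y \<in> W \<Longrightarrow> acomm ((D ^^ i) w) y * w = w * acomm ((D ^^ i) w) y"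
proof (induction i arbitrary: y)
  case 0
  have "D (w * w) + D (w * w) = 0"
    using D_acomm_w[OF cyc_base] by (simp add: acomm_def der_simps)
  then have "D (w * w) = 0" by (simp add: double_zero_iff)
  then have "(w * w) * e = e * (w * w)" by (simp add: der_def)
  from cyc_commutant[OF this _ 0] have "(w * w) * y = y * (w * w)" by (simp add: mult.assoc)
  then show ?case by (simp add: acomm_def algebra_simps)
next
  case (Suc i)
  have "acomm ((D ^^ Suc i) w) y = - acomm ((D ^^ i) w) (D y)"
    using skew[OF cyc_gen Suc.prems, of i] by simp
  then show ?case using Suc.IH[OF cyc_der[OF Suc.prems]] by simp
qed

lemma acomm_comm_w: "x \<in> W \<Longrightarrow> y \<in> W \<Longrightarrow> acomm x y * w = w * acomm x y"
proof (induction rule: cyc_induct)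
  case subspace
  then show ?case
    by (auto simp: vs.subspace_def acomm_simps acomm_sc algebra_simps sc_left_comm)
qed (simp add: acomm_comm_w_gen)

end

section \<open>Conjugation by \<open>A\<close> is an isometry of \<open>W\<close>\<close>

context yq
begin

definition tau :: "'a fps \<Rightarrow> 'a fps" where "tau y = Ai * y * A"

definition fD :: "'a fps \<Rightarrow> 'a fps" where "fD f = fps_const e * f - f * fps_const e"

lemma fD_nth: "fD f $ n = D (f $ n)"
  by (simp add: fD_def der_def)

lemma fD_simps: "fD (x + y) = fD x + fD y" "fD (x - y) = fD x - fD y" "fD (- x) = - fD x"
  "fD (fps_X * x) = fps_X * fD x" "fD (fps_const a) = fps_const (D a)"
  by (simp_all add: fps_eq_iff fD_nth der_simps fps_X_mult_nth)

lemma tau_simps: "tau (x + y) = tau x + tau y" "tau (x - y) = tau x - tau y" "tau (- x) = - tau x"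
  "tau (x * y) = tau x * tau y" "tau (fps_X * x) = fps_X * tau x" "tau 0 = 0"
  by (simp_all add: tau_def algebra_simps Ai' fps_X_left_comm[of Ai])

lemma tau_sc: "tau (fps_const (sc c * y)) = fps_const (sc c) * tau (fps_const y)"
proof -
  have "Ai * fps_const (sc c) = fps_const (sc c) * Ai"
    by (rule fps_ext) (simp add: sc_comm)
  then have "Ai * (fps_const (sc c) * u) = fps_const (sc c) * (Ai * u)" for u
    by (simp flip: mult.assoc)
  then show ?thesis by (simp add: tau_def mult.assoc flip: fps_const_mult)
qed

lemma eAi: "fps_const e * Ai = Ai * fps_const e"
proof -
  have "Ai * (fps_const e * A) * Ai = Ai * (A * fps_const e) * Ai" by (simp add: eA)
  then show ?thesis by (simp add: Ai Ai' mult.assoc)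
qed

lemma fD_tau: "fD (tau y) = tau (fD y)"
proof -
  have "fps_const e * (Ai * u) = Ai * (fps_const e * u)" for u
    by (simp only: eAi flip: mult.assoc)
  then show ?thesis by (simp add: fD_def tau_def algebra_simps eA)
qed

lemma tau_w: "tau (fps_const w) = fps_const w + (p + p)"
  unfolding tau_def by (simp add: mult.assoc wA Ai')

text \<open>Skewness of \<open>D\<close> makes D^2 + 2D and D^2 - 2D adjoint to each other for the
  anticommutator form.\<close>

definition Sp where "Sp f = fD (fD f) + (fD f + fD f)"
definition Sm where "Sm f = fD (fD f) - (fD f + fD f)"

lemma Spm_simps:
  "Sp (x + y) = Sp x + Sp y" "Sm (x + y) = Sm x + Sm y"
  "tau (Sp x) = Sp (tau x)" "fD (Sp x) = Sp (fD x)" "fD (Sm x) = Sm (fD x)"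
  by (simp_all add: Sp_def Sm_def fD_simps tau_simps fD_tau)

text \<open>Here \<open>tau (fps_const w)\<close> is \<open>fps_const w + (p + p)\<close>, and
  eliminating \<open>q\<close> between \<open>eq\<close> and \<open>ep\<close> leaves a second-order
  equation for \<open>p\<close>. The statement is that equation, written symmetrically.\<close>

lemma tau_rec_w:
  "4 * tau (fps_const w) - fps_X * (fps_X * Sm (tau (fps_const w)))
   = 4 * fps_const w - fps_X * (fps_X * Sp (fps_const w))"
proof -
  have q: "fps_X * fD q = - (p + p)" using eq by (simp add: fD_def)
  have p: "fps_X * fD p = fps_X * (fps_const w + fps_const w) + fps_X * (p + p) - (q + q)"
    using ep by (simp add: fD_def)
  have "fps_X * (fps_X * fD (fD p)) = fps_X * fD (fps_X * fD p)"
    by (simp add: fD_simps)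
  also have "\<dots> = fps_X * (fps_X * (fD (fps_const w) + fD (fps_const w))) + fps_X * (fps_X * (fD p + fD p)) - (fps_X * fD q + fps_X * fD q)"
    unfolding p by (simp add: fD_simps algebra_simps del: fps_const_add)
  finally have pp: "fps_X * (fps_X * fD (fD p)) = fps_X * (fps_X * (fD (fps_const w) + fD (fps_const w))) + fps_X * (fps_X * (fD p + fD p)) + (p + p + (p + p))"
    unfolding q by (simp add: algebra_simps)
  have "fps_X * (fps_X * Sm (tau (fps_const w))) = fps_X * (fps_X * Sm (fps_const w))
     + (fps_X * (fps_X * fD (fD p)) + fps_X * (fps_X * fD (fD p)))
     - (fps_X * (fps_X * (fD p + fD p)) + fps_X * (fps_X * (fD p + fD p)))"
    unfolding tau_w Spm_simps by (simp add: Sm_def algebra_simps fD_simps(1-4))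
  then show ?thesis unfolding tau_w pp
    by (simp add: Sm_def Sp_def numeral_times_expand algebra_simps fD_simps(1-4) del: fps_const_add)
qed

lemma fD_four: "fD (4 * f) = 4 * fD f"
  by (simp add: numeral_times_expand fD_simps)

text \<open>Formally, with X for \<open>fps_X\<close>, \<open>tau\<close> is the quotient of 4 - X^2
  (D^2 + 2D) by 4 - X^2 (D^2 - 2D). Both sides are linear in \<open>y\<close> and compatible with
  \<open>fD\<close>, so the case \<open>y = w\<close> spreads to the cyclic space.\<close>

lemma tau_rec:
  assumes "y \<in> W"
  shows "4 * tau (fps_const y) - fps_X * (fps_X * Sm (tau (fps_const y)))
   = 4 * fps_const y - fps_X * (fps_X * Sp (fps_const y))" (is "?L y = ?R y")
  using assms
proof (induction rule: cyc_induct)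
  case subspace
  have sc: "fps_X * (fps_const (sc c) * f) = fps_const (sc c) * (fps_X * f)" for c f
    by (rule fps_X_left_comm[symmetric])
  have fDc: "fD (fps_const (sc c) * f) = fps_const (sc c) * fD f" for c f
    by (rule fps_ext) (simp add: fD_nth der_simps)
  have Lsc: "?L (sc c * y) = fps_const (sc c) * ?L y" for c y
    by (simp add: tau_sc Sm_def fDc sc numeral_times_expand algebra_simps)
  have Rsc: "?R (sc c * y) = fps_const (sc c) * ?R y" for c y
    by (simp only: fps_const_mult[symmetric] Sp_def fDc sc numeral_times_expand algebra_simps)
  have Ladd: "?L (x + y) = ?L x + ?L y" for x y
    by (simp only: fps_const_add[symmetric] tau_simps Spm_simps numeral_times_expand) (simp add: algebra_simps del: fps_const_add)
  have Radd: "?R (x + y) = ?R x + ?R y" for x y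
    by (simp only: fps_const_add[symmetric] Spm_simps numeral_times_expand) (simp add: algebra_simps del: fps_const_add)
  have "?L 0 = ?R 0" by (simp add: tau_simps Sm_def Sp_def fD_def)
  then show ?case unfolding vs.subspace_def mem_Collect_eq Lsc Rsc Ladd Radd by simp
next
  case (base i)
  show ?case
  proof (induction i)
    case 0
    then show ?case using tau_rec_w by simp
  next
    case (Suc i)
    have *: "fD (?L y) = ?L (D y)" "fD (?R y) = ?R (D y)" for y
      by (simp_all only: fD_simps fD_four Spm_simps fD_tau)
    show ?case using arg_cong[OF Suc.IH, of fD] unfolding * by simp
  qed
qed

text \<open>The recursion obtains coefficient \<open>n\<close> from \<open>y\<close> and from
  coefficient \<open>n - 2\<close> by means of \<open>D\<close> only. Besides \<open>W\<close>
  itself, the subspace that matters is the radical of the form.\<close>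

lemma tau_nth_in:
  assumes S: "vs.subspace S" and SW: "S \<subseteq> W" and SD: "\<And>x. x \<in> S \<Longrightarrow> D x \<in> S" and y: "y \<in> S"
  shows "tau (fps_const y) $ n \<in> S"
proof (induction n rule: less_induct)
  case (less n)
  let ?t = "tau (fps_const y)"
  have "4 * ?t = 4 * fps_const y - fps_X * (fps_X * Sp (fps_const y)) + fps_X * (fps_X * Sm ?t)"
    using tau_rec[of y] y SW by (auto simp: algebra_simps)
  from arg_cong[OF this, of "\<lambda>f. f $ n"] 
  have eqn: "?t $ n + ?t $ n + (?t $ n + ?t $ n) =
     (4 * fps_const y - fps_X * (fps_X * Sp (fps_const y)) + fps_X * (fps_X * Sm ?t)) $ n"
    by (simp add: numeral_times_expand)
  have "(4 * fps_const y - fps_X * (fps_X * Sp (fps_const y)) + fps_X * (fps_X * Sm ?t)) $ n \<in> S"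
  proof -
    have 1: "(4 * fps_const y) $ n \<in> S"
      using y by (auto simp: numeral_times_expand intro!: vs.subspace_add[OF S] vs.subspace_0[OF S])
    have sp: "Sp f $ k \<in> S" if "f $ k \<in> S" for f k
      using that by (auto simp: Sp_def fD_nth intro!: vs.subspace_add[OF S] SD)
    have sm: "Sm f $ k \<in> S" if "f $ k \<in> S" for f k
      using that by (auto simp: Sm_def fD_nth intro!: vs.subspace_diff[OF S] vs.subspace_add[OF S] SD)
    have 2: "(fps_X * (fps_X * Sp (fps_const y))) $ n \<in> S"
      using y vs.subspace_0[OF S] by (auto simp: fps_X_mult_nth intro!: sp)
    have 3: "(fps_X * (fps_X * Sm ?t)) $ n \<in> S"
      using less vs.subspace_0[OF S] by (auto simp: fps_X_mult_nth intro!: sm)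
    show ?thesis using vs.subspace_add[OF S vs.subspace_diff[OF S 1 2] 3] by (simp only: fps_sub_nth fps_add_nth)
  qed
  then show ?case unfolding eqn[symmetric] by (rule sc_double_in_subspace[OF S sc_double_in_subspace[OF S]])
qed

lemma fD_skew:
  assumes "\<And>n. f $ n \<in> W" "\<And>n. g $ n \<in> W"
  shows "acomm (fD f) g = - acomm f (fD g)"
  by (rule fps_ext) (simp add: acomm_fps_nth fD_nth skew assms sum_negf)

lemma acomm_four: "acomm (4 * x) y = 4 * acomm x y" "acomm x (4 * y) = 4 * acomm x y"
  by (simp_all add: numeral_times_expand acomm_simps)

text \<open>The numerator and denominator of the transform are mutually adjoint and commute, so it
  preserves the form. No inverse is taken: the defect \<open>G\<close> satisfies
  \<open>4 * G y = fps_X * (fps_X * G (Spc y))\<close> and vanishes by induction on the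
  degree.\<close>

lemma tau_acomm:
  assumes x: "x \<in> W" and y: "y \<in> W"
  shows "tau (acomm (fps_const x) (fps_const y)) = acomm (fps_const x) (fps_const y)"
proof -
  define G where "G y = acomm (tau (fps_const x)) (tau (fps_const y)) - acomm (fps_const x) (fps_const y)" for y
  have W: "tau (fps_const u) $ n \<in> W" if "u \<in> W" for u n
    by (rule tau_nth_in[OF cyc_subspace subset_refl cyc_der that])
  have fDW: "fD f $ n \<in> W" if "\<And>n. f $ n \<in> W" for f n
    using that by (simp add: fD_nth cyc_der)
  have cW: "fps_const u $ n \<in> W" if "u \<in> W" for u n
    using that vs.subspace_0[OF cyc_subspace] by simp
  have sk: "acomm (Sm f) g = acomm f (Sp g)" "acomm (Sp f) g = acomm f (Sm g)" 
    if "\<And>n. f $ n \<in> W" "\<And>n. g $ n \<in> W" for f g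
    using that by (simp_all add: Sm_def Sp_def acomm_simps fD_skew fDW)
  have Xc: "acomm (fps_X * f) g = fps_X * acomm f g" "acomm f (fps_X * g) = fps_X * acomm f g" for f g :: "'a fps"
    by (rule acomm_central; rule fps_X_central)+
  define Spc where "Spc y = D (D y) + (D y + D y)" for y
  have Spc: "Sp (fps_const y) = fps_const (Spc y)" for y
    by (rule fps_ext) (simp add: Sp_def fD_nth Spc_def der_simps)
  have rec: "4 * G y = fps_X * (fps_X * G (Spc y))" if y: "y \<in> W" for y
  proof -
    let ?t = "tau (fps_const x)" and ?u = "tau (fps_const y)" and ?x = "fps_const x" and ?y = "fps_const y"
    \<comment> \<open>One value is computed twice: through the recursion for \<open>x\<close>,
      adjointness and the recursion for \<open>y\<close>; and through adjointness alone.\<close>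
    have "acomm (4 * ?t - fps_X * (fps_X * Sm ?t)) ?u = acomm (4 * ?x - fps_X * (fps_X * Sp ?x)) ?u"
      by (simp only: tau_rec[OF x])
    also have "\<dots> = acomm ?x (4 * ?u - fps_X * (fps_X * Sm ?u))"
      by (simp only: acomm_simps acomm_four Xc sk[OF cW[OF x] W[OF y]])
    also have "\<dots> = acomm ?x (4 * ?y - fps_X * (fps_X * Sp ?y))"
      by (simp only: tau_rec[OF y])
    also have "acomm (4 * ?t - fps_X * (fps_X * Sm ?t)) ?u = acomm ?t (4 * ?u - fps_X * (fps_X * Sp ?u))"
      by (simp only: acomm_simps acomm_four Xc sk[OF W[OF x] W[OF y]])
    finally show ?thesis
      unfolding G_def Spc[symmetric] Spm_simps
      by (simp add: acomm_simps acomm_four Xc algebra_simps)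
  qed
  have "G y $ n = 0" if "y \<in> W" for n y
    using that
  proof (induction n arbitrary: y rule: less_induct)
    case (less n)
    have "Spc y \<in> W" unfolding Spc_def
      by (intro vs.subspace_add[OF cyc_subspace] cyc_der less.prems)
    then have "(fps_X * (fps_X * G (Spc y))) $ n = 0"
      using less.IH by (auto simp: fps_X_mult_nth)
    then have "(4 * G y) $ n = 0" by (simp only: rec[OF less.prems])
    then show ?case by (simp add: numeral_times_expand double_zero_iff)
  qed
  then have "G y = 0" using y by (auto simp: fps_eq_iff)
  then show ?thesis unfolding G_def acomm_def by (simp add: tau_simps del: fps_const_mult fps_const_add)
qed

lemma acomm_comm_A:
  assumes "x \<in> W" "y \<in> W"
  shows "acomm x y * A $ n = A $ n * acomm x y"
proof -
  have c: "acomm (fps_const x) (fps_const y) = fps_const (acomm x y)"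
    by (simp add: acomm_def)
  have "A * tau (fps_const (acomm x y)) = A * fps_const (acomm x y)"
    using tau_acomm[OF assms] unfolding c by simp
  then have "fps_const (acomm x y) * A = A * fps_const (acomm x y)"
    by (simp add: tau_def Ai' mult.assoc)
  from arg_cong[OF this, of "\<lambda>f. f $ n"] show ?thesis by simp
qed

text \<open>Moving \<open>y\<close> to the right of a coefficient of \<open>A\<close> costs only
  coefficients of \<open>tau\<close>. Hence the common kernel of a \<open>D\<close>-stable subspace
  of \<open>W\<close> is stable under \<open>A\<close>.\<close>

lemma mult_A_nth:
  "y * A $ n = (\<Sum>i=0..n. A $ i * tau (fps_const y) $ (n - i))"
proof -
  have "fps_const y * A = A * tau (fps_const y)" by (simp add: tau_def Ai' mult.assoc)
  from arg_cong[OF this, of "\<lambda>f. f $ n"] show ?thesis by (simp only: fps_mult_left_const_nth fps_mult_nth[of A])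
qed

end

section \<open>The series of a Clifford tuple\<close>

text \<open>One tensor factor \<open>V(x)\<close> is appended on the right; the formulas for the new series come from
  the coproduct, the new odd generator being \<open>\<xi>\<close> with \<open>\<xi>\<^sup>2 = x\<close>.\<close>

lemma relations_append:
  fixes X x k A B P Q e w \<xi> :: "'r::ring_1"
  assumes X: "\<And>y. y * X = X * y" and x: "\<And>y. y * x = x * y" and k: "\<And>y. y * k = k * y"
    and \<xi>: "\<xi> * \<xi> = x" "\<xi> * A = A * \<xi>" "\<xi> * B = B * \<xi>" "\<xi> * P = - (P * \<xi>)" "\<xi> * Q = - (Q * \<xi>)"
      "\<xi> * e = e * \<xi>" "\<xi> * w = - (w * \<xi>)"
    and AO: "A * w - w * A = - (P + P)"
    and BO: "w * B = B * w"
    and QO: "Q * w + w * Q = - (B + B)"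
    and PO: "P * w + w * P = 0"
    and eQ: "X * (e * Q - Q * e) = - (P + P)"
    and eP: "X * (e * P - P * e) = X * (A * w + w * A) - (Q + Q)"
    and eA: "e * A = A * e"
    and eB: "e * B - B * e = Q * w - w * Q"
    and A': "A' = A - X * (x * B) + X * (Q * \<xi>)"
    and B': "B' = B - X * (x * A) + X * (P * \<xi>)"
    and P': "P' = P + X * (x * Q) - X * (B * \<xi>)"
    and Q': "Q' = Q + X * (x * P) - X * (A * \<xi>)"
    and e': "e' = e + w * \<xi> + k" and w': "w' = w - \<xi>"
  shows "A' * w' - w' * A' = - (P' + P')" (is ?AO)
    and "w' * B' = B' * w'" (is ?BO)
    and "Q' * w' + w' * Q' = - (B' + B')" (is ?QO)
    and "P' * w' + w' * P' = 0" (is ?PO)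
    and "X * (e' * Q' - Q' * e') = - (P' + P')" (is ?eQ)
    and "X * (e' * P' - P' * e') = X * (A' * w' + w' * A') - (Q' + Q')" (is ?eP)
    and "e' * A' = A' * e'" (is ?eA)
    and "e' * B' - B' * e' = Q' * w' - w' * Q'" (is ?eB)
proof -
  have ext: "a * (b * y) = c * y" if "a * b = c" for a b c y :: 'r
    using that by (simp flip: mult.assoc)
  have Xl: "a * (X * b) = X * (a * b)" for a b by (metis X mult.assoc)
  have xl: "a * (x * b) = x * (a * b)" for a b by (metis x mult.assoc)
  \<comment> \<open>Central elements are moved to the front only past the listed letters;
    unrestricted rules of this kind would loop.\<close>
  note XX = Xl[of A] Xl[of B] Xl[of P] Xl[of Q] Xl[of e] Xl[of w] Xl[of \<xi>] X[of A] X[of B] X[of P] X[of Q]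
    X[of e] X[of w] X[of \<xi>]
  note xx = xl[of A] xl[of B] xl[of P] xl[of Q] xl[of e] xl[of w] xl[of \<xi>] xl[of X] x[of A] x[of B] x[of P] x[of Q]
    x[of e] x[of w] x[of \<xi>] x[of X]
  have kA: "a * (k * b) = k * (a * b)" for a b by (metis k mult.assoc)
  have kl: "k * A' = A' * k" "k * B' = B' * k" "k * P' = P' * k" "k * Q' = Q' * k" by (simp_all add: k)
  have 1: "w * A = A * w + (P + P)" using AO by (simp add: algebra_simps)
  have 2: "w * Q = - (Q * w) - (B + B)" using QO by (simp add: algebra_simps eq_neg_iff_add_eq_0)
  have 3: "w * P = - (P * w)" using PO by (simp add: eq_neg_iff_add_eq_0 add.commute)
  have 4: "X * (e * Q) = X * (Q * e) - (P + P)" using eQ by (simp add: algebra_simps)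
  have 5: "X * (e * P) = X * (P * e) + X * (A * w + A * w + (P + P)) - (Q + Q)"
    using eP unfolding 1 by (simp add: algebra_simps)
  have 6: "e * B = B * e + (Q * w + Q * w + (B + B))"
    using eB unfolding 2 by (simp add: algebra_simps)
  \<comment> \<open>The relations \<open>4\<close> and \<open>5\<close> hold only behind a factor
    \<open>X\<close>, so their right-multiplied forms must carry that factor along.\<close>
  have q4: "X * (e * (Q * y)) = X * (Q * (e * y)) - (P * y + P * y)" for y
    using arg_cong[OF 4, of "\<lambda>t. t * y"] by (simp add: algebra_simps)
  have q5: "X * (e * (P * y)) = X * (P * (e * y)) + X * (A * (w * y) + A * (w * y) + (P * y + P * y)) - (Q * y + Q * y)" for y
    using arg_cong[OF 5, of "\<lambda>t. t * y"] by (simp add: algebra_simps)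
  note R = 1 2 3 4 5 6 q4 q5 eA BO \<xi> ext[OF 1] ext[OF 2] ext[OF 3] ext[OF 6] ext[OF eA] ext[OF BO]
    ext[OF \<xi>(1)] ext[OF \<xi>(2)] ext[OF \<xi>(3)] ext[OF \<xi>(4)] ext[OF \<xi>(5)] ext[OF \<xi>(6)] ext[OF \<xi>(7)]
  note S = algebra_simps XX xx R
  show ?AO unfolding A' P' w' by (simp add: S)
  show ?BO unfolding B' w' by (simp add: S)
  show ?QO unfolding B' Q' w' by (simp add: S)
  show ?PO unfolding P' w' by (simp add: S)
  have kk: "(u + k) * y - y * (u + k) = u * y - y * u" for u y by (simp add: algebra_simps k)
  show ?eQ unfolding e' kk unfolding P' Q' by (simp add: S)
  show ?eP unfolding e' kk unfolding P' Q' A' w' by (simp add: S)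
  have "(e + w * \<xi>) * A' - A' * (e + w * \<xi>) = 0"
    unfolding A' by (simp add: S)
  then show ?eA unfolding e' by (simp add: algebra_simps k)
  show ?eB unfolding e' kk unfolding Q' B' w' by (simp add: S)
qed

lemma mult_eq_assoc:
  fixes a b c d :: "'r::ring_1"
  shows "a * b = c * d \<Longrightarrow> a * (b * y) = c * (d * y)"
    and "a * b = - (c * d) \<Longrightarrow> a * (b * y) = - (c * (d * y))"
  by (simp_all flip: mult.assoc)

context calg
begin

text \<open>These are the even- and odd-degree parts of T_{1,1} and of T_{-1,1} on V(s). The head of
  the list is the rightmost tensor factor, so the weights are stored in reverse order.\<close>

fun vA and vB and vP and vQ :: "(complex \<times> 'a) list \<Rightarrow> 'a fps" where
  "vA [] = 1"
| "vA ((x, \<xi>) # L) = vA L - fps_X * (fps_const (sc x) * vB L) + fps_X * (vQ L * fps_const \<xi>)"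
| "vB [] = 0"
| "vB ((x, \<xi>) # L) = vB L - fps_X * (fps_const (sc x) * vA L) + fps_X * (vP L * fps_const \<xi>)"
| "vP [] = 0"
| "vP ((x, \<xi>) # L) = vP L + fps_X * (fps_const (sc x) * vQ L) - fps_X * (vB L * fps_const \<xi>)"
| "vQ [] = 0"
| "vQ ((x, \<xi>) # L) = vQ L + fps_X * (fps_const (sc x) * vP L) - fps_X * (vA L * fps_const \<xi>)"

fun clif :: "(complex \<times> 'a) list \<Rightarrow> bool" where
  "clif [] = True"
| "clif ((x, \<xi>) # L) \<longleftrightarrow> \<xi> * \<xi> = sc x \<and> (\<forall>\<eta>\<in>snd ` set L. \<xi> * \<eta> = - (\<eta> * \<xi>)) \<and> clif L"

abbreviation "ve L \<equiv> vA L $ 2"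
abbreviation "vw L \<equiv> vQ L $ Suc 0"

lemma v_nth_low: "vA L $ 0 = 1 \<and> vB L $ 0 = 0 \<and> vP L $ 0 = 0 \<and> vQ L $ 0 = 0 \<and>
    vP L $ Suc 0 = 0 \<and> vB L $ Suc 0 = sc (- sum_list (map fst L)) \<and> vQ L $ Suc 0 = - sum_list (map snd L)"
  by (induction L) (auto simp: sc_minus sc_add sc_diff algebra_simps)

lemma ve_Cons: "ve ((x, \<xi>) # L) = ve L + vw L * \<xi> + sc (x * sum_list (map fst L))"
  by (simp add: v_nth_low numeral_2_eq_2 sc_minus sc_mult)

lemma vw_Cons: "vw ((x, \<xi>) # L) = vw L - \<xi>"
  by (simp add: v_nth_low)

text \<open>\<open>vA\<close> and \<open>vB\<close> are even polynomials in the generators,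
  \<open>vP\<close> and \<open>vQ\<close> odd ones. This is what the step that appends a generator
  requires of the new one.\<close>

lemma v_commute:
  assumes "\<forall>\<eta>\<in>snd ` set L. \<zeta> * \<eta> = - (\<eta> * \<zeta>)"
  shows "fps_const \<zeta> * vA L = vA L * fps_const \<zeta> \<and> fps_const \<zeta> * vB L = vB L * fps_const \<zeta> \<and>
    fps_const \<zeta> * vP L = - (vP L * fps_const \<zeta>) \<and> fps_const \<zeta> * vQ L = - (vQ L * fps_const \<zeta>)"
  using assms
proof (induction L)
  case (Cons a L)
  obtain x \<xi> where a: "a = (x, \<xi>)" by force
  let ?z = "fps_const \<zeta>" and ?k = "fps_const \<xi>"
  have "\<zeta> * \<xi> = - (\<xi> * \<zeta>)" using Cons.prems by (simp add: a)
  then have 1: "?z * ?k = - (?k * ?z)" by simp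
  note q1 = mult_eq_assoc(2)[OF 1]
  have IH: "?z * vA L = vA L * ?z" "?z * vB L = vB L * ?z"
    "?z * vP L = - (vP L * ?z)" "?z * vQ L = - (vQ L * ?z)"
    using Cons by auto
  note IH' = mult_eq_assoc(1)[OF IH(1)] mult_eq_assoc(1)[OF IH(2)]
    mult_eq_assoc(2)[OF IH(3)] mult_eq_assoc(2)[OF IH(4)]
  have c: "?z * (fps_const (sc x) * y) = fps_const (sc x) * (?z * y)" for y
    by (simp add: sc_comm flip: mult.assoc)
  show ?case unfolding a
    by (simp add: algebra_simps IH IH' c 1 q1 fps_X_left_comm[of ?z] del: fps_const_mult)
qed simp

lemma v_relations:
  assumes "clif L"
  shows "vA L * fps_const (vw L) - fps_const (vw L) * vA L = - (vP L + vP L)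
    \<and> fps_const (vw L) * vB L = vB L * fps_const (vw L)
    \<and> vQ L * fps_const (vw L) + fps_const (vw L) * vQ L = - (vB L + vB L)
    \<and> vP L * fps_const (vw L) + fps_const (vw L) * vP L = 0
    \<and> fps_X * (fps_const (ve L) * vQ L - vQ L * fps_const (ve L)) = - (vP L + vP L)
    \<and> fps_X * (fps_const (ve L) * vP L - vP L * fps_const (ve L))
             = fps_X * (vA L * fps_const (vw L) + fps_const (vw L) * vA L) - (vQ L + vQ L)
    \<and> fps_const (ve L) * vA L = vA L * fps_const (ve L)
    \<and> fps_const (ve L) * vB L - vB L * fps_const (ve L) = vQ L * fps_const (vw L) - fps_const (vw L) * vQ L"
  using assms
proof (induction L)
  case (Cons a L)
  obtain x \<xi> where a: "a = (x, \<xi>)" by force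
  from Cons.prems have c: "\<xi> * \<xi> = sc x" "\<forall>\<eta>\<in>snd ` set L. \<xi> * \<eta> = - (\<eta> * \<xi>)" "clif L"
    by (auto simp: a)
  note IH = Cons.IH[OF c(3)]
  note com = v_commute[OF c(2)]
  have e: "\<xi> * ve L = ve L * \<xi>" using arg_cong[OF conjunct1[OF com], of "\<lambda>f. f $ 2"] by simp
  have w: "\<xi> * vw L = - (vw L * \<xi>)" using com by (auto simp: fps_eq_iff)
  have e': "fps_const (ve (a # L)) = fps_const (ve L) + fps_const (vw L) * fps_const \<xi>
      + fps_const (sc (x * sum_list (map fst L)))"
    unfolding a ve_Cons by simp
  have w': "fps_const (vw (a # L)) = fps_const (vw L) - fps_const \<xi>"
    unfolding a vw_Cons by simp
  have ctr: "y * fps_const (sc d) = fps_const (sc d) * y" for y d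
    by (rule fps_ext) (simp add: sc_comm)
  have k1: "fps_const \<xi> * fps_const \<xi> = fps_const (sc x)" using c(1) by simp
  have k6: "fps_const \<xi> * fps_const (ve L) = fps_const (ve L) * fps_const \<xi>" using e by simp
  have k7: "fps_const \<xi> * fps_const (vw L) = - (fps_const (vw L) * fps_const \<xi>)" using w by simp
  note i1 = IH[THEN conjunct1] and r1 = IH[THEN conjunct2]
  note i2 = r1[THEN conjunct1] and r2 = r1[THEN conjunct2]
  note i3 = r2[THEN conjunct1] and r3 = r2[THEN conjunct2]
  note i4 = r3[THEN conjunct1] and r4 = r3[THEN conjunct2]
  note i5 = r4[THEN conjunct1] and r5 = r4[THEN conjunct2]
  note i6 = r5[THEN conjunct1] and r6 = r5[THEN conjunct2]
  note i7 = r6[THEN conjunct1] and r7 = r6[THEN conjunct2]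
  note c1 = com[THEN conjunct1] and d1 = com[THEN conjunct2]
  note c2 = d1[THEN conjunct1] and d2 = d1[THEN conjunct2]
  note c3 = d2[THEN conjunct1] and d3 = d2[THEN conjunct2]
  note rel = relations_append[OF fps_X_central ctr ctr k1 c1 c2 c3 d3 k6 k7 i1 i2 i3 i4 i5 i6 i7 r7
      vA.simps(2) vB.simps(2) vP.simps(2) vQ.simps(2) e'[unfolded a] w'[unfolded a]]
  show ?case unfolding a by (intro conjI; fact rel)
qed simp

lemma v_yq: "clif L \<Longrightarrow> yq sc (vA L) (vB L) (vP L) (vQ L) (ve L) (vw L)"
  using v_relations[of L] v_nth_low[of L] by unfold_locales simp_all

end

section \<open>Skew cyclic operators\<close>

context calg
begin

lemma sc_inj: "sc a = sc b \<longleftrightarrow> a = b"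
  using vs.scale_cancel_right[of a 1 b] by simp

lemma sc_eq_0_iff: "sc c = 0 \<longleftrightarrow> c = 0"
  using sc_inj[of c 0] by simp

lemma linear_on_sum:
  assumes W: "vs.subspace W"
    and add: "\<And>x y. x \<in> W \<Longrightarrow> y \<in> W \<Longrightarrow> T (x + y) = T x + T y"
    and scale: "\<And>c x. x \<in> W \<Longrightarrow> T (sc c * x) = sc c * T x"
    and B: "finite B" "B \<subseteq> W"
  shows "T (\<Sum>b\<in>B. sc (u b) * b) = (\<Sum>b\<in>B. sc (u b) * T b) \<and> (\<Sum>b\<in>B. sc (u b) * b) \<in> W"
  using B
proof (induction B)
  case empty
  have "T (sc 0 * 0) = sc 0 * T 0" by (rule scale) (rule vs.subspace_0[OF W])
  then show ?case using vs.subspace_0[OF W] by simp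
next
  case (insert b B)
  then show ?case
    by (auto simp: add scale vs.subspace_scale[OF W] intro!: vs.subspace_add[OF W])
qed

text \<open>\<open>T\<close> is linear on \<open>W\<close> only, and the ambient ring may be
  infinite-dimensional. The matrix of \<open>T\<close> in a basis of \<open>W\<close> has a complex
  eigenvalue, and its eigenvector is carried back through the basis.\<close>

lemma eigenvector_exists:
  assumes W: "vs.subspace W" and B: "finite B" "vs.independent B" "vs.span B = W" and ne: "W \<noteq> {0}"
    and add: "\<And>x y. x \<in> W \<Longrightarrow> y \<in> W \<Longrightarrow> T (x + y) = T x + T y"
    and scale: "\<And>c x. x \<in> W \<Longrightarrow> T (sc c * x) = sc c * T x"
    and TW: "\<And>x. x \<in> W \<Longrightarrow> T x \<in> W"
  obtains x t where "x \<in> W" "x \<noteq> 0" "T x = sc t * x"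
proof -
  define n where "n = card B"
  obtain h where h: "bij_betw h {0..<n} B"
    using ex_bij_betw_nat_finite[OF B(1)] unfolding n_def by blast
  have BW: "B \<subseteq> W" using B(3) vs.span_superset by blast
  have "B \<noteq> {}" using ne B(3) by auto
  then have n: "n > 0" using B(1) unfolding n_def by (simp add: card_gt_0_iff)
  have "\<exists>m. T b = (\<Sum>c\<in>B. sc (m c) * c)" if "b \<in> B" for b
  proof -
    have "T b \<in> vs.span B" using TW that BW B(3) by auto
    then show ?thesis unfolding vs.span_finite[OF B(1)] by auto
  qed
  then obtain m where m: "\<And>b. b \<in> B \<Longrightarrow> T b = (\<Sum>c\<in>B. sc (m b c) * c)" by metis
  define M where "M = mat n n (\<lambda>(i,j). m (h j) (h i))"
  have M: "M \<in> carrier_mat n n" by (simp add: M_def)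
  obtain t where "eigenvalue M t" using spectrum_non_empty[OF M n] unfolding spectrum_def by auto
  then obtain v where v: "v \<in> carrier_vec n" "v \<noteq> 0\<^sub>v n" "M *\<^sub>v v = t \<cdot>\<^sub>v v"
    unfolding eigenvalue_def eigenvector_def using M by auto
  define g where "g = inv_into {0..<n} h"
  have gh: "g (h i) = i" if i: "i < n" for i
  proof -
    have "i \<in> {0..<n}" using i by simp
    from bij_betw_inv_into_left[OF h this] show ?thesis unfolding g_def .
  qed
  define x where "x = (\<Sum>b\<in>B. sc (vec_index v (g b)) * b)"
  have row: "(\<Sum>b\<in>B. vec_index v (g b) * m b c) = t * vec_index v (g c)" if "c \<in> B" for c
  proof -
    have "c \<in> h ` {0..<n}" using that by (simp only: bij_betw_imp_surj_on[OF h])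
    then obtain i where i: "i < n" "c = h i" by auto
    have "vec_index (M *\<^sub>v v) i = (\<Sum>j\<in>{0..<n}. m (h j) (h i) * vec_index v j)"
      using i v(1) M by (simp add: scalar_prod_def M_def)
    also have "\<dots> = (\<Sum>j\<in>{0..<n}. vec_index v (g (h j)) * m (h j) (h i))"
      by (intro sum.cong) (auto simp: gh)
    also have "\<dots> = (\<Sum>b\<in>B. vec_index v (g b) * m b (h i))"
      using sum.reindex_bij_betw[OF h, of "\<lambda>b. vec_index v (g b) * m b (h i)"] by simp
    finally show ?thesis using v(1,3) i by (simp add: gh)
  qed
  have lin: "T (\<Sum>b\<in>B. sc (vec_index v (g b)) * b) = (\<Sum>b\<in>B. sc (vec_index v (g b)) * T b)
      \<and> (\<Sum>b\<in>B. sc (vec_index v (g b)) * b) \<in> W"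
    by (rule linear_on_sum[OF W _ _ B(1) BW]) (fact add scale)+
  have "T x = (\<Sum>b\<in>B. sc (vec_index v (g b)) * (\<Sum>c\<in>B. sc (m b c) * c))"
    unfolding x_def conjunct1[OF lin] by (intro sum.cong refl) (simp only: m)
  also have "\<dots> = (\<Sum>c\<in>B. sc (\<Sum>b\<in>B. vec_index v (g b) * m b c) * c)"
  proof -
    have "(\<Sum>b\<in>B. sc (vec_index v (g b)) * (\<Sum>c\<in>B. sc (m b c) * c))
        = (\<Sum>b\<in>B. \<Sum>c\<in>B. sc (vec_index v (g b) * m b c) * c)"
      by (simp add: sum_distrib_left)
    also have "\<dots> = (\<Sum>c\<in>B. \<Sum>b\<in>B. sc (vec_index v (g b) * m b c) * c)"
      by (rule sum.swap)
    finally show ?thesis by (simp only: sc_sum sum_distrib_right)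
  qed
  also have "\<dots> = (\<Sum>c\<in>B. sc t * (sc (vec_index v (g c)) * c))"
    by (intro sum.cong refl) (simp add: row)
  also have "\<dots> = sc t * x" by (simp add: x_def sum_distrib_left)
  finally have T: "T x = sc t * x" .
  have "x \<noteq> 0"
  proof
    assume "x = 0"
    then have s0: "(\<Sum>b\<in>B. sc (vec_index v (g b)) * b) = 0" unfolding x_def .
    have z: "vec_index v (g b) = 0" if b: "b \<in> B" for b
      by (rule vs.independentD[OF B(2) B(1) subset_refl s0 b])
    have "v = 0\<^sub>v n"
    proof (rule eq_vecI)
      fix i assume "i < dim_vec (0\<^sub>v n :: complex vec)"
      then have i: "i < n" by simp
      then have "h i \<in> B" using bij_betwE[OF h] by simp
      from z[OF this] show "vec_index v i = vec_index (0\<^sub>v n) i" using i by (simp add: gh)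
    qed (use v in simp)
    then show False using v by simp
  qed
  moreover have "x \<in> W" using lin unfolding x_def by simp
  ultimately show ?thesis using T that by blast
qed

text \<open>The abstract form of the odd generators: an operator \<open>D\<close>, skew for the form given by the
  anticommutator, and a cyclic vector \<open>\<sigma>\<close>.\<close>

definition skew_cyclic :: "'a set \<Rightarrow> ('a \<Rightarrow> 'a) \<Rightarrow> 'a \<Rightarrow> bool" where
  "skew_cyclic W D \<sigma> \<longleftrightarrow> vs.subspace W \<and> \<sigma> \<in> W
    \<and> (\<forall>x\<in>W. \<forall>y\<in>W. acomm x y \<in> range sc)
    \<and> (\<forall>x\<in>W. D x \<in> W) \<and> (\<forall>x\<in>W. \<forall>y\<in>W. D (x + y) = D x + D y) \<and> (\<forall>c. \<forall>x\<in>W. D (sc c * x) = sc c * D x)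
    \<and> (\<forall>x\<in>W. \<forall>y\<in>W. acomm (D x) y = - acomm x (D y))
    \<and> (\<forall>U. vs.subspace U \<and> U \<subseteq> W \<and> \<sigma> \<in> U \<and> (\<forall>x\<in>U. D x \<in> U) \<longrightarrow> U = W)
    \<and> (\<forall>x\<in>W. (\<forall>y\<in>W. acomm x y = 0) \<longrightarrow> x = 0)"

lemma skew_cyclicD:
  assumes "skew_cyclic W D \<sigma>"
  shows "vs.subspace W" "\<sigma> \<in> W" "\<And>x y. x \<in> W \<Longrightarrow> y \<in> W \<Longrightarrow> acomm x y \<in> range sc"
    "\<And>x. x \<in> W \<Longrightarrow> D x \<in> W" "\<And>x y. x \<in> W \<Longrightarrow> y \<in> W \<Longrightarrow> D (x + y) = D x + D y"
    "\<And>c x. x \<in> W \<Longrightarrow> D (sc c * x) = sc c * D x"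
    "\<And>x y. x \<in> W \<Longrightarrow> y \<in> W \<Longrightarrow> acomm (D x) y = - acomm x (D y)"
    "\<And>U. vs.subspace U \<Longrightarrow> U \<subseteq> W \<Longrightarrow> \<sigma> \<in> U \<Longrightarrow> (\<And>x. x \<in> U \<Longrightarrow> D x \<in> U) \<Longrightarrow> U = W"
    "\<And>x. x \<in> W \<Longrightarrow> (\<And>y. y \<in> W \<Longrightarrow> acomm x y = 0) \<Longrightarrow> x = 0"
  using assms unfolding skew_cyclic_def by blast+

lemma skew_cyclicI:
  assumes "vs.subspace W" "\<sigma> \<in> W" "\<And>x y. x \<in> W \<Longrightarrow> y \<in> W \<Longrightarrow> acomm x y \<in> range sc"
    "\<And>x. x \<in> W \<Longrightarrow> D x \<in> W" "\<And>x y. x \<in> W \<Longrightarrow> y \<in> W \<Longrightarrow> D (x + y) = D x + D y"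
    "\<And>c x. x \<in> W \<Longrightarrow> D (sc c * x) = sc c * D x"
    "\<And>x y. x \<in> W \<Longrightarrow> y \<in> W \<Longrightarrow> acomm (D x) y = - acomm x (D y)"
    "\<And>U. vs.subspace U \<Longrightarrow> U \<subseteq> W \<Longrightarrow> \<sigma> \<in> U \<Longrightarrow> \<forall>x\<in>U. D x \<in> U \<Longrightarrow> U = W"
    "\<And>x. x \<in> W \<Longrightarrow> \<forall>y\<in>W. acomm x y = 0 \<Longrightarrow> x = 0"
  shows "skew_cyclic W D \<sigma>"
proof -
  have "\<forall>U. vs.subspace U \<and> U \<subseteq> W \<and> \<sigma> \<in> U \<and> (\<forall>x\<in>U. D x \<in> U) \<longrightarrow> U = W" using assms(8) by blast
  moreover have "\<forall>x\<in>W. (\<forall>y\<in>W. acomm x y = 0) \<longrightarrow> x = 0" using assms(9) by blast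
  ultimately show ?thesis
    unfolding skew_cyclic_def using assms(1-4) by (simp add: assms(5-7))
qed

text \<open>Otherwise \<open>x\<close> is an eigenvector of \<open>D\<close> itself. Its orthogonal
  complement is then \<open>D\<close>-stable and contains \<sigma>, so by cyclicity it is all of
  \<open>W\<close>, and \<open>x\<close> lies in the radical.\<close>

lemma skew_cyclic_eigenvector:
  assumes "skew_cyclic W D \<sigma>" "x \<in> W" "x \<noteq> 0" "D x + acomm \<sigma> x * \<sigma> = sc t * x"
  shows "acomm \<sigma> x \<noteq> 0"
proof
  assume 0: "acomm \<sigma> x = 0"
  then have Dx: "D x = sc t * x" using assms(4) by simp
  note s = skew_cyclicD[OF assms(1)]
  note W = s(1)
  define U where "U = {u \<in> W. acomm u x = 0}"
  have "D u \<in> U" if "u \<in> U" for u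
  proof -
    have "acomm (D u) x = - acomm u (D x)" using s(7)[of u x] assms(2) that unfolding U_def by simp
    then show ?thesis using that s(4)[of u] unfolding U_def Dx by (simp add: acomm_sc)
  qed
  moreover have "vs.subspace U"
    using W unfolding vs.subspace_def U_def by (auto simp: acomm_simps acomm_sc)
  moreover have "\<sigma> \<in> U" "U \<subseteq> W" using s(2) 0 by (auto simp: U_def)
  ultimately have "U = W" by (intro s(8))
  then have "acomm x y = 0" if "y \<in> W" for y using that unfolding U_def acomm_sym[of x y] by auto
  then show False using s(9)[OF assms(2)] assms(3) by blast
qed

text \<open>If \<open>t + t' = 0\<close>, the eigenvalue terms cancel in the skewness identity for
  \<open>x\<close> and \<open>y\<close>, leaving twice the product of their pairings with \<sigma>,
  and neither pairing is zero. The case \<open>x = y\<close> is included and shows that eigenvalues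
  are nonzero.\<close>

lemma skew_cyclic_eigenvalues:
  assumes sk: "skew_cyclic W D \<sigma>"
    and x: "x \<in> W" "x \<noteq> 0" "D x + acomm \<sigma> x * \<sigma> = sc t * x"
    and y: "y \<in> W" "y \<noteq> 0" "D y + acomm \<sigma> y * \<sigma> = sc t' * y"
  shows "t + t' \<noteq> 0"
proof
  assume "t + t' = 0"
  then have "t' = - t" by (simp add: eq_neg_iff_add_eq_0 add.commute)
  then have t': "sc t' = - sc t" by (simp add: sc_minus)
  note s = skew_cyclicD[OF sk]
  obtain b where b: "acomm \<sigma> x = sc b" using s(3)[OF s(2) x(1)] by blast
  obtain b' where b': "acomm \<sigma> y = sc b'" using s(3)[OF s(2) y(1)] by blast
  have 1: "D x = sc t * x - sc b * \<sigma>" using x(3) b by (simp add: algebra_simps)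
  have 2: "D y = - (sc t * y) - sc b' * \<sigma>" using y(3) b' t' by (simp add: algebra_simps)
  have "acomm (D x) y = - acomm x (D y)" by (rule s(7)[OF x(1) y(1)])
  then have "sc b * sc b' + sc b * sc b' = 0"
    unfolding 1 2 using b b' sc_comm[of "sc b'" b]
    by (simp add: acomm_simps acomm_sc acomm_sym[of x \<sigma>]) (metis add.right_inverse)
  then have "b * b' = 0" by (simp add: double_zero_iff sc_eq_0_iff flip: sc_mult)
  then have "b = 0 \<or> b' = 0" by simp
  then have "acomm \<sigma> x = 0 \<or> acomm \<sigma> y = 0" unfolding b b' by auto
  with skew_cyclic_eigenvector[OF sk x] skew_cyclic_eigenvector[OF sk y] show False by simp
qed

lemma skew_cyclic_peel:
  assumes sk: "skew_cyclic W D \<sigma>" and B: "finite B" "vs.independent B" "vs.span B = W" and ne: "W \<noteq> {0}"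
  obtains \<xi> t where "\<xi> \<in> W" "t \<noteq> 0" "acomm \<xi> \<xi> = sc t" "acomm \<xi> \<sigma> = sc t" "D \<xi> = - (sc t * (\<sigma> - \<xi>))"
proof -
  note s = skew_cyclicD[OF sk]
  note W = s(1)
  obtain x t where x: "x \<in> W" "x \<noteq> 0" "D x + acomm \<sigma> x * \<sigma> = sc t * x"
  proof (rule eigenvector_exists[OF W B ne, of "\<lambda>x. D x + acomm \<sigma> x * \<sigma>"])
    show "D (x + y) + acomm \<sigma> (x + y) * \<sigma> = D x + acomm \<sigma> x * \<sigma> + (D y + acomm \<sigma> y * \<sigma>)" if "x \<in> W" "y \<in> W" for x y
      by (simp add: acomm_simps algebra_simps s(5)[OF that])
    show "D (sc c * x) + acomm \<sigma> (sc c * x) * \<sigma> = sc c * (D x + acomm \<sigma> x * \<sigma>)" if "x \<in> W" for c x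
      by (simp add: acomm_sc algebra_simps s(6)[OF that])
    show "D x + acomm \<sigma> x * \<sigma> \<in> W" if "x \<in> W" for x
    proof -
      from s(3)[OF s(2) that] obtain b where "acomm \<sigma> x = sc b" by blast
      then show ?thesis by (simp add: vs.subspace_add[OF W] vs.subspace_scale[OF W] s(2) s(4)[OF that])
    qed
  qed
  obtain b where b: "acomm \<sigma> x = sc b" using s(3)[OF s(2) x(1)] by blast
  have b0: "b \<noteq> 0" using skew_cyclic_eigenvector[OF sk x] b by auto
  obtain d where d: "acomm x x = sc d" using s(3)[OF x(1) x(1)] by blast
  have Dx: "D x = sc t * x - sc b * \<sigma>" using x(3) b by (simp add: algebra_simps)
  have "acomm (D x) x = - acomm x (D x)" by (rule s(7)[OF x(1) x(1)])
  then have "acomm (D x) x + acomm (D x) x = 0" by (simp only: acomm_sym[of x "D x"] eq_neg_iff_add_eq_0)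
  then have "acomm (D x) x = 0" by (simp add: double_zero_iff)
  \<comment> \<open>Skewness gives \<open>acomm (D x) x = 0\<close>; evaluating it relates the norm
    of \<open>x\<close> to its pairing with \<sigma>.\<close>
  then have "sc (t * d - b * b) = 0"
    unfolding Dx by (simp only: acomm_simps acomm_sc b d sc_diff sc_mult)
  then have td: "t * d = b * b" by (simp add: sc_eq_0_iff)
  then have t0: "t \<noteq> 0" using b0 by auto
  \<comment> \<open>The factor \<open>t / b\<close> equalises the pairings of \<xi> with itself and
    with \<sigma>, so that \<sigma> - \<xi> becomes orthogonal to \<xi>.\<close>
  define \<xi> where "\<xi> = sc (t / b) * x"
  have D\<xi>: "D \<xi> = - (sc t * (\<sigma> - \<xi>))"
  proof -
    have "D \<xi> = sc (t / b) * D x" unfolding \<xi>_def by (rule s(6)[OF x(1)])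
    also have "\<dots> = sc t * \<xi> - sc (t / b * b) * \<sigma>"
      unfolding Dx \<xi>_def by (simp add: right_diff_distrib mult.commute)
    finally show ?thesis using b0 by (simp add: algebra_simps)
  qed
  have "acomm \<xi> \<xi> = sc (t / b * (t / b * d))"
    unfolding \<xi>_def acomm_sc d by (simp only: sc_mult)
  also have "t / b * (t / b * d) = t" using td b0 by (simp add: field_simps)
  finally have 1: "acomm \<xi> \<xi> = sc t" .
  have "acomm \<xi> \<sigma> = sc (t / b * b)"
    unfolding \<xi>_def acomm_sc acomm_sym[of x \<sigma>] b by (simp only: sc_mult)
  then have 2: "acomm \<xi> \<sigma> = sc t" using b0 by simp
  have "\<xi> \<in> W" unfolding \<xi>_def by (rule vs.subspace_scale[OF W x(1)])
  then show ?thesis using that t0 1 2 D\<xi> by blast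
qed

text \<open>This reverses the appending of a Clifford generator. For \<open>x\<close> orthogonal to
  \<xi>, the correction \<open>- acomm \<sigma> x * \<xi>\<close> brings \<open>D x\<close> back
  into the orthogonal complement.\<close>

lemma skew_cyclic_reduce:
  assumes sk: "skew_cyclic W D \<sigma>" and \<xi>: "\<xi> \<in> W" "t \<noteq> 0" "acomm \<xi> \<xi> = sc t" "acomm \<xi> \<sigma> = sc t"
    "D \<xi> = - (sc t * (\<sigma> - \<xi>))"
  shows "skew_cyclic {x \<in> W. acomm \<xi> x = 0} (\<lambda>x. D x - acomm \<sigma> x * \<xi>) (\<sigma> - \<xi>)"
    and "y \<in> W \<Longrightarrow> \<exists>c. y - sc c * \<xi> \<in> {x \<in> W. acomm \<xi> x = 0}"
proof -
  note s = skew_cyclicD[OF sk]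
  note W = s(1) and \<sigma> = s(2)
  let ?W = "{x \<in> W. acomm \<xi> x = 0}"
  let ?D = "\<lambda>x. D x - acomm \<sigma> x * \<xi>"
  show proj: "\<exists>c. y - sc c * \<xi> \<in> ?W" if "y \<in> W" for y
  proof -
    from s(3)[OF \<xi>(1) that] obtain b where b: "acomm \<xi> y = sc b" by blast
    have "acomm \<xi> (y - sc (b / t) * \<xi>) = sc (b - b / t * t)"
      unfolding acomm_simps acomm_sc b \<xi>(3) by (simp only: sc_diff sc_mult)
    then have "acomm \<xi> (y - sc (b / t) * \<xi>) = 0" using \<xi>(2) by simp
    moreover have "y - sc (b / t) * \<xi> \<in> W"
      by (intro vs.subspace_diff[OF W] vs.subspace_scale[OF W] that \<xi>)
    ultimately show ?thesis by blast
  qed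
  have W': "vs.subspace ?W"
    using W unfolding vs.subspace_def by (auto simp: acomm_simps acomm_sc)
  have D': "?D x \<in> ?W" if "x \<in> ?W" for x
  proof -
    from that have xW: "x \<in> W" by simp
    from s(3)[OF \<sigma> xW] obtain b where b: "acomm \<sigma> x = sc b" by blast
    have "acomm (D \<xi>) x = - acomm \<xi> (D x)" using s(7)[OF \<xi>(1), of x] that by simp
    then have "acomm \<xi> (D x) = sc t * sc b"
      unfolding \<xi>(5) using that b by (simp add: acomm_simps acomm_sc)
    then have "acomm \<xi> (?D x) = 0"
      using \<xi>(3) b sc_comm[of "sc b" t] by (simp add: acomm_simps acomm_sc)
    moreover have "?D x \<in> W"
      using s(4)[of x] that by (simp add: b vs.subspace_diff[OF W] vs.subspace_scale[OF W] \<xi>(1))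
    ultimately show ?thesis by blast
  qed
  have sk': "acomm (?D x) y = - acomm x (?D y)" if "x \<in> ?W" "y \<in> ?W" for x y
  proof -
    from that have xW: "x \<in> W" and yW: "y \<in> W" by simp_all
    from s(3)[OF \<sigma> xW] s(3)[OF \<sigma> yW] obtain b c where b: "acomm \<sigma> x = sc b" "acomm \<sigma> y = sc c" by blast
    have "acomm (D x) y = - acomm x (D y)" using s(7)[of x y] that by simp
    then show ?thesis using that by (simp add: b acomm_simps acomm_sc acomm_sym[of x \<xi>])
  qed
  have cyc': "U = ?W" if U: "vs.subspace U" "U \<subseteq> ?W" "\<sigma> - \<xi> \<in> U" "\<forall>x\<in>U. ?D x \<in> U" for U
  proof
    \<comment> \<open>Adding the multiples of \<xi> turns \<open>U\<close> into a
      \<open>D\<close>-stable subspace containing \<sigma>, hence into \<open>W\<close>; pairing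
      with \<xi> removes them again.\<close>
    define U' where "U' = {u + sc c * \<xi> | u c. u \<in> U}"
    have sU': "vs.subspace U'"
    proof (rule vs.subspaceI)
      have "0 = 0 + sc 0 * \<xi>" by simp
      then show "0 \<in> U'" unfolding U'_def using vs.subspace_0[OF U(1)] by blast
      show "x + y \<in> U'" if xy: "x \<in> U'" "y \<in> U'" for x y
      proof -
        obtain u c v d where "x = u + sc c * \<xi>" "y = v + sc d * \<xi>" "u \<in> U" "v \<in> U" using xy unfolding U'_def by blast
        moreover from this have "x + y = (u + v) + sc (c + d) * \<xi>" by (simp add: sc_add algebra_simps)
        ultimately show ?thesis using vs.subspace_add[OF U(1)] unfolding U'_def by blast
      qed
      show "sc a * x \<in> U'" if xy: "x \<in> U'" for a x
      proof -
        obtain u c where "x = u + sc c * \<xi>" "u \<in> U" using xy unfolding U'_def by blast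
        moreover from this have "sc a * x = sc a * u + sc (a * c) * \<xi>" by (simp add: distrib_left)
        ultimately show ?thesis using vs.subspace_scale[OF U(1)] unfolding U'_def by blast
      qed
    qed
    moreover have "U' \<subseteq> W" using U(2) unfolding U'_def
      by (auto intro!: vs.subspace_add[OF W] vs.subspace_scale[OF W] \<xi>(1))
    moreover have "\<sigma> = (\<sigma> - \<xi>) + sc 1 * \<xi>" by simp
    then have "\<sigma> \<in> U'" unfolding U'_def using U(3) by blast
    moreover have "D x \<in> U'" if "x \<in> U'" for x
    proof -
      obtain u c where u: "x = u + sc c * \<xi>" "u \<in> U" using \<open>x \<in> U'\<close> unfolding U'_def by blast
      have uW: "u \<in> W" using u U(2) by blast
      obtain b where b: "acomm \<sigma> u = sc b" using s(3)[OF \<sigma> uW] by blast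
      have "D x = D u + D (sc c * \<xi>)" unfolding u(1)
        by (rule s(5)[OF uW vs.subspace_scale[OF W \<xi>(1)]])
      also have "D (sc c * \<xi>) = sc c * D \<xi>" by (rule s(6)[OF \<xi>(1)])
      also have "D u = ?D u + sc b * \<xi>" using b by simp
      also have "?D u + sc b * \<xi> + sc c * D \<xi> = (?D u - sc (c * t) * (\<sigma> - \<xi>)) + sc b * \<xi>"
        unfolding \<xi>(5) by (simp add: algebra_simps)
      finally have "D x = (?D u - sc (c * t) * (\<sigma> - \<xi>)) + sc b * \<xi>" .
      moreover have "?D u - sc (c * t) * (\<sigma> - \<xi>) \<in> U"
        by (rule vs.subspace_diff[OF U(1) bspec[OF U(4) u(2)] vs.subspace_scale[OF U(1) U(3)]])
      ultimately show ?thesis unfolding U'_def by blast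
    qed
    ultimately have U'W: "U' = W" by (intro s(8))
    show "?W \<subseteq> U"
    proof
      fix x assume x: "x \<in> ?W"
      then have "x \<in> U'" using U'W by blast
      then obtain u c where u: "x = u + sc c * \<xi>" "u \<in> U" unfolding U'_def by blast
      have "acomm \<xi> x = sc (c * t)" using u U(2) \<xi>(3) unfolding sc_mult by (auto simp: acomm_simps acomm_sc)
      then have "c = 0" using x \<xi>(2) by (simp add: sc_eq_0_iff)
      then show "x \<in> U" using u by simp
    qed
  qed (fact U(2))
  have nd': "x = 0" if x: "x \<in> ?W" "\<forall>y\<in>?W. acomm x y = 0" for x
  proof -
    have "acomm x y = 0" if y: "y \<in> W" for y
    proof -
      obtain c where "y - sc c * \<xi> \<in> ?W" using proj[OF y] by blast
      then have "acomm x (y - sc c * \<xi>) = 0" using x(2) by blast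
      then show ?thesis using x(1) by (simp add: acomm_simps acomm_sc acomm_sym[of x \<xi>])
    qed
    then show ?thesis using s(9)[of x] x(1) by blast
  qed
  have sg': "\<sigma> - \<xi> \<in> ?W"
    using vs.subspace_diff[OF W \<sigma> \<xi>(1)] \<xi> by (simp add: acomm_simps)
  have add': "?D (x + y) = ?D x + ?D y" if "x \<in> ?W" "y \<in> ?W" for x y
    using s(5)[of x y] that by (simp add: acomm_simps algebra_simps)
  have scl': "?D (sc c * x) = sc c * ?D x" if "x \<in> ?W" for c x
    using s(6)[of x c] that by (simp add: acomm_sc algebra_simps)
  have rg': "acomm x y \<in> range sc" if "x \<in> ?W" "y \<in> ?W" for x y using s(3)[of x y] that by simp
  show "skew_cyclic ?W ?D (\<sigma> - \<xi>)"
    by (rule skew_cyclicI) (fact W' sg' rg' D' add' scl' sk' cyc' nd')+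
qed

text \<open>Generators are peeled off one at a time, by induction on the dimension. The final clause
  traces each weight back to an eigenvalue of the perturbation on the original \<open>W\<close>,
  where any two eigenvalues can be compared.\<close>

lemma skew_cyclic_clifford:
  assumes "skew_cyclic W D \<sigma>" "finite B" "vs.independent B" "vs.span B = W"
  shows "\<exists>L. clif L \<and> snd ` set L \<subseteq> W \<and> \<sigma> = sum_list (map snd L) \<and> W \<subseteq> vs.span (snd ` set L)
     \<and> (\<forall>x\<in>W. der (ve L) x = D x)
     \<and> (\<forall>s\<in>fst ` set L. \<exists>x\<in>W. x \<noteq> 0 \<and> D x + acomm \<sigma> x * \<sigma> = sc (2 * s) * x)"
  using assms
proof (induction "card B" arbitrary: W D \<sigma> B rule: less_induct)
  case less
  note sk = less.prems(1) and B = less.prems(2-4)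
  note s = skew_cyclicD[OF sk]
  note W = s(1) and \<sigma> = s(2)
  show ?case
  proof (cases "W = {0}")
    case True
    then have "D 0 = 0" using s(4)[of 0] by simp
    then show ?thesis using True \<sigma> by (intro exI[of _ "[]"]) (auto simp: der_def)
  next
    case False
    obtain \<xi> t where \<xi>: "\<xi> \<in> W" "t \<noteq> 0" "acomm \<xi> \<xi> = sc t" "acomm \<xi> \<sigma> = sc t" "D \<xi> = - (sc t * (\<sigma> - \<xi>))"
      by (rule skew_cyclic_peel[OF sk B False])
    define W' where "W' = {x \<in> W. acomm \<xi> x = 0}"
    define D' where "D' = (\<lambda>x. D x - acomm \<sigma> x * \<xi>)"
    have sk': "skew_cyclic W' D' (\<sigma> - \<xi>)"
      unfolding W'_def D'_def by (rule skew_cyclic_reduce(1)[OF sk \<xi>])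
    have proj: "\<exists>c. y - sc c * \<xi> \<in> W'" if "y \<in> W" for y
      unfolding W'_def by (rule skew_cyclic_reduce(2)[OF sk \<xi> that])
    note s' = skew_cyclicD[OF sk']
    have W'W: "W' \<subseteq> W" unfolding W'_def by blast
    obtain B' where B': "B' \<subseteq> W'" "vs.independent B'" "W' \<subseteq> vs.span B'" "card B' = vs.dim W'"
      by (rule vs.basis_exists[of W'])
    have spB': "vs.span B' = W'"
      using B' vs.span_minimal[OF B'(1) s'(1)] by blast
    have \<xi>W': "\<xi> \<notin> W'" using \<xi>(2,3) unfolding W'_def by (simp add: sc_eq_0_iff)
    have "vs.independent (insert \<xi> B')"
      using B'(2) \<xi>W' spB' by (simp add: vs.independent_insert)
    moreover have "insert \<xi> B' \<subseteq> vs.span B" using B(3) \<xi>(1) B'(1) W'W by blast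
    ultimately have "finite (insert \<xi> B') \<and> card (insert \<xi> B') \<le> card B"
      by (intro vs.independent_span_bound[OF B(1)])
    moreover have "\<xi> \<notin> B'" using B'(1) \<xi>W' by blast
    ultimately have finB': "finite B'" and card: "card B' < card B" by auto
    obtain L where L: "clif L" "snd ` set L \<subseteq> W'" "\<sigma> - \<xi> = sum_list (map snd L)" "W' \<subseteq> vs.span (snd ` set L)"
      "\<forall>x\<in>W'. der (ve L) x = D' x"
      "\<forall>s\<in>fst ` set L. \<exists>x\<in>W'. x \<noteq> 0 \<and> D' x + acomm (\<sigma> - \<xi>) x * (\<sigma> - \<xi>) = sc (2 * s) * x"
      using less.hyps[OF card sk' finB' B'(2) spB'] by (elim exE conjE) (rule that; assumption)
    define L' where "L' = (t / 2, \<xi>) # L"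
    have \<xi>\<xi>: "\<xi> * \<xi> = sc (t / 2)"
    proof -
      have "\<xi> * \<xi> + \<xi> * \<xi> = sc (t / 2 + t / 2)" using \<xi>(3) by (simp add: acomm_def)
      then show ?thesis unfolding sc_add by (simp only: double_eq_iff)
    qed
    have anti: "\<forall>\<eta>\<in>snd ` set L. \<xi> * \<eta> = - (\<eta> * \<xi>)"
    proof
      fix \<eta> assume "\<eta> \<in> snd ` set L"
      then have "acomm \<xi> \<eta> = 0" using L(2) unfolding W'_def by blast
      then show "\<xi> * \<eta> = - (\<eta> * \<xi>)" by (simp add: acomm_def eq_neg_iff_add_eq_0)
    qed
    have "clif L'" unfolding L'_def using L(1) \<xi>\<xi> anti by simp
    moreover have "snd ` set L' \<subseteq> W" unfolding L'_def using \<xi>(1) L(2) W'W by auto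
    moreover have "\<sigma> = sum_list (map snd L')" unfolding L'_def using L(3) by (simp add: algebra_simps)
    moreover have "W \<subseteq> vs.span (snd ` set L')"
    proof
      fix y assume "y \<in> W"
      then obtain c where c: "y - sc c * \<xi> \<in> W'" using proj by blast
      have "y - sc c * \<xi> \<in> vs.span (snd ` set L')"
        using c L(4) vs.span_mono[of "snd ` set L" "snd ` set L'"] unfolding L'_def by auto
      moreover have "sc c * \<xi> \<in> vs.span (snd ` set L')"
        by (rule vs.span_scale, rule vs.span_base) (simp add: L'_def)
      ultimately have "(y - sc c * \<xi>) + sc c * \<xi> \<in> vs.span (snd ` set L')" by (rule vs.span_add)
      then show "y \<in> vs.span (snd ` set L')" by simp
    qed
    moreover have "\<forall>y\<in>W. der (ve L') y = D y"
    proof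
      fix y assume y: "y \<in> W"
      then obtain c where c: "y - sc c * \<xi> \<in> W'" using proj by blast
      define u where "u = y - sc c * \<xi>"
      have uW': "u \<in> W'" and y_eq: "y = u + sc c * \<xi>" using c unfolding u_def by auto
      have uW: "u \<in> W" using uW' W'W by blast
      have vwL: "vw L = - (\<sigma> - \<xi>)" using v_nth_low[of L] L(3) by simp
      have ve: "ve L' = ve L - (\<sigma> - \<xi>) * \<xi> + sc (t / 2 * sum_list (map fst L))"
        unfolding L'_def ve_Cons vwL by (simp add: algebra_simps)
      have dve: "der (ve L') z = der (ve L) z - der ((\<sigma> - \<xi>) * \<xi>) z" for z
        unfolding ve der_def by (simp add: algebra_simps sc_comm)
      have \<xi>u: "u * \<xi> = - (\<xi> * u)" using uW' unfolding W'_def by (simp add: acomm_def eq_neg_iff_add_eq_0 add.commute)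
      \<comment> \<open>This term of \<open>ve L'\<close> restores what \<open>D'\<close> had
        subtracted from \<open>D\<close>.\<close>
      have "der ((\<sigma> - \<xi>) * \<xi>) u = - (acomm (\<sigma> - \<xi>) u * \<xi>)"
      proof -
        have "(\<sigma> - \<xi>) * \<xi> * u = - ((\<sigma> - \<xi>) * u * \<xi>)" by (simp add: \<xi>u mult.assoc)
        then show ?thesis by (simp add: der_def acomm_def algebra_simps)
      qed
      moreover have "acomm (\<sigma> - \<xi>) u = acomm \<sigma> u" using uW' unfolding W'_def by (simp add: acomm_simps)
      ultimately have du: "der (ve L') u = D u"
        using L(5) uW' unfolding dve D'_def by simp
      have "ve L * \<xi> = \<xi> * ve L"
        using arg_cong[OF conjunct1[OF v_commute[OF anti]], of "\<lambda>f. f $ 2"] by simp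
      moreover have "\<xi> * (\<sigma> - \<xi>) = - ((\<sigma> - \<xi>) * \<xi>)"
        using s'(2) unfolding W'_def by (simp add: acomm_def eq_neg_iff_add_eq_0)
      then have "der ((\<sigma> - \<xi>) * \<xi>) \<xi> = (\<sigma> - \<xi>) * (\<xi> * \<xi>) + (\<sigma> - \<xi>) * (\<xi> * \<xi>)"
        unfolding der_def by (simp add: mult.assoc[symmetric] del: mult_minus_left) (simp add: mult.assoc)
      moreover have "\<dots> = sc (t / 2 + t / 2) * (\<sigma> - \<xi>)"
        unfolding \<xi>\<xi> sc_add by (simp only: sc_comm distrib_right)
      ultimately have d\<xi>: "der (ve L') \<xi> = D \<xi>" unfolding dve \<xi>(5) by (simp add: der_def)
      have "der (ve L') y = D u + sc c * D \<xi>" unfolding y_eq der_simps du d\<xi> ..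
      also have "\<dots> = D y" unfolding y_eq
        using s(5)[OF uW vs.subspace_scale[OF W \<xi>(1)], of c] s(6)[OF \<xi>(1), of c] by simp
      finally show "der (ve L') y = D y" .
    qed
    moreover have "\<forall>a\<in>fst ` set L'. \<exists>x\<in>W. x \<noteq> 0 \<and> D x + acomm \<sigma> x * \<sigma> = sc (2 * a) * x"
    proof
      fix a assume a: "a \<in> fst ` set L'"
      have \<xi>0: "\<xi> \<noteq> 0" using \<xi>W' vs.subspace_0[OF s'(1)] by blast
      have \<xi>e: "D \<xi> + acomm \<sigma> \<xi> * \<sigma> = sc t * \<xi>"
        unfolding \<xi>(5) acomm_sym[of \<sigma>] \<xi>(4) by (simp add: algebra_simps)
      show "\<exists>x\<in>W. x \<noteq> 0 \<and> D x + acomm \<sigma> x * \<sigma> = sc (2 * a) * x"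
      proof (cases "2 * a = t")
        case True
        then show ?thesis using \<xi>0 \<xi>e \<xi>(1) by blast
      next
        case ne: False
        then have "a \<in> fst ` set L" using a unfolding L'_def by auto
        then obtain x where x: "x \<in> W'" "x \<noteq> 0" "D' x + acomm (\<sigma> - \<xi>) x * (\<sigma> - \<xi>) = sc (2 * a) * x"
          using L(6) by blast
        have xW: "x \<in> W" using x(1) W'W by blast
        obtain b where b: "acomm \<sigma> x = sc b" using s(3)[OF \<sigma> xW] by blast
        have b': "acomm (\<sigma> - \<xi>) x = sc b" using x(1) b unfolding W'_def by (simp add: acomm_simps)
        have Dx: "D x + sc b * \<sigma> = sc (2 * a) * x + sc (2 * b) * \<xi>"
        proof -
          have "sc (2 * b) = sc b + sc b" by (simp flip: sc_add)
          then show ?thesis using x(3) unfolding b' D'_def b by (simp add: algebra_simps)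
        qed
        \<comment> \<open>The perturbation is triangular relative to \<xi> and \<open>W'\<close>.
          This \<open>c\<close> solves \<open>2 * b + c * t = 2 * a * c\<close>, which lifts the
          eigenvector \<open>x\<close> of the smaller space; for \<open>2 * a = t\<close> the vector
          \<xi> itself was taken.\<close>
        define c where "c = 2 * b / (2 * a - t)"
        define y where "y = x + sc c * \<xi>"
        have yW: "y \<in> W" unfolding y_def by (intro vs.subspace_add[OF W] xW vs.subspace_scale[OF W] \<xi>(1))
        have "D y = D x + sc c * D \<xi>" unfolding y_def
          using s(5)[OF xW vs.subspace_scale[OF W \<xi>(1)], of c] s(6)[OF \<xi>(1), of c] by simp
        moreover have "acomm \<sigma> y * \<sigma> = sc b * \<sigma> + sc c * (acomm \<sigma> \<xi> * \<sigma>)"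
          unfolding y_def acomm_simps acomm_sc b by (simp only: distrib_right mult.assoc)
        ultimately have "D y + acomm \<sigma> y * \<sigma> = (D x + sc b * \<sigma>) + sc c * (D \<xi> + acomm \<sigma> \<xi> * \<sigma>)"
          by (simp add: algebra_simps)
        also have "\<dots> = sc (2 * a) * x + sc (2 * b + c * t) * \<xi>"
          unfolding Dx \<xi>e by (simp add: sc_add algebra_simps)
        also have "2 * b + c * t = 2 * a * c" using ne unfolding c_def by (simp add: field_simps)
        also have "sc (2 * a) * x + sc (2 * a * c) * \<xi> = sc (2 * a) * y"
          unfolding y_def by (simp add: distrib_left)
        finally have "D y + acomm \<sigma> y * \<sigma> = sc (2 * a) * y" .
        moreover have "y \<noteq> 0"
        proof
          assume y0: "y = 0"
          have "acomm \<xi> y = sc (c * t)"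
            using x(1) \<xi>(3) unfolding y_def W'_def sc_mult by (simp add: acomm_simps acomm_sc)
          then have "c * t = 0" using y0 by (simp add: acomm_simps sc_eq_0_iff[symmetric] del: mult_eq_0_iff)
          then have "c = 0" using \<xi>(2) by simp
          then show False using x(2) y0 unfolding y_def by simp
        qed
        ultimately show ?thesis using yW by blast
      qed
    qed
    ultimately show ?thesis by (intro exI[of _ L'] conjI)
  qed
qed

end

context calg
begin

definition lift :: "(nat \<Rightarrow> complex) \<Rightarrow> 'a fps" where
  "lift f = Abs_fps (\<lambda>n. sc (f n))"

lemma lift_central: "y * lift f = lift f * y"
proof (rule fps_ext)
  fix n
  have "(y * lift f) $ n = (\<Sum>i=0..n. y $ (n - i) * lift f $ i)"
    unfolding fps_mult_nth by (subst sum.atLeastAtMost_rev) simp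
  then show "(y * lift f) $ n = (lift f * y) $ n"
    unfolding fps_mult_nth by (simp add: lift_def sc_comm)
qed

lemma v_commute_even:
  assumes "\<forall>\<eta>\<in>snd ` set L. c * \<eta> = \<eta> * c"
  shows "fps_const c * vA L = vA L * fps_const c \<and> fps_const c * vB L = vB L * fps_const c \<and>
    fps_const c * vP L = vP L * fps_const c \<and> fps_const c * vQ L = vQ L * fps_const c"
  using assms
proof (induction L)
  case (Cons a L)
  obtain x \<xi> where a: "a = (x, \<xi>)" by force
  let ?z = "fps_const c" and ?k = "fps_const \<xi>"
  have "c * \<xi> = \<xi> * c" using Cons.prems by (simp add: a)
  then have 1: "?z * ?k = ?k * ?z" by simp
  note q1 = mult_eq_assoc(1)[OF 1]
  have IH: "?z * vA L = vA L * ?z" "?z * vB L = vB L * ?z"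
    "?z * vP L = vP L * ?z" "?z * vQ L = vQ L * ?z"
    using Cons by auto
  note IH' = IH[THEN mult_eq_assoc(1)]
  have c: "?z * (fps_const (sc x) * y) = fps_const (sc x) * (?z * y)" for y
    by (simp add: sc_comm flip: mult.assoc)
  show ?case unfolding a
    by (simp add: algebra_simps IH IH' c 1 q1 fps_X_left_comm[of ?z] del: fps_const_mult)
qed simp

end

section \<open>Graded algebras and the Clifford realisation of a simple module\<close>

locale graded_algebra = calg sc for sc :: "complex \<Rightarrow> 'a::ring_1" +
  fixes Ev Od :: "'a set"
  assumes Ev_sub: "vs.subspace Ev" and Od_sub: "vs.subspace Od" and Ev_1: "1 \<in> Ev"
    and Ev_Ev: "x \<in> Ev \<Longrightarrow> y \<in> Ev \<Longrightarrow> x * y \<in> Ev" and Ev_Od: "x \<in> Ev \<Longrightarrow> y \<in> Od \<Longrightarrow> x * y \<in> Od"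
    and Od_Ev: "x \<in> Od \<Longrightarrow> y \<in> Ev \<Longrightarrow> x * y \<in> Od" and Od_Od: "x \<in> Od \<Longrightarrow> y \<in> Od \<Longrightarrow> x * y \<in> Ev"
begin

lemma v_graded:
  assumes "snd ` set L \<subseteq> Od"
  shows "vA L $ n \<in> Ev \<and> vB L $ n \<in> Ev \<and> vP L $ n \<in> Od \<and> vQ L $ n \<in> Od"
  using assms
proof (induction L arbitrary: n)
  case Nil
  then show ?case using Ev_1 vs.subspace_0[OF Ev_sub] vs.subspace_0[OF Od_sub] by simp
next
  case (Cons a L)
  obtain x \<xi> where a: "a = (x, \<xi>)" by force
  have \<xi>: "\<xi> \<in> Od" and L: "snd ` set L \<subseteq> Od" using Cons.prems by (auto simp: a)
  note IH = Cons.IH[OF L]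
  note I = vs.subspace_add[OF Ev_sub] vs.subspace_diff[OF Ev_sub] vs.subspace_scale[OF Ev_sub] Od_Od
    vs.subspace_add[OF Od_sub] vs.subspace_diff[OF Od_sub] vs.subspace_scale[OF Od_sub] Ev_Od \<xi>
  show ?case unfolding a using IH[of n] IH[of "n - 1"]
    by (cases n) (simp_all add: I)
qed

end

text \<open>Simplicity is stated in ring-theoretic form. \<open>schur\<close> describes the even
  commutant of \<open>w\<close> and \<open>A\<close>; \<open>radical\<close> says that odd
  anticommuting operators vanish when \<open>w\<close> and \<open>A\<close> preserve their common
  kernel; \<open>trace\<close> excludes nonzero scalar commutators, as for matrices.\<close>

locale yq_simple = yq sc A B P Q e w + graded_algebra sc Ev Od
  for sc :: "complex \<Rightarrow> 'a::ring_1" and A B P Q e w Ev Od +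
  assumes e_A: "e = A $ 2"
    and A_comm: "A $ i * A $ j = A $ j * A $ i"
    and A_Ev: "A $ n \<in> Ev" and w_Od: "w \<in> Od"
    and schur: "y \<in> Ev \<Longrightarrow> y * w = w * y \<Longrightarrow> (\<And>n. y * A $ n = A $ n * y) \<Longrightarrow> y \<in> range sc"
    and radical: "vs.subspace R \<Longrightarrow> R \<subseteq> Od \<Longrightarrow> (\<And>x y. x \<in> R \<Longrightarrow> y \<in> R \<Longrightarrow> acomm x y = 0) \<Longrightarrow>
        (\<And>x. x \<in> R \<Longrightarrow> acomm x w = 0) \<Longrightarrow>
        (\<And>x n. x \<in> R \<Longrightarrow> \<exists>g. (\<forall>i. g i \<in> R) \<and> x * A $ n = (\<Sum>i=0..n. A $ i * g (n - i))) \<Longrightarrow> R \<subseteq> {0}"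
    and fin: "\<exists>S. finite S \<and> Od \<subseteq> vs.span S"
    and trace: "a \<in> Ev \<Longrightarrow> b \<in> Ev \<Longrightarrow> a * b - b * a = sc c \<Longrightarrow> c = 0"
begin

lemma W_Od: "W \<subseteq> Od"
proof (rule cyc_least[OF Od_sub w_Od])
  fix x assume "x \<in> Od"
  then show "D x \<in> Od" unfolding der_def e_A
    by (intro vs.subspace_diff[OF Od_sub] Ev_Od Od_Ev A_Ev)
qed

lemma acomm_scalar:
  assumes x: "x \<in> W" and y: "y \<in> W"
  shows "acomm x y \<in> range sc"
proof (rule schur)
  show "acomm x y \<in> Ev" unfolding acomm_def
    by (intro vs.subspace_add[OF Ev_sub] Od_Od subsetD[OF W_Od] x y)
  show "acomm x y * w = w * acomm x y" by (rule acomm_comm_w[OF x y])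
  show "acomm x y * A $ n = A $ n * acomm x y" for n by (rule acomm_comm_A[OF x y])
qed

text \<open>By skewness the radical of the form is \<open>D\<close>-stable, so \<open>tau\<close>
  maps it to itself and \<open>mult_A_nth\<close> supplies the last hypothesis of
  \<open>radical\<close>.\<close>

lemma nondegenerate:
  assumes x: "x \<in> W" and 0: "\<And>y. y \<in> W \<Longrightarrow> acomm x y = 0"
  shows "x = 0"
proof -
  define R where "R = {x \<in> W. \<forall>y\<in>W. acomm x y = 0}"
  have R: "vs.subspace R"
    using cyc_subspace[of e w] unfolding vs.subspace_def R_def by (auto simp: acomm_simps acomm_sc)
  have RW: "R \<subseteq> W" unfolding R_def by blast
  have RD: "D x \<in> R" if "x \<in> R" for x
  proof -
    have xW: "x \<in> W" using that RW by blast
    have "acomm (D x) y = 0" if y: "y \<in> W" for y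
      using skew[OF xW y] \<open>x \<in> R\<close> cyc_der[OF y] unfolding R_def by simp
    then show ?thesis using cyc_der[OF xW] unfolding R_def by blast
  qed
  have "R \<subseteq> {0}"
  proof (rule radical[OF R])
    show "R \<subseteq> Od" using RW W_Od by blast
    show "acomm x y = 0" if "x \<in> R" "y \<in> R" for x y using that RW unfolding R_def by blast
    show "acomm x w = 0" if "x \<in> R" for x using that cyc_base unfolding R_def by blast
    show "\<exists>g. (\<forall>i. g i \<in> R) \<and> x * A $ n = (\<Sum>i=0..n. A $ i * g (n - i))" if x: "x \<in> R" for x n
      using tau_nth_in[OF R RW RD x] mult_A_nth[of x n] by (intro exI[of _ "\<lambda>i. tau (fps_const x) $ i"]) blast
  qed
  then show ?thesis using x 0 unfolding R_def by blast
qed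

lemma skew_cyclic_W: "skew_cyclic W D (- w)"
proof (rule skew_cyclicI)
  show "vs.subspace W" by (rule cyc_subspace)
  then show "- w \<in> W" by (rule vs.subspace_neg[OF _ cyc_base])
  show "U = W" if U: "vs.subspace U" "U \<subseteq> W" "- w \<in> U" "\<forall>x\<in>U. D x \<in> U" for U
  proof
    have "w \<in> U" using vs.subspace_neg[OF U(1,3)] by simp
    then show "W \<subseteq> U" using U(4) by (intro cyc_least[OF U(1)]) blast+
  qed (fact U(2))
  show "x = 0" if "x \<in> W" "\<forall>y\<in>W. acomm x y = 0" for x
    using nondegenerate[of x] that by blast
qed (simp_all add: acomm_scalar cyc_der der_simps skew)

theorem clifford_realisation:
  obtains L f where "clif L" "snd ` set L \<subseteq> Od" "\<And>s s'. s \<in> fst ` set L \<Longrightarrow> s' \<in> fst ` set L \<Longrightarrow> s + s' \<noteq> 0"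
    "f 0 = 1" "A = lift f * vA L" "B = lift f * vB L" "P = lift f * vP L" "Q = lift f * vQ L"
proof -
  obtain S where S: "finite S" "Od \<subseteq> vs.span S" using fin by blast
  obtain Bs where Bs: "Bs \<subseteq> W" "vs.independent Bs" "W \<subseteq> vs.span Bs" "card Bs = vs.dim W"
    by (rule vs.basis_exists)
  have fB: "finite Bs"
    using vs.independent_span_bound[OF S(1) Bs(2)] Bs(1) W_Od S(2) by blast
  have sB: "vs.span Bs = W" using vs.span_minimal[OF Bs(1) cyc_subspace] Bs(3) by blast
  obtain L where L: "clif L" "snd ` set L \<subseteq> W" "- w = sum_list (map snd L)"
      "\<forall>x\<in>W. der (ve L) x = D x"
      "\<forall>s\<in>fst ` set L. \<exists>x\<in>W. x \<noteq> 0 \<and> D x + acomm (- w) x * (- w) = sc (2 * s) * x"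
    using skew_cyclic_clifford[OF skew_cyclic_W fB Bs(2) sB] by (elim exE conjE) (rule that; assumption)
  have LOd: "snd ` set L \<subseteq> Od" using L(2) W_Od by blast
  \<comment> \<open>The case \<open>s = s'\<close> is included, so this also excludes zero weights
    and negatives among equal ones.\<close>
  have typc: "s + s' \<noteq> 0" if ss: "s \<in> fst ` set L" "s' \<in> fst ` set L" for s s'
  proof -
    obtain x where x: "x \<in> W" "x \<noteq> 0" "D x + acomm (- w) x * (- w) = sc (2 * s) * x" using L(5) ss(1) by blast
    obtain y where y: "y \<in> W" "y \<noteq> 0" "D y + acomm (- w) y * (- w) = sc (2 * s') * y" using L(5) ss(2) by blast
    have "2 * s + 2 * s' \<noteq> 0" by (rule skew_cyclic_eigenvalues[OF skew_cyclic_W x y])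
    then show ?thesis by (metis distrib_left mult_zero_right)
  qed
  have vw: "vw L = w" using v_nth_low[of L] L(3) by (metis minus_minus)
  interpret V: yq sc "vA L" "vB L" "vP L" "vQ L" "ve L" w
    using v_yq[OF L(1)] unfolding vw .
  \<comment> \<open>Both sides obey the recursion of \<open>pq_nth\<close> with the same
    \<open>w\<close>, and \<open>D\<close> agrees with \<open>der (ve L)\<close> on
    \<open>W\<close>.\<close>
  have pq: "p $ n = V.p $ n \<and> q $ n = V.q $ n" for n
  proof (induction n)
    case 0
    then show ?case by (simp add: p0 q0 V.p0 V.q0)
  next
    case (Suc n)
    have "D (q $ n) = der (ve L) (V.q $ n)" "D (p $ n) = der (ve L) (V.p $ n)"
      using L(4) pq_in_W[of n] Suc by metis+
    then show ?case unfolding D_q D_p V.D_q V.D_p using Suc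
      by (simp add: double_eq_iff flip: minus_add_distrib)
  qed
  then have p_eq: "p = V.p" and q_eq: "q = V.q" by (simp_all add: fps_eq_iff)
  \<comment> \<open>The quotient of the two series; the remaining task is to show that its
    coefficients are scalars.\<close>
  define K where "K = A * V.Ai"
  have AK: "A = K * vA L" by (simp add: K_def mult.assoc V.Ai)
  have Kw: "fps_const w * K = K * fps_const w"
  proof -
    have "(fps_const w + (V.p + V.p)) * V.Ai = V.Ai * (vA L * (fps_const w + (V.p + V.p))) * V.Ai"
      by (simp only: V.Ai')
    also have "\<dots> = V.Ai * fps_const w" unfolding V.wA[symmetric] by (simp add: mult.assoc V.Ai)
    finally have "(fps_const w + (p + p)) * V.Ai = V.Ai * fps_const w" unfolding p_eq .
    then show ?thesis unfolding K_def by (simp only: wA mult.assoc[symmetric]) (simp only: mult.assoc)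
  qed
  \<comment> \<open>The two derivations agree on the generators, so \<open>d\<close> commutes with
    every polynomial in them.\<close>
  define d where "d = e - ve L"
  have "\<forall>\<eta>\<in>snd ` set L. d * \<eta> = \<eta> * d"
  proof
    fix \<eta> assume "\<eta> \<in> snd ` set L"
    then have "der (ve L) \<eta> = D \<eta>" using L(2,4) by blast
    then show "d * \<eta> = \<eta> * d" unfolding d_def der_def by (simp add: algebra_simps)
  qed
  from conjunct1[OF v_commute_even[OF this]] have "fps_const d * vA L = vA L * fps_const d" .
  then have evA: "fps_const e * vA L = vA L * fps_const e"
    using V.eA unfolding d_def by (simp add: algebra_simps flip: fps_const_sub)
  have Ke: "fps_const e * K = K * fps_const e"
  proof -
    have "fps_const e * V.Ai = V.Ai * (vA L * fps_const e) * V.Ai" by (simp only: V.Ai')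
    also have "\<dots> = V.Ai * fps_const e" unfolding evA[symmetric] by (simp add: mult.assoc V.Ai)
    finally have 1: "fps_const e * V.Ai = V.Ai * fps_const e" .
    show ?thesis unfolding K_def by (simp only: eA 1 mult.assoc[symmetric]) (simp only: mult.assoc 1)
  qed
  have KW: "K $ n * x = x * K $ n" if "x \<in> W" for n x
  proof (rule cyc_commutant[OF _ _ that])
    show "K $ n * e = e * K $ n" using arg_cong[OF Ke, of "\<lambda>f. f $ n"] by simp
    show "K $ n * w = w * K $ n" using arg_cong[OF Kw, of "\<lambda>f. f $ n"] by simp
  qed
  have Kv: "K $ n * vA L $ m = vA L $ m * K $ n" for n m
  proof -
    have "\<forall>\<eta>\<in>snd ` set L. K $ n * \<eta> = \<eta> * K $ n" using KW L(2) by blast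
    from arg_cong[OF conjunct1[OF v_commute_even[OF this]], of "\<lambda>f. f $ m"] show ?thesis by simp
  qed
  have v0: "vA L $ 0 = 1" using v_nth_low by blast
  have K0: "K $ 0 = 1" using arg_cong[OF AK, of "\<lambda>f. f $ 0"] A0 v0 by simp
  have vEv: "vA L $ n \<in> Ev" for n using v_graded[OF LOd] by blast
  have KEv: "K $ n \<in> Ev" for n
  proof (induction n rule: less_induct)
    case (less n)
    have "A $ n = (\<Sum>i=0..n. K $ i * vA L $ (n - i))" using AK by (simp add: fps_mult_nth)
    also have "\<dots> = (\<Sum>i=0..<n. K $ i * vA L $ (n - i)) + K $ n"
      by (cases n) (simp_all add: v0 atLeastLessThanSuc_atLeastAtMost)
    finally have "K $ n = A $ n - (\<Sum>i=0..<n. K $ i * vA L $ (n - i))" by simp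
    then show ?case using less vEv
      by (auto intro!: vs.subspace_diff[OF Ev_sub] vs.subspace_sum[OF Ev_sub] A_Ev Ev_Ev)
  qed
  have A_nth: "A $ n = (\<Sum>i=0..n. K $ i * vA L $ (n - i))" for n
    using AK by (simp add: fps_mult_nth)
  \<comment> \<open>Induction on \<open>k + l\<close>. In the expansion of
    \<open>A $ k * A $ l = A $ l * A $ k\<close> only the two extreme terms survive, so the
    commutator of coefficients of \<open>vA L\<close> is minus the one for \<open>K\<close>. Since
    \<open>K\<close> commutes with \<open>vA L\<close> and \<open>w\<close>, this element commutes
    with the whole action; it is scalar by \<open>schur\<close> and zero by
    \<open>trace\<close>.\<close>
  have comm: "vA L $ k * vA L $ l = vA L $ l * vA L $ k \<and> K $ k * K $ l = K $ l * K $ k" for k l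
  proof (induction "k + l" arbitrary: k l rule: less_induct)
    case less
    show ?case
    proof (cases "k + l = 0")
      case False
      define a where "a = vA L"
      have Ka: "K $ n * a $ m = a $ m * K $ n" for n m unfolding a_def by (rule Kv)
      define t where "t = (\<lambda>(i, j). K $ i * K $ j * (a $ (k - i) * a $ (l - j)) - K $ j * K $ i * (a $ (l - j) * a $ (k - i)))"
      have "A $ k * A $ l = (\<Sum>i=0..k. \<Sum>j=0..l. K $ i * a $ (k - i) * (K $ j * a $ (l - j)))"
        unfolding A_nth a_def by (rule sum_product)
      also have "\<dots> = (\<Sum>i=0..k. \<Sum>j=0..l. K $ i * K $ j * (a $ (k - i) * a $ (l - j)))"
        by (intro sum.cong refl) (metis Ka mult.assoc)
      finally have 1: "A $ k * A $ l = (\<Sum>(i, j)\<in>{0..k} \<times> {0..l}. K $ i * K $ j * (a $ (k - i) * a $ (l - j)))"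
        by (simp add: sum.cartesian_product)
      have "A $ l * A $ k = (\<Sum>j=0..l. \<Sum>i=0..k. K $ j * a $ (l - j) * (K $ i * a $ (k - i)))"
        unfolding A_nth a_def by (rule sum_product)
      also have "\<dots> = (\<Sum>i=0..k. \<Sum>j=0..l. K $ j * a $ (l - j) * (K $ i * a $ (k - i)))"
        by (rule sum.swap)
      also have "\<dots> = (\<Sum>i=0..k. \<Sum>j=0..l. K $ j * K $ i * (a $ (l - j) * a $ (k - i)))"
        by (intro sum.cong refl) (metis Ka mult.assoc)
      finally have 2: "A $ l * A $ k = (\<Sum>(i, j)\<in>{0..k} \<times> {0..l}. K $ j * K $ i * (a $ (l - j) * a $ (k - i)))"
        by (simp add: sum.cartesian_product)
      have "0 = (\<Sum>x\<in>{0..k} \<times> {0..l}. t x)"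
        using A_comm[of k l] unfolding 1 2 t_def by (simp add: case_prod_beta sum_subtractf)
      also have "\<dots> = (\<Sum>x\<in>{(0, 0), (k, l)}. t x)"
      proof (rule sum.mono_neutral_right)
        show "\<forall>x\<in>{0..k} \<times> {0..l} - {(0, 0), (k, l)}. t x = 0"
        proof
          fix x assume x: "x \<in> {0..k} \<times> {0..l} - {(0, 0), (k, l)}"
          obtain i j where ij: "x = (i, j)" by force
          have "i + j < k + l" "(k - i) + (l - j) < k + l" using x unfolding ij by auto
          then show "t x = 0" using less(1) unfolding ij t_def a_def by simp
        qed
      qed auto
      also have "\<dots> = (a $ k * a $ l - a $ l * a $ k) + (K $ k * K $ l - K $ l * K $ k)"
        using False unfolding t_def a_def by (auto simp: K0 v0)
      finally have c: "a $ k * a $ l - a $ l * a $ k = - (K $ k * K $ l - K $ l * K $ k)"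
        by (simp only: eq_neg_iff_add_eq_0)
      define c0 where "c0 = a $ k * a $ l - a $ l * a $ k"
      have sub: "vs.subspace {y. c0 * y = y * c0}" by (rule commutant_subspace)
      have prod: "(x * y - y * x) * u = u * (x * y - y * x)" if "x * u = u * x" "y * u = u * y" for x y u :: 'a
      proof -
        have "x * y * u = u * (x * y)" "y * x * u = u * (y * x)" using that by (metis mult.assoc)+
        then show ?thesis by (simp add: algebra_simps)
      qed
      have zK: "c0 * K $ n = K $ n * c0" for n unfolding c0_def by (rule prod) (simp_all add: Ka)
      have za: "c0 * a $ n = a $ n * c0" for n
        using prod[OF Ka[of l n] Ka[of k n]] unfolding c0_def c by simp
      have zw: "c0 * w = w * c0"
        using prod[OF KW[OF cyc_base, of l] KW[OF cyc_base, of k]] unfolding c0_def c by simp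
      have "c0 * A $ n = A $ n * c0" for n
      proof -
        have "c0 * (K $ i * a $ (n - i)) = K $ i * a $ (n - i) * c0" for i
          by (metis zK za mult.assoc)
        then show ?thesis unfolding A_nth a_def[symmetric] by (simp add: sum_distrib_left sum_distrib_right)
      qed
      moreover have "c0 \<in> Ev" unfolding c0_def a_def by (intro vs.subspace_diff[OF Ev_sub] Ev_Ev vEv)
      ultimately have "c0 \<in> range sc" using zw by (intro schur)
      then obtain b where b: "c0 = sc b" by blast
      then have "b = 0" using trace[OF vEv vEv, of k l b] unfolding c0_def a_def by simp
      then have "c0 = 0" using b by simp
      then show ?thesis using c unfolding c0_def a_def by simp
    qed (simp add: K0)
  qed
  have "K $ n \<in> range sc" for n
  proof (rule schur[OF KEv])
    show "K $ n * w = w * K $ n" by (rule KW[OF cyc_base])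
    fix m
    have "K $ n * (K $ i * vA L $ (m - i)) = K $ i * vA L $ (m - i) * K $ n" for i
      using comm[of n i] Kv[of n "m - i"] by (metis mult.assoc)
    then show "K $ n * A $ m = A $ m * K $ n"
      unfolding A_nth by (simp add: sum_distrib_left sum_distrib_right)
  qed
  then have "\<forall>n. \<exists>c. K $ n = sc c" by blast
  then obtain f where f: "\<And>n. K $ n = sc (f n)" by metis
  have KL: "K = lift f" by (rule fps_ext) (simp add: lift_def f)
  have "f 0 = 1" using f[of 0] K0 sc_inj[of "f 0" 1] by simp
  moreover have A: "A = lift f * vA L" using AK unfolding KL .
  moreover have P: "P = lift f * vP L"
  proof -
    have "A * V.p = lift f * (vA L * V.p)" by (subst A) (rule mult.assoc)
    moreover have "A * V.p = P" unfolding p_eq[symmetric] by (rule P_eq[symmetric])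
    ultimately show ?thesis by (simp only: V.P_eq[symmetric])
  qed
  moreover have Q: "Q = lift f * vQ L"
  proof -
    have "A * V.q = lift f * (vA L * V.q)" by (subst A) (rule mult.assoc)
    moreover have "A * V.q = Q" unfolding q_eq[symmetric] by (rule Q_eq[symmetric])
    ultimately show ?thesis by (simp only: V.Q_eq[symmetric])
  qed
  moreover have "B = lift f * vB L"
  proof -
    have "- (B + B) = lift f * (vQ L * fps_const w + fps_const w * vQ L)"
      unfolding QO[symmetric] Q by (simp add: algebra_simps) (simp add: lift_central[of "fps_const w"] flip: mult.assoc)
    also have "\<dots> = - (lift f * vB L + lift f * vB L)" unfolding V.QO by (simp add: algebra_simps)
    finally show ?thesis by (simp add: fps_double_eq_iff flip: minus_add_distrib)
  qed
  ultimately show ?thesis using that L(1) LOd typc by blast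
qed

end

section \<open>Matrices as operators on sequences\<close>

text \<open>Matrices of different sizes are put into a single ring type: an \<open>N \<times> N\<close> matrix acts
  block by block on sequences, which is a unital embedding for every \<open>N > 0\<close>.\<close>

typedef lop = "{f :: (nat \<Rightarrow> complex) \<Rightarrow> nat \<Rightarrow> complex.
    (\<forall>x y. f (\<lambda>n. x n + y n) = (\<lambda>n. f x n + f y n)) \<and> (\<forall>c x. f (\<lambda>n. c * x n) = (\<lambda>n. c * f x n))}"
  morphisms lapp Lop
  by (rule exI[of _ "\<lambda>x. x"]) simp

lemma lapp_add: "lapp f (\<lambda>n. x n + y n) = (\<lambda>n. lapp f x n + lapp f y n)"
  and lapp_scale: "lapp f (\<lambda>n. c * x n) = (\<lambda>n. c * lapp f x n)"
  using lapp[of f] by auto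

lemma lapp_zero: "lapp f (\<lambda>n. 0) = (\<lambda>n. 0)"
  using lapp_scale[of f 0 "\<lambda>n. 0"] by simp

lemma lapp_Lop:
  assumes "\<And>x y. f (\<lambda>n. x n + y n) = (\<lambda>n. f x n + f y n)" "\<And>c x. f (\<lambda>n. c * x n) = (\<lambda>n. c * f x n)"
  shows "lapp (Lop f) = f"
  using assms by (intro Lop_inverse) simp

lemma lop_eqI: "(\<And>x n. lapp f x n = lapp g x n) \<Longrightarrow> f = g"
  by (intro lapp_inject[THEN iffD1] ext)

instantiation lop :: ring_1
begin

definition "0 = Lop (\<lambda>x n. 0)"
definition "1 = Lop (\<lambda>x. x)"
definition "f + g = Lop (\<lambda>x n. lapp f x n + lapp g x n)"
definition "f - g = Lop (\<lambda>x n. lapp f x n - lapp g x n)"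
definition "- f = Lop (\<lambda>x n. - lapp f x n)"
definition "f * g = Lop (\<lambda>x. lapp f (lapp g x))"

lemma lapp_simps:
  "lapp 0 = (\<lambda>x n. 0)" "lapp 1 = (\<lambda>x. x)" "lapp (f + g) = (\<lambda>x n. lapp f x n + lapp g x n)"
  "lapp (f - g) = (\<lambda>x n. lapp f x n - lapp g x n)" "lapp (- f) = (\<lambda>x n. - lapp f x n)"
  "lapp (f * g) = (\<lambda>x. lapp f (lapp g x))"
  unfolding zero_lop_def one_lop_def plus_lop_def minus_lop_def uminus_lop_def times_lop_def
  by (rule lapp_Lop; simp add: lapp_add lapp_scale algebra_simps)+

instance
proof
  have "lapp 0 (\<lambda>n. 1) 0 \<noteq> lapp 1 (\<lambda>n. 1) 0" by (simp add: lapp_simps)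
  then show "(0::lop) \<noteq> 1" by metis
qed (rule lop_eqI; simp add: lapp_simps lapp_add algebra_simps)+

end

definition scl :: "complex \<Rightarrow> lop" where
  "scl c = Lop (\<lambda>x n. c * x n)"

lemma lapp_scl: "lapp (scl c) = (\<lambda>x n. c * x n)"
  unfolding scl_def by (rule lapp_Lop) (simp_all add: algebra_simps)

interpretation op: calg scl
  by unfold_locales (rule lop_eqI; simp add: lapp_simps lapp_scl lapp_scale algebra_simps)+

lemma lapp_sum: "lapp (sum f S) x n = (\<Sum>i\<in>S. lapp (f i) x n)"
  by (induction S rule: infinite_finite_induct) (simp_all add: lapp_simps)

definition emb :: "nat \<Rightarrow> complex mat \<Rightarrow> lop" where
  "emb N A = Lop (\<lambda>x k. \<Sum>j<N. A $$ (k mod N, j) * x (k div N * N + j))"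

lemma lapp_emb: "lapp (emb N A) = (\<lambda>x k. \<Sum>j<N. A $$ (k mod N, j) * x (k div N * N + j))"
  unfolding emb_def
  by (rule lapp_Lop) (simp_all add: distrib_left sum.distrib sum_distrib_left algebra_simps)

context
  fixes N :: nat
  assumes N: "N > 0"
begin

lemma emb_add: "A \<in> carrier_mat N N \<Longrightarrow> B \<in> carrier_mat N N \<Longrightarrow> emb N (A + B) = emb N A + emb N B"
  by (rule lop_eqI) (simp add: lapp_emb lapp_simps N distrib_right sum.distrib)

lemma emb_minus: "A \<in> carrier_mat N N \<Longrightarrow> B \<in> carrier_mat N N \<Longrightarrow> emb N (A - B) = emb N A - emb N B"
  by (rule lop_eqI) (simp add: lapp_emb lapp_simps N left_diff_distrib sum_subtractf)

lemma emb_uminus: "A \<in> carrier_mat N N \<Longrightarrow> emb N (- A) = - emb N A"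
  by (rule lop_eqI) (simp add: lapp_emb lapp_simps N sum_negf)

lemma emb_smult: "A \<in> carrier_mat N N \<Longrightarrow> emb N (c \<cdot>\<^sub>m A) = scl c * emb N A"
  by (rule lop_eqI) (simp add: lapp_emb lapp_simps lapp_scl N sum_distrib_left mult.assoc)

lemma emb_zero: "emb N (0\<^sub>m N N) = 0"
  by (rule lop_eqI) (simp add: lapp_emb lapp_simps N)

lemma emb_one: "emb N (1\<^sub>m N) = 1"
proof (rule lop_eqI)
  fix x k
  have "lapp (emb N (1\<^sub>m N)) x k = (\<Sum>j<N. if j = k mod N then x (k div N * N + j) else 0)"
    unfolding lapp_emb by (intro sum.cong refl) (auto simp: N)
  also have "\<dots> = lapp 1 x k" by (simp add: N lapp_simps)
  finally show "lapp (emb N (1\<^sub>m N)) x k = lapp 1 x k" .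
qed

lemma emb_mult:
  assumes A: "A \<in> carrier_mat N N" and B: "B \<in> carrier_mat N N"
  shows "emb N (A * B) = emb N A * emb N B"
proof (rule lop_eqI)
  fix x k
  have "lapp (emb N (A * B)) x k = (\<Sum>j<N. \<Sum>l<N. A $$ (k mod N, l) * (B $$ (l, j) * x (k div N * N + j)))"
    unfolding lapp_emb using A B
    by (intro sum.cong refl) (simp add: N scalar_prod_def sum_distrib_right mult.assoc lessThan_atLeast0)
  also have "\<dots> = (\<Sum>l<N. \<Sum>j<N. A $$ (k mod N, l) * (B $$ (l, j) * x (k div N * N + j)))"
    by (rule sum.swap)
  also have "\<dots> = lapp (emb N A * emb N B) x k"
    unfolding lapp_simps lapp_emb by (simp add: sum_distrib_left)
  finally show "lapp (emb N (A * B)) x k = lapp (emb N A * emb N B) x k" .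
qed

text \<open>Vectors are placed in block 0, where \<open>emb N A\<close> acts as \<open>A\<close>;
  this is the way back from operators on sequences to vectors.\<close>

definition ext :: "complex vec \<Rightarrow> nat \<Rightarrow> complex" where
  "ext v = (\<lambda>k. if k < dim_vec v then vec_index v k else 0)"

lemma lapp_emb_ext:
  assumes "A \<in> carrier_mat N N" "v \<in> carrier_vec N"
  shows "lapp (emb N A) (ext v) = ext (A *\<^sub>v v)"
proof
  fix k
  show "lapp (emb N A) (ext v) k = ext (A *\<^sub>v v) k"
  proof (cases "k < N")
    case True
    then show ?thesis using assms
      by (simp add: lapp_emb ext_def scalar_prod_def lessThan_atLeast0)
  next
    case False
    then have "k div N \<ge> 1" using N by (simp add: div_greater_zero_iff Suc_le_eq)
    then have "k div N * N \<ge> N" by simp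
    then have "\<not> k div N * N + j < N" for j by linarith
    then show ?thesis using assms False by (simp add: lapp_emb ext_def)
  qed
qed

lemma ext_inj: "v \<in> carrier_vec N \<Longrightarrow> u \<in> carrier_vec N \<Longrightarrow> ext v = ext u \<longleftrightarrow> v = u"
  by (auto simp: ext_def fun_eq_iff split: if_splits intro!: eq_vecI)

lemma ext_zero: "ext (0\<^sub>v N) = (\<lambda>k. 0)"
  by (auto simp: ext_def)

lemma emb_inj:
  assumes A: "A \<in> carrier_mat N N" and B: "B \<in> carrier_mat N N"
  shows "emb N A = emb N B \<longleftrightarrow> A = B"
proof
  assume e: "emb N A = emb N B"
  show "A = B"
  proof (rule eq_matI)
    fix i j assume "i < dim_row B" "j < dim_col B"
    then have ij: "i < N" "j < N" using B by auto
    have "ext (A *\<^sub>v unit_vec N j) = ext (B *\<^sub>v unit_vec N j)"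
      using e lapp_emb_ext[OF A, of "unit_vec N j"] lapp_emb_ext[OF B, of "unit_vec N j"] by simp
    then have "vec_index (A *\<^sub>v unit_vec N j) i = vec_index (B *\<^sub>v unit_vec N j) i"
      using A B by (subst (asm) ext_inj) auto
    then show "A $$ (i, j) = B $$ (i, j)" using A B ij by simp
  qed (use A B in auto)
qed simp

definition Evop :: "(nat \<Rightarrow> bool) \<Rightarrow> lop set" where
  "Evop pr = emb N ` {A. homog N pr False A}"

definition Odop :: "(nat \<Rightarrow> bool) \<Rightarrow> lop set" where
  "Odop pr = emb N ` {A. homog N pr True A}"

lemma homog_carrier: "homog N pr b A \<Longrightarrow> A \<in> carrier_mat N N"
  by (simp add: homog_def)

lemma homog_add: "homog N pr b A \<Longrightarrow> homog N pr b B \<Longrightarrow> homog N pr b (A + B)"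
  unfolding homog_def
proof (intro conjI allI impI; elim conjE)
  fix i j
  assume *: "A \<in> carrier_mat N N" "B \<in> carrier_mat N N" "i < N" "j < N" "(A + B) $$ (i, j) \<noteq> 0"
    "\<forall>a<N. \<forall>c<N. A $$ (a, c) \<noteq> 0 \<longrightarrow> (pr a \<longleftrightarrow> pr c) = (\<not> b)"
    "\<forall>a<N. \<forall>c<N. B $$ (a, c) \<noteq> 0 \<longrightarrow> (pr a \<longleftrightarrow> pr c) = (\<not> b)"
  then have "A $$ (i, j) \<noteq> 0 \<or> B $$ (i, j) \<noteq> 0" by auto
  then show "(pr i \<longleftrightarrow> pr j) = (\<not> b)" using * by blast
qed simp

lemma homog_smult: "homog N pr b A \<Longrightarrow> homog N pr b (c \<cdot>\<^sub>m A)"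
  unfolding homog_def by auto

lemma homog_zero: "homog N pr b (0\<^sub>m N N)"
  unfolding homog_def by auto

lemma homog_mult:
  assumes "homog N pr b A" "homog N pr c B"
  shows "homog N pr (b \<noteq> c) (A * B)"
  unfolding homog_def
proof (intro conjI allI impI)
  have A: "A \<in> carrier_mat N N" and B: "B \<in> carrier_mat N N" using assms homog_carrier by blast+
  then show "A * B \<in> carrier_mat N N" by simp
  fix i j assume ij: "i < N" "j < N" "(A * B) $$ (i, j) \<noteq> 0"
  then have "(\<Sum>l<N. A $$ (i, l) * B $$ (l, j)) \<noteq> 0"
    using A B by (simp add: scalar_prod_def lessThan_atLeast0)
  then obtain l where l: "l < N" "A $$ (i, l) * B $$ (l, j) \<noteq> 0"
    by (metis (no_types, lifting) lessThan_iff sum.neutral)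
  then have "(pr i \<longleftrightarrow> pr l) = (\<not> b)" "(pr l \<longleftrightarrow> pr j) = (\<not> c)"
    using assms ij unfolding homog_def by auto
  then show "(pr i \<longleftrightarrow> pr j) = (\<not> (b \<noteq> c))" by auto
qed

lemma homog_one: "homog N pr False (1\<^sub>m N)"
  unfolding homog_def by auto

lemma graded_algebra_op: "graded_algebra scl (Evop pr) (Odop pr)"
proof -
  have sub: "op.vs.subspace (emb N ` {A. homog N pr b A})" for b
  proof (rule op.vs.subspaceI)
    show "0 \<in> emb N ` {A. homog N pr b A}" using homog_zero emb_zero by force
    show "x + y \<in> emb N ` {A. homog N pr b A}"
      if "x \<in> emb N ` {A. homog N pr b A}" "y \<in> emb N ` {A. homog N pr b A}" for x y
      using that homog_add homog_carrier by (auto simp flip: emb_add)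
    show "scl c * x \<in> emb N ` {A. homog N pr b A}"
      if "x \<in> emb N ` {A. homog N pr b A}" for x c
      using that homog_smult homog_carrier by (auto simp flip: emb_smult)
  qed
  have mul: "x * y \<in> emb N ` {A. homog N pr (b \<noteq> c) A}"
    if "x \<in> emb N ` {A. homog N pr b A}" "y \<in> emb N ` {A. homog N pr c A}" for x y b c
    using that homog_mult[of pr b _ c] homog_carrier by (auto simp flip: emb_mult)
  show ?thesis
    using sub mul[of _ False _ False] mul[of _ True _ False] mul[of _ False _ True] mul[of _ True _ True]
      homog_one[of pr] emb_one
    unfolding Evop_def Odop_def by unfold_locales (auto intro: rev_image_eqI)
qed

lemma emb_finite_span: "\<exists>S. finite S \<and> emb N ` carrier_mat N N \<subseteq> op.vs.span S"
proof -
  define E where "E = (\<lambda>(i, j). emb N (mat N N (\<lambda>ab. if ab = (i, j) then 1 else 0)))"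
  have "emb N A \<in> op.vs.span (E ` ({..<N} \<times> {..<N}))" if A: "A \<in> carrier_mat N N" for A
  proof -
    have "emb N A = (\<Sum>ij\<in>{..<N} \<times> {..<N}. scl (A $$ ij) * E ij)"
    proof (rule lop_eqI)
      fix x k
      let ?i = "k mod N"
      have i: "?i < N" using N by simp
      have "lapp (\<Sum>ij\<in>{..<N} \<times> {..<N}. scl (A $$ ij) * E ij) x k
        = (\<Sum>a<N. \<Sum>b<N. A $$ (a, b) * (\<Sum>j<N. (if (?i, j) = (a, b) then 1 else 0) * x (k div N * N + j)))"
        unfolding lapp_sum E_def lapp_simps lapp_scl sum.cartesian_product
        by (intro sum.cong refl) (auto simp: lapp_emb i)
      also have "\<dots> = (\<Sum>a<N. if a = ?i then (\<Sum>b<N. A $$ (?i, b) * x (k div N * N + b)) else 0)"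
        by (intro sum.cong refl) (auto simp: if_distrib[of "\<lambda>t. t * _"] cong: if_cong)
      also have "\<dots> = lapp (emb N A) x k" using i by (simp add: lapp_emb)
      finally show "lapp (emb N A) x k = lapp (\<Sum>ij\<in>{..<N} \<times> {..<N}. scl (A $$ ij) * E ij) x k" ..
    qed
    then show ?thesis
      by (simp only:) (intro op.vs.span_sum op.vs.span_scale op.vs.span_base imageI)
  qed
  then show ?thesis by (intro exI[of _ "E ` ({..<N} \<times> {..<N})"]) auto
qed

end

definition mtr :: "complex mat \<Rightarrow> complex" where
  "mtr A = (\<Sum>i<dim_row A. A $$ (i, i))"

lemma mtr_comm:
  assumes "A \<in> carrier_mat n m" "B \<in> carrier_mat m n"
  shows "mtr (A * B) = mtr (B * A)"
proof -
  have "mtr (A * B) = (\<Sum>i<n. \<Sum>j<m. A $$ (i, j) * B $$ (j, i))"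
    using assms by (simp add: mtr_def scalar_prod_def lessThan_atLeast0)
  also have "\<dots> = (\<Sum>j<m. \<Sum>i<n. A $$ (i, j) * B $$ (j, i))" by (rule sum.swap)
  also have "\<dots> = mtr (B * A)"
    using assms by (simp add: mtr_def scalar_prod_def lessThan_atLeast0 mult.commute)
  finally show ?thesis .
qed

text \<open>A commutator has trace zero, whereas the scalar matrix has trace
  \<open>c * of_nat N\<close>.\<close>

lemma commutator_not_scalar:
  assumes A: "A \<in> carrier_mat N N" and B: "B \<in> carrier_mat N N" and N: "N > 0"
    and c: "emb N A * emb N B - emb N B * emb N A = scl c"
  shows "c = 0"
proof -
  have "emb N (A * B - B * A) = emb N (c \<cdot>\<^sub>m 1\<^sub>m N)"
    using c A B by (simp add: emb_minus[OF N] emb_mult[OF N] emb_smult[OF N] emb_one[OF N])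
  then have "A * B - B * A = c \<cdot>\<^sub>m 1\<^sub>m N" using A B emb_inj[OF N] by (metis minus_carrier_mat mult_carrier_mat one_carrier_mat smult_carrier_mat)
  then have "mtr (A * B - B * A) = mtr (c \<cdot>\<^sub>m 1\<^sub>m N)" by simp
  moreover have "mtr (A * B - B * A) = mtr (A * B) - mtr (B * A)"
    using A B by (simp add: mtr_def sum_subtractf)
  moreover have "mtr (c \<cdot>\<^sub>m 1\<^sub>m N) = c * of_nat N" by (simp add: mtr_def)
  ultimately show ?thesis using mtr_comm[OF A B] N by simp
qed

section \<open>The modules \<open>V(s) \<otimes> \<Gamma>\<^sub>f\<close>\<close>

context calg
begin

text \<open>With the degrees recombined, \<open>EV\<close> and \<open>OV\<close> are the full series
  T_{1,1} and T_{-1,1} of V(s).\<close>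

definition EV where "EV L = vA L + vB L"
definition OV where "OV L = vP L + vQ L"

lemma EV_Cons: "EV ((x, \<xi>) # L) $ Suc n = EV L $ Suc n - sc x * EV L $ n + OV L $ n * \<xi>"
  and OV_Cons: "OV ((x, \<xi>) # L) $ Suc n = OV L $ Suc n + sc x * OV L $ n - EV L $ n * \<xi>"
  and EV_0: "EV L $ 0 = 1" and OV_0: "OV L $ 0 = 0"
  using v_nth_low[of L] by (simp_all add: EV_def OV_def algebra_simps)

lemma v_parity:
  shows "odd n \<Longrightarrow> vA L $ n = 0" "even n \<Longrightarrow> vB L $ n = 0" "odd n \<Longrightarrow> vP L $ n = 0" "even n \<Longrightarrow> vQ L $ n = 0"
proof -
  have "(odd n \<longrightarrow> vA L $ n = 0) \<and> (even n \<longrightarrow> vB L $ n = 0) \<and> (odd n \<longrightarrow> vP L $ n = 0) \<and> (even n \<longrightarrow> vQ L $ n = 0)"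
  proof (induction L arbitrary: n)
    case (Cons a L)
    show ?case using Cons.IH by (cases a; cases n) auto
  qed auto
  then show "odd n \<Longrightarrow> vA L $ n = 0" "even n \<Longrightarrow> vB L $ n = 0" "odd n \<Longrightarrow> vP L $ n = 0" "even n \<Longrightarrow> vQ L $ n = 0"
    by auto
qed

lemma v_in_subalgebra:
  assumes S: "vs.subspace S" "1 \<in> S" "\<And>x y. x \<in> S \<Longrightarrow> y \<in> S \<Longrightarrow> x * y \<in> S"
    and L: "snd ` set L \<subseteq> S"
  shows "EV L $ n \<in> S" "OV L $ n \<in> S"
proof -
  have "EV L $ n \<in> S \<and> OV L $ n \<in> S" using L
  proof (induction L arbitrary: n)
    case Nil
    then show ?case using S(2) vs.subspace_0[OF S(1)] by (simp add: EV_def OV_def)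
  next
    case (Cons a L)
    obtain x \<xi> where a: "a = (x, \<xi>)" by force
    have "\<xi> \<in> S" and IH: "EV L $ n \<in> S" "OV L $ n \<in> S" for n using Cons by (auto simp: a)
    then show ?case unfolding a
      by (cases n) (auto simp: EV_Cons OV_Cons EV_0 OV_0 S(2) vs.subspace_0[OF S(1)]
          intro!: vs.subspace_add[OF S(1)] vs.subspace_diff[OF S(1)] vs.subspace_scale[OF S(1)] S(3))
  qed
  then show "EV L $ n \<in> S" "OV L $ n \<in> S" by auto
qed

text \<open>\<epsilon> is the sign of the odd generator in the last factor of each product. The
  element \<Sigma>_k has \<epsilon> = 1, but removing the last factor flips the sign, so the
  recursion needs both values.\<close>

definition Sig :: "(nat \<Rightarrow> complex) \<Rightarrow> (nat \<Rightarrow> 'a) \<Rightarrow> nat \<Rightarrow> nat \<Rightarrow> complex \<Rightarrow> 'a" where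
  "Sig s \<xi> n k \<epsilon> = (\<Sum>S\<in>{S. S \<subseteq> {0..<n} \<and> card S = k}.
     prod_list (map (\<lambda>(j, i). sc (s i) + sc (\<epsilon> * (-1) ^ (k - Suc j)) * \<xi> i) (List.enumerate 0 (sorted_list_of_set S))))"

text \<open>Subsets are sorted by whether they contain the top index \<open>n\<close>, which then
  provides the last factor.\<close>

lemma Sig_Suc:
  "Sig s \<xi> (Suc n) (Suc k) \<epsilon> = Sig s \<xi> n (Suc k) \<epsilon> + Sig s \<xi> n k (- \<epsilon>) * (sc (s n) + sc \<epsilon> * \<xi> n)"
proof -
  let ?F = "\<lambda>k \<epsilon> S. prod_list (map (\<lambda>(j, i). sc (s i) + sc (\<epsilon> * (-1) ^ (k - Suc j)) * \<xi> i) (List.enumerate 0 (sorted_list_of_set S)))"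
  let ?P = "\<lambda>(n::nat) k. {S. S \<subseteq> {0..<n} \<and> card S = k}"
  have fin: "finite (?P n k)" for n k by (rule finite_subset[of _ "Pow {0..<n}"]) auto
  have fS: "finite S" if "S \<in> ?P n k" for S k using that finite_subset[of S "{0..<n}"] by auto
  have split: "?P (Suc n) (Suc k) = ?P n (Suc k) \<union> insert n ` ?P n k"
  proof (rule subset_antisym; rule subsetI)
    fix S assume S: "S \<in> ?P (Suc n) (Suc k)"
    show "S \<in> ?P n (Suc k) \<union> insert n ` ?P n k"
    proof (cases "n \<in> S")
      case True
      have "S - {n} \<in> ?P n k" using S True finite_subset[of S "{0..<Suc n}"]
        by (auto simp: less_Suc_eq card_Diff_singleton)
      moreover have "S = insert n (S - {n})" using True by auto
      ultimately show ?thesis by blast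
    next
      case False
      then have "S \<subseteq> {0..<n}" using S by (auto simp: less_Suc_eq)
      then show ?thesis using S by auto
    qed
  next
    fix S assume "S \<in> ?P n (Suc k) \<union> insert n ` ?P n k"
    then show "S \<in> ?P (Suc n) (Suc k)"
    proof
      assume "S \<in> insert n ` ?P n k"
      then obtain T where T: "S = insert n T" "T \<in> ?P n k" by blast
      have "n \<notin> T" using T by auto
      then show ?thesis using T fS[OF T(2)] by auto
    qed auto
  qed
  have disj: "?P n (Suc k) \<inter> insert n ` ?P n k = {}" by auto
  have inj: "inj_on (insert n) (?P n k)"
  proof (rule inj_onI)
    fix S T assume "S \<in> ?P n k" "T \<in> ?P n k" and eq: "insert n S = insert n T"
    then have "n \<notin> S" "n \<notin> T" by auto
    then show "S = T" using eq insert_ident[of n S T] by blast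
  qed
  \<comment> \<open>The index \<open>n\<close> comes last and gets exponent 0; every earlier
    exponent grows by one, which is absorbed into \<open>- \<epsilon>\<close>.\<close>
  have last: "?F (Suc k) \<epsilon> (insert n S) = ?F k (- \<epsilon>) S * (sc (s n) + sc \<epsilon> * \<xi> n)" if S: "S \<in> ?P n k" for S
  proof -
    have nS: "n \<notin> S" and lt: "\<forall>x\<in>S. x < n" using S by auto
    have "sorted_list_of_set (insert n S) = insort n (sorted_list_of_set S)"
      using nS fS[OF S] by (simp add: sorted_list_of_set_insert)
    also have "\<dots> = sorted_list_of_set S @ [n]"
      by (rule sorted_insort_is_snoc) (use lt fS[OF S] in \<open>auto intro: less_imp_le\<close>)
    finally have sl: "sorted_list_of_set (insert n S) = sorted_list_of_set S @ [n]" .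
    have len: "length (sorted_list_of_set S) = k" using S by simp
    have m: "map (\<lambda>(j, i). sc (s i) + sc (\<epsilon> * (-1) ^ (Suc k - Suc j)) * \<xi> i) (List.enumerate 0 (sorted_list_of_set S))
        = map (\<lambda>(j, i). sc (s i) + sc (- \<epsilon> * (-1) ^ (k - Suc j)) * \<xi> i) (List.enumerate 0 (sorted_list_of_set S))"
    proof (intro map_cong refl)
      fix ji assume "ji \<in> set (List.enumerate 0 (sorted_list_of_set S))"
      then have "fst ji < k" using len by (auto simp: in_set_enumerate_eq)
      then have "k - fst ji = Suc (k - Suc (fst ji))" by simp
      then show "(case ji of (j, i) \<Rightarrow> sc (s i) + sc (\<epsilon> * (-1) ^ (Suc k - Suc j)) * \<xi> i)
         = (case ji of (j, i) \<Rightarrow> sc (s i) + sc (- \<epsilon> * (-1) ^ (k - Suc j)) * \<xi> i)"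
        by (simp add: case_prod_beta)
    qed
    have l1: "prod_list (map (\<lambda>(j, i). sc (s i) + sc (\<epsilon> * (-1) ^ (Suc k - Suc j)) * \<xi> i) (List.enumerate (0 + k) [n]))
        = sc (s n) + sc \<epsilon> * \<xi> n" by simp
    show ?thesis unfolding sl enumerate_append_eq map_append prod_list.append len m l1 ..
  qed
  have "Sig s \<xi> (Suc n) (Suc k) \<epsilon> = (\<Sum>S\<in>?P n (Suc k). ?F (Suc k) \<epsilon> S) + (\<Sum>S\<in>insert n ` ?P n k. ?F (Suc k) \<epsilon> S)"
    unfolding Sig_def split by (rule sum.union_disjoint[OF fin finite_imageI[OF fin] disj])
  also have "(\<Sum>S\<in>insert n ` ?P n k. ?F (Suc k) \<epsilon> S) = (\<Sum>S\<in>?P n k. ?F (Suc k) \<epsilon> (insert n S))"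
    by (rule sum.reindex_cong[OF inj refl refl])
  also have "\<dots> = Sig s \<xi> n k (- \<epsilon>) * (sc (s n) + sc \<epsilon> * \<xi> n)"
    unfolding Sig_def sum_distrib_right by (intro sum.cong refl last)
  finally show ?thesis unfolding Sig_def .
qed

lemma Sig_0: "Sig s \<xi> n 0 \<epsilon> = 1" 
proof -
  have "{S. S \<subseteq> {0..<n} \<and> card S = 0} = {{}}"
    using finite_subset[of _ "{0..<n}"] by auto
  then show ?thesis unfolding Sig_def by simp
qed

lemma Sig_empty: "Sig s \<xi> 0 (Suc k) \<epsilon> = 0"
  unfolding Sig_def by (rule sum.neutral) auto

text \<open>The recursions for \<open>EV\<close> and \<open>OV\<close> are the part without
  \<epsilon> and the part linear in \<epsilon> of one recursion for \<open>Sig\<close>, once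
  \<epsilon>^2 is replaced by 1.\<close>

lemma Sig_EV_OV:
  assumes "\<epsilon> * \<epsilon> = 1"
  shows "Sig s \<xi> n k \<epsilon> = sc ((-1) ^ k) *
    (EV (rev (map (\<lambda>i. (s i, \<xi> i)) [0..<n])) $ k + sc \<epsilon> * OV (rev (map (\<lambda>i. (s i, \<xi> i)) [0..<n])) $ k)"
  using assms
proof (induction n arbitrary: k \<epsilon>)
  case 0
  show ?case by (cases k) (simp_all add: Sig_0 Sig_empty EV_def OV_def)
next
  case (Suc n)
  show ?case
  proof (cases k)
    case 0
    then show ?thesis by (simp add: Sig_0 EV_0 OV_0)
  next
    case (Suc j)
    define E O' where "E = EV (rev (map (\<lambda>i. (s i, \<xi> i)) [0..<n]))" and "O' = OV (rev (map (\<lambda>i. (s i, \<xi> i)) [0..<n]))"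
    have 1: "Sig s \<xi> n (Suc j) \<epsilon> = sc ((-1) ^ Suc j) * (E $ Suc j + sc \<epsilon> * O' $ Suc j)"
      unfolding E_def O'_def by (rule Suc.IH[OF Suc.prems])
    have 2: "Sig s \<xi> n j (- \<epsilon>) = sc ((-1) ^ j) * (E $ j + sc (- \<epsilon>) * O' $ j)"
      unfolding E_def O'_def by (rule Suc.IH) (use Suc.prems in simp)
    have e1: "sc \<epsilon> * (sc \<epsilon> * y) = y" for y using Suc.prems by simp
    have e2: "O' $ j * (sc \<epsilon> * \<xi> n) = sc \<epsilon> * (O' $ j * \<xi> n)" "E $ j * (sc \<epsilon> * \<xi> n) = sc \<epsilon> * (E $ j * \<xi> n)"
      "O' $ j * sc (s n) = sc (s n) * O' $ j" "E $ j * sc (s n) = sc (s n) * E $ j"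
      by (simp_all only: sc_left_comm sc_comm[of _ "s n"])
    have "(E $ j + sc (- \<epsilon>) * O' $ j) * (sc (s n) + sc \<epsilon> * \<xi> n)
        = sc (s n) * E $ j + sc \<epsilon> * (E $ j * \<xi> n) - sc \<epsilon> * (sc (s n) * O' $ j) - O' $ j * \<xi> n"
      unfolding sc_minus by (simp add: distrib_left left_diff_distrib mult.assoc e2 e1 del: vs.scale_scale)
    then have "Sig s \<xi> (Suc n) k \<epsilon> = sc ((-1) ^ Suc j) * (E $ Suc j + sc \<epsilon> * O' $ Suc j
        - (sc (s n) * E $ j + sc \<epsilon> * (E $ j * \<xi> n) - sc \<epsilon> * (sc (s n) * O' $ j) - O' $ j * \<xi> n))"
      unfolding Suc Sig_Suc 1 2 by (simp add: mult.assoc sc_minus) (simp add: algebra_simps del: vs.scale_scale)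
    also have "\<dots> = sc ((-1) ^ k) *
      (EV (rev (map (\<lambda>i. (s i, \<xi> i)) [0..<Suc n])) $ k + sc \<epsilon> * OV (rev (map (\<lambda>i. (s i, \<xi> i)) [0..<Suc n])) $ k)"
      unfolding Suc by (simp add: EV_Cons OV_Cons E_def O'_def algebra_simps del: vs.scale_scale)
    finally show ?thesis .
  qed
qed

end

lemma emb_mprod:
  assumes N: "N > 0" and "\<forall>A\<in>set As. A \<in> carrier_mat N N"
  shows "emb N (mprod N As) = prod_list (map (emb N) As) \<and> mprod N As \<in> carrier_mat N N"
  using assms(2) by (induction As) (auto simp: mprod_def emb_one[OF N] emb_mult[OF N])

definition hL :: "complex list \<Rightarrow> hmod \<Rightarrow> (complex \<times> lop) list" where
  "hL s H = rev (map (\<lambda>i. (s ! i, emb (hdim H) (xi H i))) [0..<length s])"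

lemma emb_Sigma:
  assumes N: "hdim H > 0" and xi: "\<And>i. i < length s \<Longrightarrow> xi H i \<in> carrier_mat (hdim H) (hdim H)"
  shows "emb (hdim H) (Sigma_op s H k) = op.Sig (\<lambda>i. s ! i) (\<lambda>i. emb (hdim H) (xi H i)) (length s) k 1"
proof -
  let ?N = "hdim H"
  let ?f = "\<lambda>(j, i). (s ! i) \<cdot>\<^sub>m 1\<^sub>m ?N + sgn1 (k - Suc j) \<cdot>\<^sub>m xi H i"
  let ?P = "{S. S \<subseteq> {0..<length s} \<and> card S = k}"
  let ?l = "\<lambda>S. List.enumerate 0 (sorted_list_of_set S)"
  have "emb ?N (Sigma_op s H k) = (\<Sum>S\<in>?P. emb ?N (mprod ?N (map ?f (?l S))))"
  proof (rule lop_eqI)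
    fix x n
    have "lapp (emb ?N (Sigma_op s H k)) x n
       = (\<Sum>j<?N. \<Sum>S\<in>?P. mprod ?N (map ?f (?l S)) $$ (n mod ?N, j) * x (n div ?N * ?N + j))"
      unfolding lapp_emb Sigma_op_def using N by (intro sum.cong refl) (simp add: sum_distrib_right)
    also have "\<dots> = lapp (\<Sum>S\<in>?P. emb ?N (mprod ?N (map ?f (?l S)))) x n"
      unfolding lapp_sum lapp_emb by (rule sum.swap)
    finally show "lapp (emb ?N (Sigma_op s H k)) x n = lapp (\<Sum>S\<in>?P. emb ?N (mprod ?N (map ?f (?l S)))) x n" .
  qed
  also have "\<dots> = op.Sig (\<lambda>i. s ! i) (\<lambda>i. emb ?N (xi H i)) (length s) k 1"
    unfolding op.Sig_def
  proof (rule sum.cong[OF refl])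
    fix S assume S: "S \<in> ?P"
    then have fS: "finite S" using finite_subset[of S "{0..<length s}"] by auto
    have i: "snd ji < length s" if "ji \<in> set (?l S)" for ji
    proof -
      have "snd ji \<in> set (map snd (?l S))" using that by (simp only: set_map) (rule imageI)
      then have "snd ji \<in> S" using fS by simp
      then show ?thesis using S by auto
    qed
    then have c: "\<forall>A\<in>set (map ?f (?l S)). A \<in> carrier_mat ?N ?N"
      using xi by (auto simp: case_prod_beta)
    have m: "map (emb ?N) (map ?f (?l S))
      = map (\<lambda>(j, i). scl (s ! i) + scl (1 * (-1) ^ (k - Suc j)) * emb ?N (xi H i)) (?l S)"
      unfolding map_map
    proof (intro map_cong refl)
      fix ji assume ji: "ji \<in> set (?l S)"
      show "(emb ?N \<circ> ?f) ji = (case ji of (j, i) \<Rightarrow> scl (s ! i) + scl (1 * (-1) ^ (k - Suc j)) * emb ?N (xi H i))"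
        using xi[OF i[OF ji]] by (simp add: case_prod_beta emb_add[OF N] emb_smult[OF N] emb_one[OF N] sgn1_def)
    qed
    show "emb ?N (mprod ?N (map ?f (?l S))) =
       prod_list (map (\<lambda>(j, i). scl (s ! i) + scl (1 * (-1) ^ (k - Suc j)) * emb ?N (xi H i)) (?l S))"
      unfolding conjunct1[OF emb_mprod[OF N c]] m ..
  qed
  finally show ?thesis .
qed

lemma emb_even_odd_part:
  assumes N: "N > 0" and C: "C \<in> carrier_mat N N" and a: "a \<in> Evop N pr" and b: "b \<in> Odop N pr"
    and eq: "emb N C = a + b"
  shows "emb N (even_part N pr C) = a" "emb N (odd_part N pr C) = b"
proof -
  obtain A where A: "a = emb N A" "homog N pr False A" using a unfolding Evop_def[OF N] by auto
  obtain B where B: "b = emb N B" "homog N pr True B" using b unfolding Odop_def[OF N] by auto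
  have cA: "A \<in> carrier_mat N N" and cB: "B \<in> carrier_mat N N" using A B homog_carrier[OF N] by blast+
  have "emb N C = emb N (A + B)" using eq cA cB by (simp add: A(1) B(1) emb_add[OF N])
  then have CAB: "C = A + B" using emb_inj[OF N C, of "A + B"] cA cB by simp
  have hA: "A $$ (i, j) \<noteq> 0 \<Longrightarrow> pr i = pr j" and hB: "B $$ (i, j) \<noteq> 0 \<Longrightarrow> pr i \<noteq> pr j"
    if "i < N" "j < N" for i j using that A(2) B(2) unfolding homog_def by auto
  have "even_part N pr C = A"
  proof (rule eq_matI)
    fix i j assume "i < dim_row A" "j < dim_col A"
    then have ij: "i < N" "j < N" using cA by auto
    show "even_part N pr C $$ (i, j) = A $$ (i, j)"
      using hA[OF ij] hB[OF ij] ij cA cB unfolding CAB even_part_def by (cases "pr i = pr j") auto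
  qed (use cA in \<open>auto simp: even_part_def\<close>)
  then show "emb N (even_part N pr C) = a" using A by simp
  have "odd_part N pr C = B"
  proof (rule eq_matI)
    fix i j assume "i < dim_row B" "j < dim_col B"
    then have ij: "i < N" "j < N" using cB by auto
    show "odd_part N pr C $$ (i, j) = B $$ (i, j)"
      using hA[OF ij] hB[OF ij] ij cA cB unfolding CAB odd_part_def by (cases "pr i = pr j") auto
  qed (use cB in \<open>auto simp: odd_part_def\<close>)
  then show "emb N (odd_part N pr C) = b" using B by simp
qed

definition sgl :: "nat \<Rightarrow> lop" where "sgl m = (if even m then 1 else - 1)"

lemma scl_sgn1: "scl (sgn1 m) = sgl m"
  by (simp add: sgl_def sgn1_def op.sc_minus minus_one_power_iff)

lemma sgl_sgl: "sgl m * (sgl m * x) = x" "sgl m * sgl m = 1"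
  by (simp_all add: sgl_def)

lemma homog_hL:
  assumes "hdim H > 0" "\<And>i. i < length s \<Longrightarrow> homog (hdim H) (hpar H) True (xi H i)"
  shows "snd ` set (hL s H) \<subseteq> Odop (hdim H) (hpar H)"
  using assms unfolding hL_def Odop_def[OF assms(1)] by auto

text \<open>The sign (-1)^m in the homomorphism onto the W-algebra cancels the one in
  \<open>Sig_EV_OV\<close>, which leaves T_{1,1} and T_{-1,1} free of signs.\<close>

lemma V_mod_emb:
  assumes N: "hdim H > 0" and xi: "\<And>i. i < length s \<Longrightarrow> homog (hdim H) (hpar H) True (xi H i)"
  defines "L \<equiv> hL s H"
  shows "emb (hdim H) (act (V_mod s H) m 1 1) = op.EV L $ m"
    and "emb (hdim H) (act (V_mod s H) m (-1) 1) = op.OV L $ m"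
    and "emb (hdim H) (act (V_mod s H) m (-1) (-1)) = sgl m * op.EV L $ m"
    and "emb (hdim H) (act (V_mod s H) m 1 (-1)) = sgl m * op.OV L $ m"
    and "act (V_mod s H) m i j \<in> carrier_mat (hdim H) (hdim H)"
proof -
  let ?N = "hdim H" and ?pr = "hpar H"
  have cS: "Sigma_op s H m \<in> carrier_mat ?N ?N" by (simp add: Sigma_op_def)
  interpret graded_algebra scl "Evop ?N ?pr" "Odop ?N ?pr" by (rule graded_algebra_op[OF N])
  have gr: "op.EV L $ m \<in> Evop ?N ?pr" "op.OV L $ m \<in> Odop ?N ?pr"
    using v_graded[OF homog_hL[OF N xi], where n = m] op.vs.subspace_add[OF Ev_sub] op.vs.subspace_add[OF Od_sub]
    unfolding L_def op.EV_def op.OV_def by auto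
  have s1: "sgl m = scl ((-1) ^ m)" by (simp add: sgl_def op.sc_minus minus_one_power_iff)
  have gr': "sgl m * op.EV L $ m \<in> Evop ?N ?pr" "sgl m * op.OV L $ m \<in> Odop ?N ?pr"
    unfolding s1 by (intro op.vs.subspace_scale[OF Ev_sub] op.vs.subspace_scale[OF Od_sub] gr)+
  have "emb ?N (Sigma_op s H m) = sgl m * op.EV L $ m + sgl m * op.OV L $ m"
    using emb_Sigma[OF N homog_carrier[OF N xi], of s m]
    by (simp add: op.Sig_EV_OV L_def hL_def s1 distrib_left)
  note parts = emb_even_odd_part[OF N cS gr' this]
  have c: "even_part ?N ?pr C \<in> carrier_mat ?N ?N" "odd_part ?N ?pr C \<in> carrier_mat ?N ?N" for C
    by (simp_all add: even_part_def odd_part_def)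
  show "emb ?N (act (V_mod s H) m 1 1) = op.EV L $ m"
    "emb ?N (act (V_mod s H) m (-1) 1) = op.OV L $ m"
    "emb ?N (act (V_mod s H) m (-1) (-1)) = sgl m * op.EV L $ m"
    "emb ?N (act (V_mod s H) m 1 (-1)) = sgl m * op.OV L $ m"
    unfolding V_mod_def Let_def by (simp_all add: parts emb_smult[OF N] c scl_sgn1 sgl_sgl)
  show "act (V_mod s H) m i j \<in> carrier_mat ?N ?N"
    unfolding V_mod_def Let_def by (simp add: c)
qed

text \<open>The coefficient sequence of f(u) in powers of u^{-1}, so that tensoring with \<Gamma>_f
  becomes multiplication by \<open>op.lift (gam f)\<close>.\<close>

definition gam :: "(nat \<Rightarrow> complex) \<Rightarrow> nat \<Rightarrow> complex" where
  "gam f n = (if n = 0 then 1 else if even n then f (n div 2) else 0)"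

lemma tensor_Gamma_dim: "dim (tensor V (Gamma_mod f)) = dim V" "par (tensor V (Gamma_mod f)) = par V"
  by (auto simp: tensor_def Gamma_mod_def Let_def)

text \<open>Odd generators act by zero on the one-dimensional factor, so only \<open>k = j\<close>
  survives in the coproduct, and all signs attached to that term are 1.\<close>

lemma tensor_Gamma_emb:
  assumes N: "dim V > 0" and c: "\<And>m i j. act V m i j \<in> carrier_mat (dim V) (dim V)"
    and i: "i \<in> idx" and j: "j \<in> idx"
  shows "emb (dim V) (act (tensor V (Gamma_mod f)) r i j)
     = (\<Sum>s=0..r. scl (gam f (r - s)) * emb (dim V) (Tc V (int s) i j))"
    and "act (tensor V (Gamma_mod f)) r i j \<in> carrier_mat (dim V) (dim V)"
proof -
  let ?N = "dim V"
  have g: "Tc (Gamma_mod f) (int n) k j $$ (0, 0) = (if k = j then gam f n else 0)" for n k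
    by (auto simp: Tc_def Gamma_mod_def gam_def)
  have sg: "sgn1 ((pp i + pp j) * (pp j + pp j)) = 1" "sgn1 ((pp j + pp j) * b) = 1" for b
    by (simp_all add: sgn1_def flip: mult_2)
  have k: "(\<Sum>k\<in>idx. F k * (if k = j then g0 else 0)) = F j * g0" for F :: "int \<Rightarrow> complex" and g0
  proof -
    have "finite idx" by (simp add: idx_def)
    then show ?thesis using j by (simp add: if_distrib[of "(*) _"] cong: if_cong)
  qed
  have inner: "(\<Sum>k\<in>idx. sgn1 ((pp i + pp k) * (pp j + pp k)) * sgn1 ((pp k + pp j) * b) *
      Tc V t i k $$ xy * Tc (Gamma_mod f) (int n) k j $$ (0, 0)) = Tc V t i j $$ xy * gam f n" for t n b xy
    unfolding g k sg by simp
  have dG: "dim (Gamma_mod f) = 1" by (simp add: Gamma_mod_def)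
  have a: "act (tensor V (Gamma_mod f)) r i j = mat ?N ?N (\<lambda>(x, y). \<Sum>s=0..r. Tc V (int s) i j $$ (x, y) * gam f (r - s))"
    unfolding tensor_def Let_def dG smod.simps mult_1_right div_by_1 mod_by_1 inner ..
  show "act (tensor V (Gamma_mod f)) r i j \<in> carrier_mat ?N ?N" unfolding a by simp
  show "emb ?N (act (tensor V (Gamma_mod f)) r i j) = (\<Sum>s=0..r. scl (gam f (r - s)) * emb ?N (Tc V (int s) i j))"
  proof (rule lop_eqI)
    fix x n
    have "lapp (emb ?N (act (tensor V (Gamma_mod f)) r i j)) x n
        = (\<Sum>b<?N. \<Sum>s=0..r. gam f (r - s) * (Tc V (int s) i j $$ (n mod ?N, b) * x (n div ?N * ?N + b)))"
      unfolding lapp_emb a using N by (intro sum.cong refl) (simp add: sum_distrib_left sum_distrib_right mult.commute mult.left_commute)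
    also have "\<dots> = (\<Sum>s=0..r. \<Sum>b<?N. gam f (r - s) * (Tc V (int s) i j $$ (n mod ?N, b) * x (n div ?N * ?N + b)))"
      by (rule sum.swap)
    also have "\<dots> = lapp (\<Sum>s=0..r. scl (gam f (r - s)) * emb ?N (Tc V (int s) i j)) x n"
      unfolding lapp_sum lapp_simps lapp_scl lapp_emb by (simp add: sum_distrib_left)
    finally show "lapp (emb ?N (act (tensor V (Gamma_mod f)) r i j)) x n
      = lapp (\<Sum>s=0..r. scl (gam f (r - s)) * emb ?N (Tc V (int s) i j)) x n" .
  qed
qed

lemma tensor_V_mod_emb:
  fixes f :: "nat \<Rightarrow> complex"
  assumes N: "hdim H > 0" and xi: "\<forall>i<length s. homog (hdim H) (hpar H) True (xi H i)"
  defines "L \<equiv> hL s H" and "T \<equiv> tensor (V_mod s H) (Gamma_mod f)"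
  shows "dim T = hdim H" "par T = hpar H"
    and "emb (hdim H) (act T m 1 1) = (op.lift (gam f) * op.EV L) $ m"
    and "emb (hdim H) (act T m (-1) 1) = (op.lift (gam f) * op.OV L) $ m"
    and "emb (hdim H) (act T m (-1) (-1)) = sgl m * (op.lift (gam f) * op.EV L) $ m"
    and "emb (hdim H) (act T m 1 (-1)) = sgl m * (op.lift (gam f) * op.OV L) $ m"
    and "i \<in> idx \<Longrightarrow> j \<in> idx \<Longrightarrow> act T m i j \<in> carrier_mat (hdim H) (hdim H)"
proof -
  let ?N = "hdim H"
  have d: "dim (V_mod s H) = ?N" "par (V_mod s H) = hpar H" by (simp_all add: V_mod_def)
  show "dim T = hdim H" "par T = hpar H" unfolding T_def by (simp_all add: tensor_Gamma_dim d)
  note V = V_mod_emb[OF N xi[rule_format]]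
  have c: "\<And>m i j. act (V_mod s H) m i j \<in> carrier_mat (dim (V_mod s H)) (dim (V_mod s H))"
    using V(5) unfolding d .
  have N': "dim (V_mod s H) > 0" using N d by simp
  note T = tensor_Gamma_emb[OF N' c, of _ _ f m, unfolded d, folded T_def]
  show "i \<in> idx \<Longrightarrow> j \<in> idx \<Longrightarrow> act T m i j \<in> carrier_mat ?N ?N" by (rule T(2))
  have Tc: "emb ?N (Tc (V_mod s H) (int n) 1 1) = op.EV L $ n" "emb ?N (Tc (V_mod s H) (int n) (-1) 1) = op.OV L $ n"
    "emb ?N (Tc (V_mod s H) (int n) (-1) (-1)) = sgl n * op.EV L $ n" "emb ?N (Tc (V_mod s H) (int n) 1 (-1)) = sgl n * op.OV L $ n" for n
    by (cases "n = 0"; simp add: Tc_def d V L_def emb_one[OF N] emb_zero[OF N] op.EV_0 op.OV_0 sgl_def)+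
  have id: "(1::int) \<in> idx" "(-1::int) \<in> idx" by (auto simp: idx_def)
  have conv: "(op.lift (gam f) * F) $ m = (\<Sum>n=0..m. scl (gam f (m - n)) * F $ n)" for F
    unfolding op.lift_central[symmetric] fps_mult_nth by (simp add: op.lift_def op.sc_comm)
  \<comment> \<open>Only even \<open>m - n\<close> contribute, since \<open>gam f\<close> vanishes
    in odd degrees; for these \<open>sgl n\<close> and \<open>sgl m\<close> agree.\<close>
  have sg: "(\<Sum>n=0..m. scl (gam f (m - n)) * (sgl n * F $ n)) = sgl m * (\<Sum>n=0..m. scl (gam f (m - n)) * F $ n)" for F
    unfolding sum_distrib_left
  proof (intro sum.cong refl)
    fix n assume "n \<in> {0..m}"
    then show "scl (gam f (m - n)) * (sgl n * F $ n) = sgl m * (scl (gam f (m - n)) * F $ n)"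
      by (cases "even m"; cases "even n") (auto simp: gam_def sgl_def)
  qed
  show "emb ?N (act T m 1 1) = (op.lift (gam f) * op.EV L) $ m"
    "emb ?N (act T m (-1) 1) = (op.lift (gam f) * op.OV L) $ m"
    "emb ?N (act T m (-1) (-1)) = sgl m * (op.lift (gam f) * op.EV L) $ m"
    "emb ?N (act T m 1 (-1)) = sgl m * (op.lift (gam f) * op.OV L) $ m"
    unfolding T(1)[OF id(1) id(1)] T(1)[OF id(2) id(1)] T(1)[OF id(2) id(2)] T(1)[OF id(1) id(2)] Tc conv sg
    by (rule refl)+
qed

section \<open>Realisation of simple modules\<close>

text \<open>Up to a factor 2, the relations \<open>AO\<close>, \<open>eP\<close> and
  \<open>QO\<close> solve for \<open>P\<close>, \<open>Q\<close> and \<open>B\<close> in turn.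
  Whatever is checked for \<open>w\<close> and \<open>A\<close> thus spreads to the whole
  action.\<close>

lemma (in yq) generated:
  assumes S: "vs.subspace S" "\<And>x y. x \<in> S \<Longrightarrow> y \<in> S \<Longrightarrow> x * y \<in> S"
    and w: "w \<in> S" and A: "\<And>n. A $ n \<in> S" and e: "e \<in> S"
  shows "B $ n \<in> S" "P $ n \<in> S" "Q $ n \<in> S"
proof -
  show P: "P $ n \<in> S" for n
  proof -
    have "P $ n + P $ n = w * A $ n - A $ n * w"
      using arg_cong[OF AO, of "\<lambda>f. - f $ n"] by simp
    then show ?thesis using S w A by (metis sc_double_in_subspace vs.subspace_diff)
  qed
  show Q: "Q $ n \<in> S" for n
  proof (cases n)
    case 0
    have "Q $ 0 + Q $ 0 = 0" using arg_cong[OF eP, of "\<lambda>f. - f $ 0"] by simp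
    then show ?thesis using 0 vs.subspace_0[OF S(1)] by (simp add: double_zero_iff)
  next
    case (Suc m)
    have "Q $ n + Q $ n = (A $ m * w + w * A $ m) - (e * P $ m - P $ m * e)"
      using arg_cong[OF eP, of "\<lambda>f. f $ n"] Suc by (simp add: algebra_simps)
    then show ?thesis
      using vs.subspace_diff[OF S(1)] vs.subspace_add[OF S(1)] S(2) w A e P
      by (metis sc_double_in_subspace[OF S(1)])
  qed
  have "B $ n + B $ n = - (Q $ n * w + w * Q $ n)"
    using arg_cong[OF QO, of "\<lambda>f. - f $ n"] by simp
  then show "B $ n \<in> S"
    using vs.subspace_neg[OF S(1)] vs.subspace_add[OF S(1)] S(2) w Q
    by (metis sc_double_in_subspace[OF S(1)])
qed

section \<open>Coefficient relations on a module\<close>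

context
  fixes M :: smod
  assumes M: "is_YQ1_module M" and d: "dim M > 0"
begin

abbreviation "E r \<equiv> emb (dim M) (Tc M r 1 1)"
abbreviation "Ob r \<equiv> emb (dim M) (Tc M r (-1) 1)"
abbreviation "w \<equiv> Ob 1"

definition sgi :: "int \<Rightarrow> lop" where "sgi r = (if even r then 1 else - 1)"

lemma act_homog: "m \<ge> 1 \<Longrightarrow> i \<in> idx \<Longrightarrow> j \<in> idx \<Longrightarrow> homog (dim M) (par M) (i \<noteq> j) (act M m i j)"
  using M unfolding is_YQ1_module_def by blast

lemma Tc_homog: "i \<in> idx \<Longrightarrow> j \<in> idx \<Longrightarrow> homog (dim M) (par M) (i \<noteq> j) (Tc M r i j)"
  unfolding Tc_def using act_homog[of "nat r" i j] homog_zero[OF d] homog_one[OF d] by auto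

lemma Tc_carrier [simp]: "i \<in> idx \<Longrightarrow> j \<in> idx \<Longrightarrow> Tc M r i j \<in> carrier_mat (dim M) (dim M)"
  using Tc_homog homog_carrier[OF d] by blast

lemma idx_mem [simp]: "(1::int) \<in> idx" "(-1::int) \<in> idx"
  by (auto simp: idx_def)

lemma act_neg: "m \<ge> 1 \<Longrightarrow> act M m (-1) (-1) = sgn1 m \<cdot>\<^sub>m act M m 1 1"
  "m \<ge> 1 \<Longrightarrow> act M m 1 (-1) = sgn1 m \<cdot>\<^sub>m act M m (-1) 1"
proof -
  have "\<forall>m\<ge>1. \<forall>i\<in>idx. \<forall>j\<in>idx. sgn1 m \<cdot>\<^sub>m act M m i j = act M m (- i) (- j)"
    using M unfolding is_YQ1_module_def by blast
  then have *: "m \<ge> 1 \<Longrightarrow> i \<in> idx \<Longrightarrow> j \<in> idx \<Longrightarrow> act M m (- i) (- j) = sgn1 m \<cdot>\<^sub>m act M m i j" for i j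
    by simp
  show "m \<ge> 1 \<Longrightarrow> act M m (-1) (-1) = sgn1 m \<cdot>\<^sub>m act M m 1 1"
    "m \<ge> 1 \<Longrightarrow> act M m 1 (-1) = sgn1 m \<cdot>\<^sub>m act M m (-1) 1"
    using *[of 1 1] *[of "-1" 1] by simp_all
qed

lemma T_neg:
  "emb (dim M) (Tc M r (-1) (-1)) = sgi r * E r" "emb (dim M) (Tc M r 1 (-1)) = sgi r * Ob r"
proof -
  have s: "scl (sgn1 (nat r)) = sgi r" if "r > 0"
    using that by (simp add: scl_sgn1 sgl_def sgi_def even_nat_iff)
  have c: "act M (nat r) i j \<in> carrier_mat (dim M) (dim M)" if "r > 0" "i \<in> idx" "j \<in> idx" for i j
    by (rule homog_carrier[OF d act_homog]) (use that in auto)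
  show "emb (dim M) (Tc M r (-1) (-1)) = sgi r * E r" "emb (dim M) (Tc M r 1 (-1)) = sgi r * Ob r"
    using act_neg[of "nat r"] s c
    by (auto simp: Tc_def emb_zero[OF d] emb_smult[OF d] sgi_def)
qed

lemma E_low: "r < 0 \<Longrightarrow> E r = 0" "E 0 = 1" "r \<le> 0 \<Longrightarrow> Ob r = 0"
  by (auto simp: Tc_def emb_zero[OF d] emb_one[OF d])

lemma emb_rel:
  assumes "i \<in> idx" "j \<in> idx" "k \<in> idx" "l \<in> idx"
  shows "emb (dim M) (rel_lhs M i j k l p q) = emb (dim M) (rel_rhs M i j k l p q)"
  using M assms unfolding is_YQ1_module_def by metis

lemma index_simps: "2 - (- a) = 2 + a" "- (- a) = a" "- (- a - 1) = 1 + a" for a :: int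
  by simp_all

lemma carrier_closed:
  "X \<in> carrier_mat (dim M) (dim M) \<Longrightarrow> Y \<in> carrier_mat (dim M) (dim M) \<Longrightarrow> X * Y \<in> carrier_mat (dim M) (dim M)"
  "X \<in> carrier_mat (dim M) (dim M) \<Longrightarrow> Y \<in> carrier_mat (dim M) (dim M) \<Longrightarrow> X - Y \<in> carrier_mat (dim M) (dim M)"
  "X \<in> carrier_mat (dim M) (dim M) \<Longrightarrow> Y \<in> carrier_mat (dim M) (dim M) \<Longrightarrow> X + Y \<in> carrier_mat (dim M) (dim M)"
  by auto

lemmas emb_hom = emb_add[OF d] emb_minus[OF d] emb_mult[OF d] emb_smult[OF d] carrier_closed

text \<open>The coefficient of u^{-a} v^{-b} in the relation for i = j = k = l = 1.
  \<open>R2\<close> takes k = -1, and \<open>R3\<close> takes i = k = -1; operators with second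
  index -1 are rewritten by \<open>T_neg\<close>.\<close>

lemma R1: "(E (2 + a) * E b - E b * E (2 + a)) - (E a * E (2 + b) - E (2 + b) * E a)
   = (E (1 + a) * E b - E b * E (1 + a)) + (E a * E (1 + b) - E (1 + b) * E a)
    - ((Ob (1 + a) * Ob b - sgi b * Ob b * (sgi (1 + a) * Ob (1 + a)))
       - (Ob a * Ob (1 + b) - sgi (1 + b) * Ob (1 + b) * (sgi a * Ob a)))"
  using emb_rel[of 1 1 1 1 "- a" "- b"]
  unfolding rel_lhs_def rel_rhs_def relC_def relD_def scomm_def index_simps
  by (simp add: emb_hom T_neg pp_def sgn1_def)

lemma R2: "(E (2 + a) * Ob b - Ob b * E (2 + a)) - (E a * Ob (2 + b) - Ob (2 + b) * E a)
   = (Ob (1 + a) * E b - Ob b * E (1 + a)) + (Ob a * E (1 + b) - Ob (1 + b) * E a)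
    + ((E (1 + a) * Ob b - sgi b * E b * (sgi (1 + a) * Ob (1 + a)))
       - (E a * Ob (1 + b) - sgi (1 + b) * E (1 + b) * (sgi a * Ob a)))"
  using emb_rel[of 1 1 "-1" 1 "- a" "- b"]
  unfolding rel_lhs_def rel_rhs_def relC_def relD_def scomm_def index_simps
  by (simp add: emb_hom T_neg pp_def sgn1_def op.sc_minus)

lemma R3: "- ((Ob (2 + a) * Ob b + Ob b * Ob (2 + a)) - (Ob a * Ob (2 + b) + Ob (2 + b) * Ob a))
   = (Ob (1 + a) * Ob b - Ob b * Ob (1 + a)) + (Ob a * Ob (1 + b) - Ob (1 + b) * Ob a)
    + ((E (1 + a) * E b - sgi b * E b * (sgi (1 + a) * E (1 + a)))
       - (E a * E (1 + b) - sgi (1 + b) * E (1 + b) * (sgi a * E a)))"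
  using emb_rel[of "-1" 1 "-1" 1 "- a" "- b"]
  unfolding rel_lhs_def rel_rhs_def relC_def relD_def scomm_def index_simps
  by (simp add: emb_hom T_neg pp_def sgn1_def op.sc_minus)

text \<open>At \<open>b = -1\<close> the coefficients of index \<open>b\<close> vanish, those of
  index \<open>1 + b\<close> are 0 or 1, and \<open>2 + b = 1\<close> produces
  \<open>w\<close>.\<close>

lemma rel_Ew: "E a * w - w * E a = - (Ob a + sgi a * Ob a)"
  using R2[of a "-1"] by (simp add: E_low sgi_def algebra_simps split: if_splits)

lemma rel_Ow: "Ob a * w + w * Ob a = sgi a * E a - E a"
  using R3[of a "-1"] by (simp add: E_low sgi_def algebra_simps split: if_splits)

lemma E1_central: "E 1 * E b = E b * E 1" "E 1 * Ob b = Ob b * E 1"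
  using R1[of "-1" b] R2[of "-1" b] by (simp_all add: E_low sgi_def algebra_simps)

lemma rel_eO: "E 2 * Ob b - Ob b * E 2 = w * E b + sgi b * E b * w - (Ob (1 + b) + Ob (1 + b))"
  using R2[of 0 b] E1_central(2)[of b] by (simp add: E_low sgi_def algebra_simps split: if_splits)

lemma rel_eE: "E 2 * E b - E b * E 2 = - (w * Ob b + sgi b * Ob b * w)"
  using R1[of 0 b] E1_central(1)[of b] by (simp add: E_low sgi_def algebra_simps split: if_splits)

text \<open>Products of odd operators cancel between \<open>R1\<close> for \<open>(a, b)\<close> and
  for \<open>(b, a)\<close>, on adding the two when \<open>a\<close> and \<open>b\<close> have equal
  parity and on subtracting them otherwise.\<close>

lemma even_E_commute:
  assumes "even a" "even b"
  shows "E a * E b = E b * E a"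
proof -
  \<comment> \<open>This is twice the commutator for equal parities and zero otherwise, which lets
    one recursion cover all cases.\<close>
  define S where "S a b = (E a * E b - E b * E a) - sgi a * sgi b * (E b * E a - E a * E b)" for a b
  have rec: "S (2 + a) b = S a (2 + b) + S (1 + a) b + S a (1 + b)" for a b
    using arg_cong2[where f = "(+)", OF R1[of a b] R1[of b a]]
      arg_cong2[where f = "(-)", OF R1[of a b] R1[of b a]] unfolding S_def
    by (cases "even a"; cases "even b") (simp_all add: sgi_def algebra_simps)
  have "S (int n - 1) b = 0 \<and> S (int n) b = 0" for n b
  proof (induction n arbitrary: b)
    case 0
    then show ?case by (simp add: S_def E_low)
  next
    case (Suc n)
    have "S (2 + (int n - 1)) b = 0" unfolding rec using Suc by simp
    then show ?case using Suc by (simp add: algebra_simps)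
  qed
  then have "S a b = 0"
    by (cases "a \<ge> 0") (metis int_nat_eq, simp add: S_def E_low)
  then have "(E a * E b - E b * E a) + (E a * E b - E b * E a) = 0"
    using assms unfolding S_def sgi_def by (simp add: algebra_simps)
  then show ?thesis by (simp only: op.double_zero_iff right_minus_eq)
qed

definition mA where "mA = Abs_fps (\<lambda>n. if even n then E (int n) else 0)"
definition mB where "mB = Abs_fps (\<lambda>n. if odd n then E (int n) else 0)"
definition mP where "mP = Abs_fps (\<lambda>n. if even n then Ob (int n) else 0)"
definition mQ where "mQ = Abs_fps (\<lambda>n. if odd n then Ob (int n) else 0)"

lemma module_yq: "yq scl mA mB mP mQ (E 2) w"
proof -
  show ?thesis
  proof unfold_locales
    show "mA $ 0 = 1" by (simp add: mA_def E_low)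
    show "mA * fps_const w - fps_const w * mA = - (mP + mP)"
      by (rule fps_ext) (auto simp: mA_def mP_def rel_Ew sgi_def)
    show "mQ * fps_const w + fps_const w * mQ = - (mB + mB)"
      by (rule fps_ext) (auto simp: mQ_def mB_def rel_Ow sgi_def)
    show "mP * fps_const w + fps_const w * mP = 0"
      by (rule fps_ext) (auto simp: mP_def rel_Ow sgi_def)
    show "fps_X * (fps_const (E 2) * mQ - mQ * fps_const (E 2)) = - (mP + mP)"
    proof (rule fps_ext)
      fix n
      show "(fps_X * (fps_const (E 2) * mQ - mQ * fps_const (E 2))) $ n = (- (mP + mP)) $ n"
      proof (cases n)
        case 0
        then show ?thesis by (simp add: mP_def E_low)
      next
        case (Suc m)
        show ?thesis using rel_eO[of "int m"] rel_Ew[of "int m"]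
          by (auto simp: Suc mQ_def mP_def sgi_def algebra_simps)
      qed
    qed
    show "fps_X * (fps_const (E 2) * mP - mP * fps_const (E 2)) = fps_X * (mA * fps_const w + fps_const w * mA) - (mQ + mQ)"
    proof (rule fps_ext)
      fix n
      show "(fps_X * (fps_const (E 2) * mP - mP * fps_const (E 2))) $ n = (fps_X * (mA * fps_const w + fps_const w * mA) - (mQ + mQ)) $ n"
      proof (cases n)
        case 0
        then show ?thesis by (simp add: mQ_def E_low)
      next
        case (Suc m)
        show ?thesis using rel_eO[of "int m"]
          by (auto simp: Suc mQ_def mP_def mA_def sgi_def algebra_simps)
      qed
    qed
    show "fps_const (E 2) * mA = mA * fps_const (E 2)"
      by (rule fps_ext) (auto simp: mA_def intro: even_E_commute)
    show "fps_const (E 2) * mB - mB * fps_const (E 2) = mQ * fps_const w - fps_const w * mQ"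
      by (rule fps_ext) (auto simp: mB_def mQ_def rel_eE sgi_def)
  qed
qed

lemma act_emb:
  assumes "m \<ge> 1"
  shows "emb (dim M) (act M m 1 1) = (mA + mB) $ m" "emb (dim M) (act M m (-1) 1) = (mP + mQ) $ m"
    "emb (dim M) (act M m (-1) (-1)) = sgl m * (mA + mB) $ m" "emb (dim M) (act M m 1 (-1)) = sgl m * (mP + mQ) $ m"
proof -
  have T: "act M m i j = Tc M (int m) i j" for i j using assms by (simp add: Tc_def)
  have "sgi (int m) = sgl m" by (simp add: sgi_def sgl_def)
  then show "emb (dim M) (act M m 1 1) = (mA + mB) $ m" "emb (dim M) (act M m (-1) 1) = (mP + mQ) $ m"
    "emb (dim M) (act M m (-1) (-1)) = sgl m * (mA + mB) $ m" "emb (dim M) (act M m 1 (-1)) = sgl m * (mP + mQ) $ m"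
    unfolding T T_neg by (simp_all add: mA_def mB_def mP_def mQ_def)
qed

lemma act_in_subalgebra:
  assumes S: "op.vs.subspace S" "\<And>x y. x \<in> S \<Longrightarrow> y \<in> S \<Longrightarrow> x * y \<in> S"
    and w: "w \<in> S" and A: "\<And>n. mA $ n \<in> S" and m: "m \<ge> 1" "i \<in> idx" "j \<in> idx"
  shows "emb (dim M) (act M m i j) \<in> S"
proof -
  interpret yq scl mA mB mP mQ "E 2" w by (rule module_yq)
  have "E 2 = mA $ 2" by (simp add: mA_def)
  then have e: "E 2 \<in> S" using A by metis
  note g = generated[OF S w A e, of m]
  have 1: "(mA + mB) $ m \<in> S" "(mP + mQ) $ m \<in> S"
    using g A by (auto intro!: op.vs.subspace_add[OF S(1)])
  have "sgl m * x \<in> S" if "x \<in> S" for x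
    using that op.vs.subspace_neg[OF S(1)] by (auto simp: sgl_def)
  then show ?thesis using m 1 act_emb[OF m(1)] unfolding idx_def by auto
qed

end

section \<open>Graded Schur lemma, common kernels, and the axioms of \<open>yq_simple\<close> for
  modules\<close>

lemma mult_mat_vec_nth:
  "A \<in> carrier_mat N N \<Longrightarrow> v \<in> carrier_vec N \<Longrightarrow> a < N \<Longrightarrow>
    vec_index (A *\<^sub>v v) a = (\<Sum>b<N. A $$ (a, b) * vec_index v b)"
  by (simp add: scalar_prod_def lessThan_atLeast0)

lemma even_proj_carrier: "even_proj N pr v \<in> carrier_vec N"
  by (simp add: even_proj_def)

lemma even_mult_even_proj:
  assumes "homog N pr False Z" "v \<in> carrier_vec N"
  shows "Z *\<^sub>v even_proj N pr v = even_proj N pr (Z *\<^sub>v v)"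
proof (rule eq_vecI)
  have Z: "Z \<in> carrier_mat N N" using assms unfolding homog_def by blast
  then show "dim_vec (Z *\<^sub>v even_proj N pr v) = dim_vec (even_proj N pr (Z *\<^sub>v v))" by (simp add: even_proj_def)
  fix a assume "a < dim_vec (even_proj N pr (Z *\<^sub>v v))"
  then have a: "a < N" by (simp add: even_proj_def)
  have "vec_index (Z *\<^sub>v even_proj N pr v) a = (\<Sum>b<N. Z $$ (a, b) * vec_index (even_proj N pr v) b)"
    by (rule mult_mat_vec_nth[OF Z even_proj_carrier a])
  also have "\<dots> = (\<Sum>b<N. if pr a then 0 else Z $$ (a, b) * vec_index v b)"
    using assms(1) a unfolding homog_def by (intro sum.cong refl) (auto simp: even_proj_def)
  also have "\<dots> = vec_index (even_proj N pr (Z *\<^sub>v v)) a"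
    using mult_mat_vec_nth[OF Z assms(2) a] a by (simp add: even_proj_def)
  finally show "vec_index (Z *\<^sub>v even_proj N pr v) a = vec_index (even_proj N pr (Z *\<^sub>v v)) a" .
qed

text \<open>An odd operator sends the even and odd parts of \<open>v\<close> into complementary
  parts, so both images vanish; thus its kernel is graded.\<close>

lemma odd_mult_even_proj:
  assumes "homog N pr True X" "v \<in> carrier_vec N" "X *\<^sub>v v = 0\<^sub>v N"
  shows "X *\<^sub>v even_proj N pr v = 0\<^sub>v N"
proof (rule eq_vecI)
  have X: "X \<in> carrier_mat N N" using assms unfolding homog_def by blast
  then show "dim_vec (X *\<^sub>v even_proj N pr v) = dim_vec (0\<^sub>v N :: complex vec)" by simp
  fix a assume "a < dim_vec (0\<^sub>v N :: complex vec)"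
  then have a: "a < N" by simp
  have "vec_index (X *\<^sub>v even_proj N pr v) a = (\<Sum>b<N. X $$ (a, b) * vec_index (even_proj N pr v) b)"
    by (rule mult_mat_vec_nth[OF X even_proj_carrier a])
  also have "\<dots> = (\<Sum>b<N. if pr a then X $$ (a, b) * vec_index v b else 0)"
    using assms(1) a unfolding homog_def by (intro sum.cong refl) (auto simp: even_proj_def)
  also have "\<dots> = (if pr a then vec_index (X *\<^sub>v v) a else 0)"
    using mult_mat_vec_nth[OF X assms(2) a] by simp
  also have "\<dots> = vec_index (0\<^sub>v N) a" using a by (simp add: assms(3))
  finally show "vec_index (X *\<^sub>v even_proj N pr v) a = vec_index (0\<^sub>v N) a" .
qed

lemma mat_eq_by_vec:
  fixes A B :: "complex mat"
  assumes "A \<in> carrier_mat n m" "B \<in> carrier_mat n m" "\<And>v. v \<in> carrier_vec m \<Longrightarrow> A *\<^sub>v v = B *\<^sub>v v"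
  shows "A = B"
proof (rule eq_matI)
  fix i j assume "i < dim_row B" "j < dim_col B"
  then have ij: "i < n" "j < m" using assms by auto
  have "vec_index (A *\<^sub>v unit_vec m j) i = vec_index (B *\<^sub>v unit_vec m j) i"
    using assms(3)[of "unit_vec m j"] by simp
  then show "A $$ (i, j) = B $$ (i, j)" using assms(1,2) ij by simp
qed (use assms in auto)

text \<open>Evenness of \<open>Z\<close> makes its eigenspaces graded, so that graded simplicity
  applies. A simple graded module may well admit nonscalar odd operators commuting with the
  action.\<close>

lemma graded_schur:
  assumes simple: "simple_graded N pr ops" and ops: "ops \<subseteq> carrier_mat N N" and Z: "homog N pr False Z"
    and comm: "\<And>G. G \<in> ops \<Longrightarrow> Z * G = G * Z"
  shows "\<exists>c. Z = c \<cdot>\<^sub>m 1\<^sub>m N"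
proof -
  have N: "N > 0" using simple unfolding simple_graded_def by blast
  have cZ: "Z \<in> carrier_mat N N" using Z unfolding homog_def by blast
  obtain k where "eigenvalue Z k" using spectrum_non_empty[OF cZ N] unfolding spectrum_def by auto
  then obtain v where v: "v \<in> carrier_vec N" "v \<noteq> 0\<^sub>v N" "Z *\<^sub>v v = k \<cdot>\<^sub>v v"
    unfolding eigenvalue_def eigenvector_def using cZ by auto
  define U where "U = {v \<in> carrier_vec N. Z *\<^sub>v v = k \<cdot>\<^sub>v v}"
  have "graded_inv_subspace N pr ops U"
    unfolding graded_inv_subspace_def
  proof (intro conjI ballI allI)
    show "U \<subseteq> carrier_vec N" unfolding U_def by blast
    have "Z *\<^sub>v 0\<^sub>v N = k \<cdot>\<^sub>v 0\<^sub>v N" using cZ by (intro eq_vecI) (auto simp: scalar_prod_def)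
    then show "0\<^sub>v N \<in> U" unfolding U_def by simp
    show "x + y \<in> U" if "x \<in> U" "y \<in> U" for x y
      using that cZ unfolding U_def by (simp add: mult_add_distrib_mat_vec[of _ N N] smult_add_distrib_vec[of _ N])
    show "c \<cdot>\<^sub>v x \<in> U" if "x \<in> U" for c x
      using that cZ unfolding U_def by (auto simp: mult_mat_vec[of _ N N] smult_smult_assoc mult.commute)
    show "even_proj N pr x \<in> U" if "x \<in> U" for x
    proof -
      have x: "x \<in> carrier_vec N" "Z *\<^sub>v x = k \<cdot>\<^sub>v x" using that unfolding U_def by auto
      have "Z *\<^sub>v even_proj N pr x = even_proj N pr (k \<cdot>\<^sub>v x)"
        using even_mult_even_proj[OF Z x(1)] x(2) by simp
      also have "\<dots> = k \<cdot>\<^sub>v even_proj N pr x" using x(1) by (intro eq_vecI) (auto simp: even_proj_def)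
      finally show ?thesis unfolding U_def by (simp add: even_proj_carrier)
    qed
    show "G *\<^sub>v x \<in> U" if G: "G \<in> ops" and x: "x \<in> U" for G x
    proof -
      have cG: "G \<in> carrier_mat N N" using G ops by blast
      have x: "x \<in> carrier_vec N" "Z *\<^sub>v x = k \<cdot>\<^sub>v x" using x unfolding U_def by auto
      have "Z *\<^sub>v (G *\<^sub>v x) = G *\<^sub>v (Z *\<^sub>v x)"
        using comm[OF G] cZ cG x(1) by (metis assoc_mult_mat_vec)
      then show ?thesis unfolding U_def using x cG by (simp add: mult_mat_vec[of _ N N])
    qed
  qed
  then have "U = {0\<^sub>v N} \<or> U = carrier_vec N" using simple unfolding simple_graded_def by blast
  moreover have "v \<in> U" using v unfolding U_def by simp
  ultimately have U: "U = carrier_vec N" using v(2) by blast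
  have "Z = k \<cdot>\<^sub>m 1\<^sub>m N"
  proof (rule mat_eq_by_vec[OF cZ])
    fix x :: "complex vec" assume x: "x \<in> carrier_vec N"
    then have "Z *\<^sub>v x = k \<cdot>\<^sub>v x" using U unfolding U_def by blast
    also have "\<dots> = (k \<cdot>\<^sub>m 1\<^sub>m N) *\<^sub>v x" using x by (intro eq_vecI) (auto simp: smult_scalar_prod_distrib[of _ N])
    finally show "Z *\<^sub>v x = (k \<cdot>\<^sub>m 1\<^sub>m N) *\<^sub>v x" .
  qed simp
  then show ?thesis by blast
qed

text \<open>Operators are added one by one. If the new \<open>r\<close> does not kill the current
  vector \<open>v\<close>, then \<open>r v\<close> takes its place: \<open>r\<close> squares to
  zero, and the earlier operators anticommute with \<open>r\<close>.\<close>

lemma common_kernel: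
  assumes N: "N > 0" and fin: "finite F" and F: "F \<subseteq> Odop N pr" and anti: "\<And>x y. x \<in> F \<Longrightarrow> y \<in> F \<Longrightarrow> acomm x y = 0"
  shows "\<exists>v\<in>carrier_vec N. v \<noteq> 0\<^sub>v N \<and> (\<forall>r\<in>F. lapp r (ext v) = (\<lambda>k. 0))"
  using fin F anti
proof (induction F)
  case empty
  then show ?case using N by (intro bexI[of _ "unit_vec N 0"]) auto
next
  case (insert r F)
  obtain v where v: "v \<in> carrier_vec N" "v \<noteq> 0\<^sub>v N" "\<forall>r\<in>F. lapp r (ext v) = (\<lambda>k. 0)"
    using insert by auto
  obtain X where X: "r = emb N X" "X \<in> carrier_mat N N"
    using insert.prems(1) homog_carrier[OF N] unfolding Odop_def[OF N] by auto
  show ?case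
  proof (cases "lapp r (ext v) = (\<lambda>k. 0)")
    case True
    then show ?thesis using v by blast
  next
    case False
    have e: "lapp r (ext v) = ext (X *\<^sub>v v)" unfolding X(1) by (rule lapp_emb_ext[OF N X(2) v(1)])
    have c: "X *\<^sub>v v \<in> carrier_vec N" using X v by simp
    have "X *\<^sub>v v \<noteq> 0\<^sub>v N" using False ext_zero[OF N] unfolding e by auto
    moreover have "lapp t (ext (X *\<^sub>v v)) = (\<lambda>k. 0)" if t: "t \<in> insert r F" for t
    proof -
      have tr0: "acomm t r = 0" using insert.prems(2) t by blast
      then have tr: "t * r = - (r * t)" by (simp add: acomm_def eq_neg_iff_add_eq_0)
      have eq: "lapp t (ext (X *\<^sub>v v)) = lapp (t * r) (ext v)" unfolding e[symmetric] by (simp add: lapp_simps)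
      show ?thesis
      proof (cases "t = r")
        case True
        then have "r * r + r * r = 0" using tr0 by (simp add: acomm_def)
        then have "r * r = 0" by (simp add: op.double_zero_iff)
        then show ?thesis unfolding eq by (simp only: True lapp_simps(1))
      next
        case False
        then have "lapp t (ext v) = (\<lambda>k. 0)" using t v(3) by blast
        then show ?thesis unfolding eq tr by (simp add: lapp_simps lapp_zero)
      qed
    qed
    ultimately show ?thesis using c by blast
  qed
qed

context
  fixes M :: smod
  assumes M: "is_YQ1_module M" and S: "simple_YQ1 M"
begin

lemma dim_pos: "dim M > 0"
  using S unfolding simple_YQ1_def simple_graded_def by blast

lemma module_yq_simple:
  "yq_simple scl (mA M) (mB M) (mP M) (mQ M) (emb (dim M) (Tc M 2 1 1)) (emb (dim M) (Tc M 1 (-1) 1))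
     (Evop (dim M) (par M)) (Odop (dim M) (par M))"
proof -
  note d = dim_pos
  let ?N = "dim M" and ?pr = "par M"
  let ?ops = "{act M m i j | m i j. m \<ge> 1 \<and> i \<in> idx \<and> j \<in> idx}"
  let ?w = "emb (dim M) (Tc M 1 (-1) 1)" and ?A = "mA M"
  interpret yq scl "mA M" "mB M" "mP M" "mQ M" "emb (dim M) (Tc M 2 1 1)" "emb (dim M) (Tc M 1 (-1) 1)"
    by (rule module_yq[OF M d])
  interpret graded_algebra scl "Evop (dim M) (par M)" "Odop (dim M) (par M)"
    by (rule graded_algebra_op[OF d])
  have simple: "simple_graded ?N ?pr ?ops" using S unfolding simple_YQ1_def .
  have opsc: "?ops \<subseteq> carrier_mat ?N ?N" using homog_carrier[OF d act_homog[OF M d]] by blast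
  have AN: "?A $ n = (if even n then emb ?N (Tc M (int n) 1 1) else 0)" for n by (simp add: mA_def[OF M d])
  obtain S1 where S1: "finite S1" "emb ?N ` carrier_mat ?N ?N \<subseteq> op.vs.span S1" using emb_finite_span[OF d] by blast
  have "Odop ?N ?pr \<subseteq> emb ?N ` carrier_mat ?N ?N"
    unfolding Odop_def[OF d] by (intro image_mono subsetI) (simp add: homog_carrier[OF d])
  then obtain S0 where S0: "finite S0" "Odop ?N ?pr \<subseteq> op.vs.span S0" using S1 by blast
  show ?thesis
  proof unfold_locales
    show "emb ?N (Tc M 2 1 1) = ?A $ 2" by (simp add: AN)
    show "?A $ i * ?A $ j = ?A $ j * ?A $ i" for i j
      using even_E_commute[OF M d, of "int i" "int j"] by (simp add: AN)
    show "?A $ n \<in> Evop ?N ?pr" for n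
      using Tc_homog[OF M d, of 1 1 "int n"] op.vs.subspace_0[OF Ev_sub] unfolding AN Evop_def[OF d]
      by (auto simp: idx_def)
    show "?w \<in> Odop ?N ?pr"
      using Tc_homog[OF M d, of "-1" 1 1] unfolding Odop_def[OF d] by (auto simp: idx_def)
    show "y \<in> range scl" if y: "y \<in> Evop ?N ?pr" "y * ?w = ?w * y" "\<And>n. y * ?A $ n = ?A $ n * y" for y
    proof -
      obtain Z where Z: "y = emb ?N Z" "homog ?N ?pr False Z" using y(1) unfolding Evop_def[OF d] by auto
      have cZ: "Z \<in> carrier_mat ?N ?N" by (rule homog_carrier[OF d Z(2)])
      have "\<exists>c. Z = c \<cdot>\<^sub>m 1\<^sub>m ?N"
      proof (rule graded_schur[OF simple opsc Z(2)])
        fix G assume G: "G \<in> ?ops"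
        then have cG: "G \<in> carrier_mat ?N ?N" using opsc by blast
        obtain m i j where mij: "G = act M m i j" "m \<ge> 1" "i \<in> idx" "j \<in> idx" using G by blast
        have "emb ?N (act M m i j) \<in> {x. y * x = x * y}"
        proof (rule act_in_subalgebra[OF M d op.commutant_subspace _ _ _ mij(2-4)])
          show "x * x' \<in> {x. y * x = x * y}" if "x \<in> {x. y * x = x * y}" "x' \<in> {x. y * x = x * y}" for x x'
            using that by simp (metis mult.assoc)
        qed (use y in simp_all)
        then have "emb ?N Z * emb ?N G = emb ?N G * emb ?N Z" unfolding Z(1) mij(1) by simp
        then have "emb ?N (Z * G) = emb ?N (G * Z)" by (simp only: emb_mult[OF d cZ cG] emb_mult[OF d cG cZ])
        then show "Z * G = G * Z" using emb_inj[OF d, of "Z * G" "G * Z"] cZ cG by simp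
      qed
      then obtain c where "Z = c \<cdot>\<^sub>m 1\<^sub>m ?N" by blast
      then have "y = scl c" unfolding Z(1) by (simp add: emb_smult[OF d] emb_one[OF d])
      then show ?thesis by blast
    qed
    show "\<exists>S. finite S \<and> Odop ?N ?pr \<subseteq> op.vs.span S"
      using S0 by blast
    show "c = 0" if ab: "a \<in> Evop ?N ?pr" "b \<in> Evop ?N ?pr" "a * b - b * a = scl c" for a b c
    proof -
      obtain X Y where XY: "a = emb ?N X" "homog ?N ?pr False X" "b = emb ?N Y" "homog ?N ?pr False Y"
        using ab(1,2) unfolding Evop_def[OF d] by blast
      show ?thesis
        by (rule commutator_not_scalar[OF homog_carrier[OF d XY(2)] homog_carrier[OF d XY(4)] d])
          (use ab(3) XY(1,3) in simp)
    qed
    show "R \<subseteq> {0}" if R: "op.vs.subspace R" "R \<subseteq> Odop ?N ?pr" "\<And>x y. x \<in> R \<Longrightarrow> y \<in> R \<Longrightarrow> acomm x y = 0"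
        "\<And>x. x \<in> R \<Longrightarrow> acomm x ?w = 0"
        "\<And>x n. x \<in> R \<Longrightarrow> \<exists>g. (\<forall>i. g i \<in> R) \<and> x * ?A $ n = (\<Sum>i=0..n. ?A $ i * g (n - i))" for R
    proof -
      obtain F where F: "F \<subseteq> R" "op.vs.independent F" "R \<subseteq> op.vs.span F" "card F = op.vs.dim R"
        by (rule op.vs.basis_exists)
      have "F \<subseteq> op.vs.span S0" using F(1) R(2) S0(2) by (intro subset_trans[OF F(1)] subset_trans[OF R(2)])
      from op.vs.independent_span_bound[OF S0(1) F(2) this] have finF: "finite F" by (rule conjunct1)
      have "\<exists>v\<in>carrier_vec ?N. v \<noteq> 0\<^sub>v ?N \<and> (\<forall>r\<in>F. lapp r (ext v) = (\<lambda>k. 0))"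
        by (rule common_kernel[OF d finF subset_trans[OF F(1) R(2)]]) (rule R(3); rule subsetD[OF F(1)])
      then obtain v where v: "v \<in> carrier_vec ?N" "v \<noteq> 0\<^sub>v ?N" "\<forall>r\<in>F. lapp r (ext v) = (\<lambda>k. 0)" by blast
      have vR: "lapp r (ext v) = (\<lambda>k. 0)" if "r \<in> R" for r
      proof -
        have "r \<in> op.vs.span F" using that F(3) by blast
        then show ?thesis
        proof (rule op.vs.span_induct)
          show "op.vs.subspace {r. lapp r (ext v) = (\<lambda>k. 0)}"
            by (auto simp: op.vs.subspace_def lapp_simps lapp_scl fun_eq_iff)
        qed (use v in blast)
      qed
      \<comment> \<open>The operators preserving the common kernel of \<open>R\<close>. This
        subalgebra contains \<open>w\<close>, which anticommutes with \<open>R\<close>, and each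
        coefficient of \<open>A\<close>, past which \<open>R\<close> moves at the cost of other
        elements of \<open>R\<close>; hence it contains the action.\<close>
      define Sg where "Sg = {g. \<forall>x. (\<forall>r\<in>R. lapp r x = (\<lambda>k. 0)) \<longrightarrow> (\<forall>r\<in>R. lapp r (lapp g x) = (\<lambda>k. 0))}"
      have Ssub: "op.vs.subspace Sg"
      proof (rule op.vs.subspaceI)
        show "0 \<in> Sg" unfolding Sg_def by (simp add: lapp_simps lapp_zero)
        show "x + y \<in> Sg" if "x \<in> Sg" "y \<in> Sg" for x y
          using that unfolding Sg_def by (simp add: lapp_simps lapp_add)
        show "scl c * x \<in> Sg" if "x \<in> Sg" for c x
          using that unfolding Sg_def by (simp add: lapp_simps lapp_scl lapp_scale)
      qed
      have Smul: "x * y \<in> Sg" if "x \<in> Sg" "y \<in> Sg" for x y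
        using that unfolding Sg_def by (simp add: lapp_simps)
      have Sw: "?w \<in> Sg" unfolding Sg_def
      proof (intro CollectI allI impI ballI)
        fix x r assume x: "\<forall>r\<in>R. lapp r x = (\<lambda>k. 0)" and r: "r \<in> R"
        have "r * ?w = - (?w * r)" using R(4)[OF r] by (simp add: acomm_def eq_neg_iff_add_eq_0)
        then have "lapp (r * ?w) x = lapp (- (?w * r)) x" by simp
        then show "lapp r (lapp ?w x) = (\<lambda>k. 0)" using x r by (simp add: lapp_simps lapp_zero)
      qed
      have SA: "?A $ n \<in> Sg" for n unfolding Sg_def
      proof (intro CollectI allI impI ballI)
        fix x r assume x: "\<forall>r\<in>R. lapp r x = (\<lambda>k. 0)" and r: "r \<in> R"
        obtain g where g: "\<forall>i. g i \<in> R" "r * ?A $ n = (\<Sum>i=0..n. ?A $ i * g (n - i))" using R(5)[OF r] by blast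
        have "lapp (r * ?A $ n) x = (\<lambda>k. \<Sum>i=0..n. lapp (?A $ i * g (n - i)) x k)"
          unfolding g(2) by (rule ext) (rule lapp_sum)
        also have "\<dots> = (\<lambda>k. 0)" using x g(1) by (simp add: lapp_simps lapp_zero)
        finally show "lapp r (lapp (?A $ n) x) = (\<lambda>k. 0)" by (simp add: lapp_simps)
      qed
      have Sact: "emb ?N (act M m i j) \<in> Sg" if "m \<ge> 1" "i \<in> idx" "j \<in> idx" for m i j
        by (rule act_in_subalgebra[OF M d Ssub Smul Sw SA that])
      \<comment> \<open>The common kernel is a graded submodule, nonzero because it contains
        \<open>v\<close>; simplicity makes it the whole space, so \<open>R\<close> acts by
        zero.\<close>
      define K where "K = {u \<in> carrier_vec ?N. \<forall>r\<in>R. lapp r (ext u) = (\<lambda>k. 0)}"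
      have ex0: "ext u = (\<lambda>k. 0) \<longleftrightarrow> u = 0\<^sub>v ?N" if "u \<in> carrier_vec ?N" for u
        using ext_inj[OF d that, of "0\<^sub>v ?N"] by (simp add: ext_zero[OF d])
      have rX: "\<exists>X. r = emb ?N X \<and> homog ?N ?pr True X" if "r \<in> R" for r
        using that R(2) unfolding Odop_def[OF d] by blast
      have "graded_inv_subspace ?N ?pr ?ops K"
        unfolding graded_inv_subspace_def
      proof (intro conjI ballI allI)
        show "K \<subseteq> carrier_vec ?N" unfolding K_def by blast
        show "0\<^sub>v ?N \<in> K" unfolding K_def by (simp add: ext_zero[OF d] lapp_zero)
        show "x + y \<in> K" if "x \<in> K" "y \<in> K" for x y
        proof -
          have "ext (x + y) = (\<lambda>k. ext x k + ext y k)" using that unfolding K_def by (auto simp: ext_def[OF d])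
          then show ?thesis using that unfolding K_def by (simp add: lapp_add)
        qed
        show "c \<cdot>\<^sub>v x \<in> K" if "x \<in> K" for c x
        proof -
          have "ext (c \<cdot>\<^sub>v x) = (\<lambda>k. c * ext x k)" using that unfolding K_def by (auto simp: ext_def[OF d])
          then show ?thesis using that unfolding K_def by (simp add: lapp_scale)
        qed
        show "even_proj ?N ?pr x \<in> K" if x: "x \<in> K" for x
        proof -
          have "lapp r (ext (even_proj ?N ?pr x)) = (\<lambda>k. 0)" if r: "r \<in> R" for r
          proof -
            obtain X where X: "r = emb ?N X" "homog ?N ?pr True X" using rX[OF r] by blast
            have cX: "X \<in> carrier_mat ?N ?N" by (rule homog_carrier[OF d X(2)])
            have cx: "x \<in> carrier_vec ?N" using x unfolding K_def by blast
            have "ext (X *\<^sub>v x) = (\<lambda>k. 0)" using x r lapp_emb_ext[OF d cX cx] unfolding K_def X(1) by auto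
            then have "X *\<^sub>v x = 0\<^sub>v ?N" using ex0 cX cx by simp
            then have "X *\<^sub>v even_proj ?N ?pr x = 0\<^sub>v ?N" by (rule odd_mult_even_proj[OF X(2) cx])
            then show ?thesis unfolding X(1) lapp_emb_ext[OF d cX even_proj_carrier] by (simp add: ext_zero[OF d])
          qed
          then show ?thesis unfolding K_def by (simp add: even_proj_carrier)
        qed
        show "G *\<^sub>v x \<in> K" if G: "G \<in> ?ops" and x: "x \<in> K" for G x
        proof -
          have cG: "G \<in> carrier_mat ?N ?N" using G opsc by blast
          have cx: "x \<in> carrier_vec ?N" using x unfolding K_def by blast
          have "emb ?N G \<in> Sg" using G Sact by blast
          then have "\<forall>r\<in>R. lapp r (lapp (emb ?N G) (ext x)) = (\<lambda>k. 0)" using x unfolding Sg_def K_def by blast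
          then show ?thesis unfolding lapp_emb_ext[OF d cG cx] K_def using cG cx by simp
        qed
      qed
      then have "K = {0\<^sub>v ?N} \<or> K = carrier_vec ?N" using simple unfolding simple_graded_def by blast
      moreover have "v \<in> K" using v(1) vR unfolding K_def by blast
      ultimately have K: "K = carrier_vec ?N" using v(2) by blast
      show "R \<subseteq> {0}"
      proof
        fix r assume r: "r \<in> R"
        obtain X where X: "r = emb ?N X" "homog ?N ?pr True X" using rX[OF r] by blast
        have cX: "X \<in> carrier_mat ?N ?N" by (rule homog_carrier[OF d X(2)])
        have "X = 0\<^sub>m ?N ?N"
        proof (rule mat_eq_by_vec[OF cX])
          fix x :: "complex vec" assume x: "x \<in> carrier_vec ?N"
          then have "lapp r (ext x) = (\<lambda>k. 0)" using K r unfolding K_def by blast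
          then have "X *\<^sub>v x = 0\<^sub>v ?N" using ex0[of "X *\<^sub>v x"] cX x unfolding X(1) lapp_emb_ext[OF d cX x] by simp
          moreover have "0\<^sub>m ?N ?N *\<^sub>v x = 0\<^sub>v ?N" using x by (intro eq_vecI) (auto simp: scalar_prod_def)
          ultimately show "X *\<^sub>v x = 0\<^sub>m ?N ?N *\<^sub>v x" by simp
        qed simp
        then show "r \<in> {0}" unfolding X(1) by (simp add: emb_zero[OF d])
      qed
    qed
  qed
qed

end

text \<open>A form without reference to the order of the list, suited to reversal and to matrices
  indexed by position.\<close>

lemma (in calg) clif_nth:
  "clif L \<longleftrightarrow> (\<forall>i<length L. snd (L ! i) * snd (L ! i) = sc (fst (L ! i))) \<and>
    (\<forall>i<length L. \<forall>j<length L. i \<noteq> j \<longrightarrow> acomm (snd (L ! i)) (snd (L ! j)) = 0)"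
proof (induction L)
  case (Cons a L)
  obtain x \<xi> where a: "a = (x, \<xi>)" by force
  have s: "(\<forall>\<eta>\<in>snd ` set L. \<xi> * \<eta> = - (\<eta> * \<xi>)) \<longleftrightarrow> (\<forall>j<length L. acomm \<xi> (snd (L ! j)) = 0)"
    by (simp add: all_set_conv_all_nth acomm_def eq_neg_iff_add_eq_0)
  have n: "acomm (snd (L ! i)) \<xi> = acomm \<xi> (snd (L ! i))" for i by (rule acomm_sym)
  show ?case unfolding a clif.simps s Cons.IH length_Cons All_less_Suc2
    by (simp only: nth_Cons_0 nth_Cons_Suc fst_conv snd_conv nat.inject nat.distinct n simp_thms) blast
qed simp

lemma hL_eqI:
  assumes "length L = length s" "\<And>i. i < length s \<Longrightarrow> rev L ! i = (s ! i, emb (hdim H) (xi H i))"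
  shows "hL s H = L"
proof -
  have "map (\<lambda>i. (s ! i, emb (hdim H) (xi H i))) [0..<length s] = rev L"
    by (rule nth_equalityI) (use assms in auto)
  then show ?thesis unfolding hL_def by simp
qed

lemma iso_YQ1_refl:
  assumes "dim M = dim M'" "par M = par M'"
    and "\<And>m i j. m \<ge> 1 \<Longrightarrow> i \<in> idx \<Longrightarrow> j \<in> idx \<Longrightarrow> act M m i j = act M' m i j"
    and "\<And>m i j. m \<ge> 1 \<Longrightarrow> i \<in> idx \<Longrightarrow> j \<in> idx \<Longrightarrow> act M m i j \<in> carrier_mat (dim M) (dim M)"
  shows "iso_YQ1 M M'"
  unfolding iso_YQ1_def
proof (intro exI[of _ "1\<^sub>m (dim M)"] conjI allI impI ballI)
  show "1\<^sub>m (dim M) \<in> carrier_mat (dim M') (dim M)" using assms(1) by simp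
  show "invertible_mat (1\<^sub>m (dim M) :: complex mat)"
    unfolding invertible_mat_def inverts_mat_def square_mat.simps by (intro conjI exI[of _ "1\<^sub>m (dim M)"]) simp_all
  show "par M' a \<longleftrightarrow> par M b" if "a < dim M'" "b < dim M" "(1\<^sub>m (dim M) :: complex mat) $$ (a, b) \<noteq> 0" for a b
    using that assms(1,2) by (auto split: if_splits)
  show "1\<^sub>m (dim M) * act M m i j = act M' m i j * 1\<^sub>m (dim M)" if "m \<ge> 1" "i \<in> idx" "j \<in> idx" for m i j
    using assms(3)[OF that] assms(4)[OF that] by (metis left_mult_one_mat right_mult_one_mat)
qed

text \<open>Odd operators found abstractly inside the embedded matrices are turned back into a tuple
  of matrices. Simplicity is left to each application, where invariant subspaces are
  compared.\<close>

lemma hmod_of_clif: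
  assumes d: "N > 0" and clif: "op.clif L" and LOd: "snd ` set L \<subseteq> Odop N pr" and s: "s = map fst (rev L)"
  shows "\<exists>H. hdim H = N \<and> hpar H = pr \<and> hL s H = L \<and>
     (\<forall>i<length s. homog (hdim H) (hpar H) True (xi H i)) \<and>
     (\<forall>i<length s. \<forall>j<length s. i \<noteq> j \<longrightarrow> xi H i * xi H j + xi H j * xi H i = 0\<^sub>m (hdim H) (hdim H)) \<and>
     (\<forall>i<length s. xi H i * xi H i = (s ! i) \<cdot>\<^sub>m 1\<^sub>m (hdim H))"
proof -
  define n where "n = length L"
  have ln: "length s = n" "length (rev L) = n" by (simp_all add: s n_def)
  have mem: "rev L ! i \<in> set L" if "i < n" for i using that ln(2) nth_mem[of i "rev L"] by simp
  have "\<exists>X. homog N pr True X \<and> snd (rev L ! i) = emb N X" if "i < n" for i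
  proof -
    have "snd (rev L ! i) \<in> Odop N pr" using mem[OF that] LOd by blast
    then show ?thesis unfolding Odop_def[OF d] by blast
  qed
  then obtain X where X: "\<And>i. i < n \<Longrightarrow> homog N pr True (X i)" "\<And>i. i < n \<Longrightarrow> snd (rev L ! i) = emb N (X i)"
    by metis
  define H where "H = \<lparr>hdim = N, hpar = pr, xi = X\<rparr>"
  have H: "hdim H = N" "hpar H = pr" "xi H = X" by (simp_all add: H_def)
  have hL: "hL s H = L"
  proof (rule hL_eqI)
    show "rev L ! i = (s ! i, emb (hdim H) (xi H i))" if "i < length s" for i
      using X(2)[of i] that ln unfolding H s by (simp add: prod_eq_iff)
  qed (simp add: s)
  have cX: "X i \<in> carrier_mat N N" if "i < n" for i by (rule homog_carrier[OF d X(1)[OF that]])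
  have nth: "snd (L ! (n - Suc i)) = emb N (X i)" "fst (L ! (n - Suc i)) = s ! i" if "i < n" for i
    using X(2)[OF that] that by (simp_all add: rev_nth n_def s)
  have cl: "\<forall>i<n. snd (L ! i) * snd (L ! i) = scl (fst (L ! i))"
    "\<forall>i<n. \<forall>j<n. i \<noteq> j \<longrightarrow> acomm (snd (L ! i)) (snd (L ! j)) = 0"
    using clif unfolding op.clif_nth n_def by blast+
  have prod: "A * B \<in> carrier_mat N N" if "A \<in> carrier_mat N N" "B \<in> carrier_mat N N" for A B :: "complex mat"
    using that by simp
  have anti: "xi H i * xi H j + xi H j * xi H i = 0\<^sub>m (hdim H) (hdim H)"
    if ij: "i < length s" "j < length s" "i \<noteq> j" for i j
  proof -
    have *: "i < n" "j < n" "n - Suc i \<noteq> n - Suc j" "n - Suc i < n" "n - Suc j < n" using ij ln by auto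
    have c: "X i \<in> carrier_mat N N" "X j \<in> carrier_mat N N" using cX * by blast+
    have "acomm (emb N (X i)) (emb N (X j)) = 0"
      using cl(2)[rule_format, OF *(4) *(5) *(3)] unfolding nth(1)[OF *(1)] nth(1)[OF *(2)] .
    then have "emb N (X i * X j + X j * X i) = emb N (0\<^sub>m N N)"
      by (simp add: emb_add[OF d prod[OF c] prod[OF c(2) c(1)]] emb_mult[OF d c] emb_mult[OF d c(2) c(1)] emb_zero[OF d] acomm_def)
    then show ?thesis unfolding H using c by (subst (asm) emb_inj[OF d]) (auto intro!: prod add_carrier_mat)
  qed
  have sq: "xi H i * xi H i = (s ! i) \<cdot>\<^sub>m 1\<^sub>m (hdim H)" if i: "i < length s" for i
  proof -
    have *: "i < n" "n - Suc i < n" using i ln by auto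
    have c: "X i \<in> carrier_mat N N" using cX * by blast
    have "emb N (X i) * emb N (X i) = scl (s ! i)"
      using cl(1)[rule_format, OF *(2)] unfolding nth[OF *(1)] .
    then have "emb N (X i * X i) = emb N ((s ! i) \<cdot>\<^sub>m 1\<^sub>m N)"
      by (simp add: emb_mult[OF d c c] emb_smult[OF d] emb_one[OF d])
    then show ?thesis unfolding H using c by (subst (asm) emb_inj[OF d]) (auto intro!: prod)
  qed
  show ?thesis
    by (intro exI[of _ H] conjI allI impI) (use H hL X(1) ln anti sq in auto)
qed

lemma stabiliser_subspace:
  assumes d: "N > 0" and Uc: "U \<subseteq> carrier_vec N" and U0: "0\<^sub>v N \<in> U"
    and Ua: "\<And>x y. x \<in> U \<Longrightarrow> y \<in> U \<Longrightarrow> x + y \<in> U" and Us: "\<And>c x. x \<in> U \<Longrightarrow> c \<cdot>\<^sub>v x \<in> U"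
  shows "op.vs.subspace {t. \<forall>v\<in>U. \<exists>u\<in>U. lapp t (ext v) = ext u}" (is "op.vs.subspace ?Sg")
proof (rule op.vs.subspaceI)
  show "0 \<in> ?Sg" using U0 by (auto simp: lapp_simps ext_zero[OF d] intro!: bexI[of _ "0\<^sub>v N"])
  show "x + y \<in> ?Sg" if xy: "x \<in> ?Sg" "y \<in> ?Sg" for x y
  proof (intro CollectI ballI)
    fix v assume v: "v \<in> U"
    obtain a b where ab: "a \<in> U" "lapp x (ext v) = ext a" "b \<in> U" "lapp y (ext v) = ext b"
      using xy v by blast
    have "a \<in> carrier_vec N" "b \<in> carrier_vec N" using ab Uc by blast+
    then have "ext (a + b) = (\<lambda>k. ext a k + ext b k)" by (auto simp: ext_def[OF d])
    then have "lapp (x + y) (ext v) = ext (a + b)" using ab(2,4) by (simp add: lapp_simps)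
    then show "\<exists>u\<in>U. lapp (x + y) (ext v) = ext u" using Ua[OF ab(1,3)] by blast
  qed
  show "scl c * x \<in> ?Sg" if x: "x \<in> ?Sg" for c x
  proof (intro CollectI ballI)
    fix v assume v: "v \<in> U"
    obtain a where a: "a \<in> U" "lapp x (ext v) = ext a" using x v by blast
    have "a \<in> carrier_vec N" using a Uc by blast
    then have "ext (c \<cdot>\<^sub>v a) = (\<lambda>k. c * ext a k)" by (auto simp: ext_def[OF d])
    then have "lapp (scl c * x) (ext v) = ext (c \<cdot>\<^sub>v a)" using a(2) by (simp add: lapp_simps lapp_scl)
    then show "\<exists>u\<in>U. lapp (scl c * x) (ext v) = ext u" using Us[OF a(1)] by blast
  qed
qed

lemma simple_module_realisation:
  assumes M: "is_YQ1_module M" and S: "simple_YQ1 M"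
  shows "\<exists>s H f. regular s \<and> typical s \<and> simple_h_module s H \<and> iso_YQ1 M (tensor (V_mod s H) (Gamma_mod f))"
proof -
  note d = dim_pos[OF M S]
  let ?N = "dim M"
  interpret yq_simple scl "mA M" "mB M" "mP M" "mQ M" "emb (dim M) (Tc M 2 1 1)" "emb (dim M) (Tc M 1 (-1) 1)"
     "Evop (dim M) (par M)" "Odop (dim M) (par M)"
    by (rule module_yq_simple[OF M S])
  obtain L f where L: "op.clif L" "snd ` set L \<subseteq> Odop ?N (par M)"
    "\<forall>s\<in>fst ` set L. \<forall>s'\<in>fst ` set L. s + s' \<noteq> 0" "f 0 = 1"
    "mA M = op.lift f * op.vA L" "mB M = op.lift f * op.vB L" "mP M = op.lift f * op.vP L" "mQ M = op.lift f * op.vQ L"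
    by (rule clifford_realisation, rule that) (assumption | blast)+
  define s where "s = map fst (rev L)"
  obtain H where H: "hdim H = ?N" "hpar H = par M" and hL: "hL s H = L"
    and xiH: "\<forall>i<length s. homog (hdim H) (hpar H) True (xi H i)"
    and anti: "\<forall>i<length s. \<forall>j<length s. i \<noteq> j \<longrightarrow> xi H i * xi H j + xi H j * xi H i = 0\<^sub>m (hdim H) (hdim H)"
    and sq: "\<forall>i<length s. xi H i * xi H i = (s ! i) \<cdot>\<^sub>m 1\<^sub>m (hdim H)"
    using hmod_of_clif[OF d L(1,2) s_def] by (elim exE conjE) (rule that; assumption)
  have fst_mem: "s ! i \<in> fst ` set L" if "i < length s" for i using that nth_mem[of i "rev L"] unfolding s_def by (simp add: image_eqI)
  have reg: "regular s" unfolding regular_def using L(3) fst_mem by (metis add_0)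
  have typ': "typical s" unfolding typical_def using L(3) fst_mem by blast
  \<comment> \<open>Both \<open>mA M\<close> and \<open>op.vA L\<close> contain even degrees only,
    and the latter has constant term 1, so their ratio \<open>f\<close> is even as well and has the
    form \<open>gam g\<close>.\<close>
  have fodd: "f k = 0" if "odd k" for k
    using that
  proof (induction k rule: less_induct)
    case (less k)
    have "0 = mA M $ k" using less.prems by (simp add: mA_def[OF M d])
    also have "\<dots> = (\<Sum>i=0..k. scl (f i) * op.vA L $ (k - i))" unfolding L(5) fps_mult_nth by (simp add: op.lift_def)
    also have "\<dots> = (\<Sum>i\<in>{k}. scl (f i) * op.vA L $ (k - i))"
    proof (rule sum.mono_neutral_right)
      show "\<forall>i\<in>{0..k} - {k}. scl (f i) * op.vA L $ (k - i) = 0"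
      proof
        fix i assume i: "i \<in> {0..k} - {k}"
        show "scl (f i) * op.vA L $ (k - i) = 0"
        proof (cases "odd i")
          case True
          then show ?thesis using less.IH[of i] i by simp
        next
          case False
          then have "odd (k - i)" using i less.prems by simp
          then show ?thesis by (simp add: op.v_parity(1))
        qed
      qed
    qed auto
    also have "\<dots> = scl (f k)" using op.v_nth_low[of L] by simp
    finally show ?case by (simp add: op.sc_eq_0_iff eq_commute[of 0])
  qed
  define g where "g k = f (2 * k)" for k
  have gam: "gam g = f"
  proof
    fix k show "gam g k = f k" using L(4) fodd[of k] by (simp add: gam_def g_def)
  qed
  have EV: "mA M + mB M = op.lift f * op.EV L" "mP M + mQ M = op.lift f * op.OV L"
    unfolding L(5-8) op.EV_def op.OV_def by (simp_all add: distrib_left)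
  have N: "hdim H > 0" using d H by simp
  let ?T = "tensor (V_mod s H) (Gamma_mod g)"
  note T = tensor_V_mod_emb[where f = g, OF N xiH, unfolded hL gam H(1,2)]
  have actc: "act M m i j \<in> carrier_mat ?N ?N" if "m \<ge> 1" "i \<in> idx" "j \<in> idx" for m i j
    by (rule homog_carrier[OF d act_homog[OF M d that]])
  have act_eq: "act M m i j = act ?T m i j" if m: "m \<ge> 1" and i: "i \<in> idx" and j: "j \<in> idx" for m i j
  proof -
    have "emb ?N (act M m i j) = emb ?N (act ?T m i j)"
      using i j act_emb[OF M d m] T(3-6)[where m = m] unfolding EV idx_def by auto
    then show ?thesis using emb_inj[OF d actc[OF m i j] T(7)[OF i j]] by simp
  qed
  have "iso_YQ1 M ?T"
    by (rule iso_YQ1_refl) (use T(1,2) act_eq actc in auto)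
  moreover have "simple_h_module s H"
    unfolding simple_h_module_def
  proof (intro conjI allI impI)
    show "homog (hdim H) (hpar H) True (xi H i)" if "i < length s" for i using xiH that by blast
    show "xi H i * xi H j + xi H j * xi H i = 0\<^sub>m (hdim H) (hdim H)" if "i < length s" "j < length s" "i \<noteq> j" for i j
      using anti that by blast
    show "xi H i * xi H i = (s ! i) \<cdot>\<^sub>m 1\<^sub>m (hdim H)" if "i < length s" for i using sq that by blast
    \<comment> \<open>The action of YQ(1) is by polynomials in the \<xi>_i with scalar coefficients,
      so a subspace stable under the \<xi>_i is a submodule of \<open>M\<close>.\<close>
    show "simple_graded (hdim H) (hpar H) {xi H i | i. i < length s}"
      unfolding simple_graded_def H
    proof (intro conjI allI impI)
      show "?N > 0" by (rule d)
      fix U assume U: "graded_inv_subspace ?N (par M) {xi H i | i. i < length s} U"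
      define Sg where "Sg = {t. \<forall>v\<in>U. \<exists>u\<in>U. lapp t (ext v) = ext u}"
      have Uc: "U \<subseteq> carrier_vec ?N" and U0: "0\<^sub>v ?N \<in> U" and Ua: "\<And>x y. x \<in> U \<Longrightarrow> y \<in> U \<Longrightarrow> x + y \<in> U"
        and Us: "\<And>c x. x \<in> U \<Longrightarrow> c \<cdot>\<^sub>v x \<in> U" and Ui: "\<And>i x. i < length s \<Longrightarrow> x \<in> U \<Longrightarrow> xi H i *\<^sub>v x \<in> U"
        using U unfolding graded_inv_subspace_def by blast+
      have Ssub: "op.vs.subspace Sg" unfolding Sg_def by (rule stabiliser_subspace[OF d Uc U0 Ua Us])
      have S1: "1 \<in> Sg" unfolding Sg_def by (auto simp: lapp_simps)
      have Sm: "x * y \<in> Sg" if xy: "x \<in> Sg" "y \<in> Sg" for x y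
        unfolding Sg_def
      proof (intro CollectI ballI)
        fix v assume v: "v \<in> U"
        obtain a where a: "a \<in> U" "lapp y (ext v) = ext a" using xy v unfolding Sg_def by blast
        obtain b where b: "b \<in> U" "lapp x (ext a) = ext b" using xy a unfolding Sg_def by blast
        show "\<exists>u\<in>U. lapp (x * y) (ext v) = ext u" using a b by (auto simp: lapp_simps)
      qed
      have SX: "snd ` set L \<subseteq> Sg"
      proof
        fix x assume "x \<in> snd ` set L"
        then obtain i where i: "i < length s" "x = emb ?N (xi H i)"
          unfolding hL[symmetric] hL_def H by auto
        have ci: "xi H i \<in> carrier_mat ?N ?N" using xiH[rule_format, OF i(1)] homog_carrier[OF d, of "par M" True "xi H i"] H by simp
        show "x \<in> Sg" unfolding Sg_def i(2)
        proof (intro CollectI ballI)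
          fix v assume v: "v \<in> U"
          then have "v \<in> carrier_vec ?N" using Uc by blast
          from lapp_emb_ext[OF d ci this] show "\<exists>u\<in>U. lapp (emb ?N (xi H i)) (ext v) = ext u"
            using Ui[OF i(1) v] by blast
        qed
      qed
      have Sv: "(op.lift f * F) $ m \<in> Sg" if "\<And>m. F $ m \<in> Sg" for F m
        unfolding fps_mult_nth by (intro op.vs.subspace_sum[OF Ssub]) (simp add: op.lift_def op.vs.subspace_scale[OF Ssub that])
      have E: "(mA M + mB M) $ m \<in> Sg" "(mP M + mQ M) $ m \<in> Sg" for m
        unfolding EV by (rule Sv, rule op.v_in_subalgebra[OF Ssub S1 Sm SX], assumption+)+
      have sg: "sgl m * x \<in> Sg" if "x \<in> Sg" for m x
        using that op.vs.subspace_neg[OF Ssub] by (auto simp: sgl_def)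
      have Sact: "emb ?N (act M m i j) \<in> Sg" if "m \<ge> 1" "i \<in> idx" "j \<in> idx" for m i j
        using that(2,3) act_emb[OF M d that(1)] E[of m] sg unfolding idx_def by auto
      have "graded_inv_subspace ?N (par M) {act M m i j | m i j. m \<ge> 1 \<and> i \<in> idx \<and> j \<in> idx} U"
        unfolding graded_inv_subspace_def
      proof (intro conjI ballI)
        show "G *\<^sub>v v \<in> U" if G: "G \<in> {act M m i j | m i j. m \<ge> 1 \<and> i \<in> idx \<and> j \<in> idx}" and v: "v \<in> U" for G v
        proof -
          have cG: "G \<in> carrier_mat ?N ?N" using G actc by blast
          have cv: "v \<in> carrier_vec ?N" using v Uc by blast
          have "emb ?N G \<in> Sg" using G Sact by blast
          then obtain u where u: "u \<in> U" "lapp (emb ?N G) (ext v) = ext u" using v unfolding Sg_def by blast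
          have "ext (G *\<^sub>v v) = ext u" using u(2) unfolding lapp_emb_ext[OF d cG cv] .
          then have "G *\<^sub>v v = u" using ext_inj[OF d, of "G *\<^sub>v v" u] cG cv u(1) Uc by auto
          then show ?thesis using u(1) by simp
        qed
      qed (use U in \<open>auto simp: graded_inv_subspace_def\<close>)
      then show "U = {0\<^sub>v ?N} \<or> U = carrier_vec ?N"
        using S unfolding simple_YQ1_def simple_graded_def by blast
    qed
  qed
  ultimately show ?thesis using reg typ' by blast
qed

section \<open>Moments and permutations of the weights\<close>

context calg
begin

definition flift :: "complex fps \<Rightarrow> 'a fps" where
  "flift g = Abs_fps (\<lambda>n. sc (g $ n))"

lemma flift_central: "y * flift g = flift g * y"
  using lift_central[of y "fps_nth g"] unfolding flift_def lift_def .

lemma flift_simps: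
  "flift (f + g) = flift f + flift g" "flift (f - g) = flift f - flift g" "flift 1 = 1" "flift fps_X = fps_X"
  "flift (f * g) = flift f * flift g" "flift (fps_const c) = fps_const (sc c)"
  by (simp_all add: fps_eq_iff flift_def sc_add sc_diff fps_mult_nth sc_sum sc_mult fps_X_def)

abbreviation "\<Pi>m L \<equiv> prod_list (map (\<lambda>x. 1 - fps_const (2 * x) * fps_X) (map fst L)) :: complex fps"
abbreviation "\<Pi>p L \<equiv> prod_list (map (\<lambda>x. 1 + fps_const (2 * x) * fps_X) (map fst L)) :: complex fps"

text \<open>The resolvent \<open>r = \<Sum> D\<^sup>n \<sigma> X\<^sup>n\<^sup>+\<^sup>1\<close>, and the addition law (of hyperbolic tangent type) for its
  moment series \<open>g\<close>.\<close>

lemma resolvent: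
  assumes "clif L"
  shows "\<exists>r g. r = fps_X * (fps_const (- vw L) + (fps_const (ve L) * r - r * fps_const (ve L)))
     \<and> acomm (fps_const (- vw L)) r = flift g \<and> g $ 0 = 0 \<and> (1 + g) * \<Pi>m L = (1 - g) * \<Pi>p L
     \<and> (\<forall>\<zeta>. (\<forall>\<eta>\<in>snd ` set L. \<zeta> * \<eta> = - (\<eta> * \<zeta>)) \<longrightarrow> acomm (fps_const \<zeta>) r = 0)"
  using assms
proof (induction L)
  case Nil
  show ?case by (rule exI[of _ 0], rule exI[of _ 0]) (simp add: acomm_simps fps_eq_iff flift_def)
next
  case (Cons a L)
  obtain x \<xi> where a: "a = (x, \<xi>)" by force
  have cl: "clif L" and \<xi>x: "\<xi> * \<xi> = sc x" and anti: "\<forall>\<eta>\<in>snd ` set L. \<xi> * \<eta> = - (\<eta> * \<xi>)"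
    using Cons.prems by (auto simp: a)
  obtain r' g' where r': "r' = fps_X * (fps_const (- vw L) + (fps_const (ve L) * r' - r' * fps_const (ve L)))"
    and g': "acomm (fps_const (- vw L)) r' = flift g'" "g' $ 0 = 0" "(1 + g') * \<Pi>m L = (1 - g') * \<Pi>p L"
    and z': "\<And>\<zeta>. \<forall>\<eta>\<in>snd ` set L. \<zeta> * \<eta> = - (\<eta> * \<zeta>) \<Longrightarrow> acomm (fps_const \<zeta>) r' = 0"
    using Cons.IH[OF cl] by metis
  define h where "h = fps_const (2 * x) * fps_X"
  define u where "u = 1 + h * g'"
  have u0: "u $ 0 = 1" unfolding u_def h_def by simp
  then have uinv: "u * inverse u = 1" by (subst mult.commute, intro inverse_mult_eq_1) simp
  \<comment> \<open>Ansatz \<open>r = flift \<alpha> * r' + flift \<beta> * k\<close>. In the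
    resolvent equation the coefficient of \<open>k\<close> forces the value of \<beta>, and that of
    \<sigma> forces \<open>\<alpha> * u = 1 - h\<close>.\<close>
  define \<alpha> where "\<alpha> = (1 - h) * inverse u"
  define \<beta> where "\<beta> = fps_X * (1 + \<alpha> * g')"
  \<comment> \<open>This equals (g' + h) / (1 + h g'), the addition formula of the hyperbolic
    tangent. The factors \<open>u * (1 - g)\<close> and \<open>u * (1 + g)\<close> below are its
    multiplicative form.\<close>
  define g where "g = \<alpha> * g' + h * (1 + \<alpha> * g')"
  have au: "\<alpha> * u = 1 - h" unfolding \<alpha>_def using uinv by (simp add: mult.assoc mult.commute[of "inverse u"])
  have gg: "g = 1 - \<alpha> * (1 - g')"
  proof -
    have "g = \<alpha> * g' + h + (\<alpha> * u - \<alpha>)" unfolding g_def u_def by (simp add: algebra_simps)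
    also have "\<dots> = 1 - \<alpha> * (1 - g')" unfolding au by (simp add: algebra_simps)
    finally show ?thesis .
  qed
  have g1: "u * (1 - g) = (1 - h) * (1 - g')"
  proof -
    have "1 - g = \<alpha> * (1 - g')" by (simp add: gg)
    then have "u * (1 - g) = (\<alpha> * u) * (1 - g')" by (simp only: mult_ac)
    then show ?thesis by (simp only: au)
  qed
  have g2: "u * (1 + g) = (1 + h) * (1 + g')"
  proof -
    have "u * (1 + g) = 2 * u - u * (1 - g)" by (simp add: algebra_simps)
    also have "\<dots> = 2 * u - (1 - h) * (1 - g')" by (simp only: g1)
    also have "\<dots> = (1 + h) * (1 + g')" unfolding u_def by (simp add: algebra_simps)
    finally show ?thesis .
  qed
  define \<sigma> where "\<sigma> = fps_const (- vw L)"
  define k where "k = fps_const \<xi>"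
  define e where "e = fps_const (ve L)"
  define r where "r = flift \<alpha> * r' + flift \<beta> * k"
  have wa: "fps_const (- vw (a # L)) = \<sigma> + k" unfolding a vw_Cons \<sigma>_def k_def by simp
  have ea: "fps_const (ve (a # L)) = e - \<sigma> * k + fps_const (sc (x * sum_list (map fst L)))"
    unfolding a ve_Cons \<sigma>_def k_def e_def by simp
  have com: "fps_const (sc c) * y = y * fps_const (sc c)" for c y by (rule fps_ext) (simp add: sc_comm)
  have kk: "k * k = flift (fps_const x)" unfolding k_def flift_simps by (simp add: \<xi>x)
  have kr: "k * r' = - (r' * k)" using z'[OF anti] unfolding k_def acomm_def by (simp add: eq_neg_iff_add_eq_0)
  have vwx: "\<xi> * vw L = - (vw L * \<xi>)"
    using v_commute[OF anti] by (auto simp: fps_eq_iff)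
  then have ks: "k * \<sigma> = - (\<sigma> * k)" unfolding k_def \<sigma>_def by simp
  have "\<xi> * ve L = ve L * \<xi>" using arg_cong[OF conjunct1[OF v_commute[OF anti]], of "\<lambda>f. f $ 2"] by simp
  then have ke: "k * e = e * k" unfolding k_def e_def by simp
  have fl: "y * (flift c * t) = flift c * (y * t)" for y c t by (metis flift_central mult.assoc)
  have sg: "\<sigma> * r' + r' * \<sigma> = flift g'" using g'(1) unfolding acomm_def \<sigma>_def .
  have r'X: "fps_X * (e * r' - r' * e) = r' - fps_X * \<sigma>"
    using r' unfolding \<sigma>_def e_def by (simp add: algebra_simps del: fps_const_neg)
  have br: "(e - \<sigma> * k) * r' - r' * (e - \<sigma> * k) = (e * r' - r' * e) + flift g' * k"
  proof -
    have "\<sigma> * k * r' = - (\<sigma> * r' * k)" by (simp add: mult.assoc kr)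
    then show ?thesis unfolding sg[symmetric] by (simp add: algebra_simps)
  qed
  have bk: "(e - \<sigma> * k) * k - k * (e - \<sigma> * k) = - (flift (fps_const (2 * x)) * \<sigma>)"
  proof -
    have "k * (\<sigma> * k) = - (\<sigma> * (k * k))" by (simp add: ks flip: mult.assoc)
    then have "(e - \<sigma> * k) * k - k * (e - \<sigma> * k) = - (\<sigma> * (k * k) + \<sigma> * (k * k))"
      by (simp add: algebra_simps ke)
    also have "\<dots> = - (flift (fps_const x + fps_const x) * \<sigma>)"
      unfolding kk flift_simps(1) by (simp only: flift_central distrib_right)
    finally show ?thesis by simp
  qed
  have Xl: "fps_X * (flift c * t) = flift c * (fps_X * t)" for c t by (rule fl)
  have eq1: "r = fps_X * ((\<sigma> + k) + ((e - \<sigma> * k) * r - r * (e - \<sigma> * k)))"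
  proof -
    have "(e - \<sigma> * k) * r - r * (e - \<sigma> * k)
      = flift \<alpha> * ((e - \<sigma> * k) * r' - r' * (e - \<sigma> * k)) + flift \<beta> * ((e - \<sigma> * k) * k - k * (e - \<sigma> * k))"
      unfolding r_def by (simp only: distrib_left distrib_right fl mult.assoc right_diff_distrib) (simp add: algebra_simps)
    also have "\<dots> = flift \<alpha> * (e * r' - r' * e) + flift (\<alpha> * g') * k - flift (\<beta> * fps_const (2 * x)) * \<sigma>"
      unfolding br bk flift_simps(5) by (simp add: algebra_simps)
    finally have "fps_X * ((\<sigma> + k) + ((e - \<sigma> * k) * r - r * (e - \<sigma> * k)))
      = fps_X * \<sigma> + fps_X * k + flift \<alpha> * (fps_X * (e * r' - r' * e)) + flift (fps_X * (\<alpha> * g')) * k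
        - flift (fps_X * (\<beta> * fps_const (2 * x))) * \<sigma>"
      unfolding flift_simps(4,5) by (simp only: distrib_left right_diff_distrib Xl mult.assoc add.assoc) (simp only: add_diff_eq)
    also have "\<dots> = flift \<alpha> * r' + flift (fps_X + fps_X * (\<alpha> * g')) * k
        + flift (fps_X - fps_X * \<alpha> - fps_X * (\<beta> * fps_const (2 * x))) * \<sigma>"
      unfolding r'X flift_simps by (simp add: algebra_simps Xl)
    also have "fps_X + fps_X * (\<alpha> * g') = \<beta>" unfolding \<beta>_def by (simp add: algebra_simps)
    also have "fps_X - fps_X * \<alpha> - fps_X * (\<beta> * fps_const (2 * x)) = fps_X * (1 - h - \<alpha> * u)"
      unfolding \<beta>_def u_def h_def by (simp add: algebra_simps)
    finally have "fps_X * ((\<sigma> + k) + ((e - \<sigma> * k) * r - r * (e - \<sigma> * k))) = flift \<alpha> * r' + flift \<beta> * k + flift 0 * \<sigma>"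
      unfolding au by simp
    moreover have "flift 0 = 0" by (simp add: flift_def fps_eq_iff)
    ultimately show ?thesis unfolding r_def by simp
  qed
  have eq2: "acomm (\<sigma> + k) r = flift g"
  proof -
    have "acomm (\<sigma> + k) r = flift \<alpha> * (\<sigma> * r' + r' * \<sigma>) + flift \<alpha> * (k * r' + r' * k) + flift \<beta> * (\<sigma> * k + k * \<sigma>) + flift \<beta> * (k * k + k * k)"
      unfolding r_def acomm_def by (simp add: distrib_left distrib_right fl mult.assoc add_ac)
    also have "\<dots> = flift (\<alpha> * g') + flift \<beta> * (flift (fps_const x) + flift (fps_const x))"
      unfolding sg kr ks kk flift_simps(5) by simp
    also have "\<dots> = flift (\<alpha> * g' + \<beta> * (fps_const x + fps_const x))" by (simp only: flift_simps(1,5))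
    also have "\<alpha> * g' + \<beta> * (fps_const x + fps_const x) = g"
    proof -
      have "fps_const x + fps_const x = fps_const (2 * x)" by simp
      then show ?thesis unfolding g_def \<beta>_def h_def by (simp only:) (simp add: algebra_simps)
    qed
    finally show ?thesis .
  qed
  have eqP: "(1 + g) * \<Pi>m (a # L) = (1 - g) * \<Pi>p (a # L)"
  proof -
    have "u * ((1 + g) * \<Pi>m (a # L)) = (u * (1 + g)) * ((1 - h) * \<Pi>m L)" by (simp add: a h_def mult.assoc)
    also have "\<dots> = (1 + h) * (1 - h) * ((1 + g') * \<Pi>m L)" unfolding g2 by (simp only: mult_ac)
    also have "\<dots> = (1 + h) * (1 - h) * ((1 - g') * \<Pi>p L)" unfolding g'(3) ..
    also have "\<dots> = (u * (1 - g)) * ((1 + h) * \<Pi>p L)" unfolding g1 by (simp only: mult_ac)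
    also have "\<dots> = u * ((1 - g) * \<Pi>p (a # L))" by (simp add: a h_def mult.assoc)
    finally have "u * ((1 + g) * \<Pi>m (a # L)) = u * ((1 - g) * \<Pi>p (a # L))" .
    moreover have "u \<noteq> 0" using u0 by auto
    ultimately show ?thesis using mult_left_cancel[of u] by blast
  qed
  have eqz: "acomm (fps_const \<zeta>) r = 0" if z: "\<forall>\<eta>\<in>snd ` set (a # L). \<zeta> * \<eta> = - (\<eta> * \<zeta>)" for \<zeta>
  proof -
    have "acomm (fps_const \<zeta>) r' = 0" by (rule z') (use z in simp)
    moreover have "\<zeta> * \<xi> + \<xi> * \<zeta> = 0" using z by (simp add: a)
    then have "acomm (fps_const \<zeta>) k = 0" unfolding acomm_def k_def by simp
    ultimately show ?thesis unfolding r_def acomm_simps by (simp add: acomm_central[OF flift_central])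
  qed
  have "r = fps_X * (fps_const (- vw (a # L)) + (fps_const (ve (a # L)) * r - r * fps_const (ve (a # L))))"
    unfolding wa ea using eq1 by (simp add: com algebra_simps)
  then show ?case using eq2 eqP eqz g'(2) unfolding wa
    by (intro exI[of _ r] exI[of _ g] conjI) (auto simp: g_def h_def)
qed

lemma moments:
  assumes "clif L"
  shows "\<exists>g. (\<forall>n. acomm (vw L) ((der (ve L) ^^ n) (vw L)) = sc (g $ Suc n)) \<and> g $ 0 = 0 \<and> (1 + g) * \<Pi>m L = (1 - g) * \<Pi>p L"
proof -
  obtain r g where r: "r = fps_X * (fps_const (- vw L) + (fps_const (ve L) * r - r * fps_const (ve L)))"
    and g: "acomm (fps_const (- vw L)) r = flift g" "g $ 0 = 0" "(1 + g) * \<Pi>m L = (1 - g) * \<Pi>p L"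
    using resolvent[OF assms] by blast
  have rn: "r $ Suc n = - ((der (ve L) ^^ n) (vw L))" for n
  proof (induction n)
    case 0
    have r0: "r $ 0 = 0" using arg_cong[OF r, of "\<lambda>f. f $ 0"] by simp
    show ?case using arg_cong[OF r, of "\<lambda>f. f $ Suc 0"] r0 by simp
  next
    case (Suc n)
    have "r $ Suc (Suc n) = der (ve L) (r $ Suc n)" using arg_cong[OF r, of "\<lambda>f. f $ Suc (Suc n)"] by (simp add: der_def)
    then show ?case unfolding Suc by (simp add: der_simps)
  qed
  have "acomm (vw L) ((der (ve L) ^^ n) (vw L)) = sc (g $ Suc n)" for n
  proof -
    have "acomm (- vw L) (r $ Suc n) = sc (g $ Suc n)"
      using arg_cong[OF g(1), of "\<lambda>f. f $ Suc n"] by (simp add: acomm_def flift_def)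
    then show ?thesis unfolding rn by (simp add: acomm_simps)
  qed
  then show ?thesis using g(2,3) by blast
qed

end

section \<open>Recovering the weights from the moment series\<close>

lemma prod_linear_factors_mset:
  fixes A B :: "complex list"
  assumes "0 \<notin> set A" "0 \<notin> set B"
    and "prod_list (map (\<lambda>y. [:1, y:]) A) = prod_list (map (\<lambda>y. [:1, y:]) B)"
  shows "mset A = mset B"
  using assms
proof (induction A arbitrary: B)
  case Nil
  show ?case
  proof (cases B)
    case (Cons y B')
    have "poly (prod_list (map (\<lambda>y. [:1, y:]) B)) (- 1 / y) = 0"
      using Nil.prems(2) by (simp add: Cons)
    then show ?thesis unfolding Nil.prems(3)[symmetric] by simp
  qed simp
next
  case (Cons y A)
  have y: "y \<noteq> 0" using Cons.prems(1) by auto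
  \<comment> \<open>A factor \<open>[:1, y:]\<close> with \<open>y\<close> nonzero is recognised by
    its root \<open>- 1 / y\<close>; the other product must have this root too, and the matching
    factors are cancelled.\<close>
  have "poly (prod_list (map (\<lambda>y. [:1, y:]) (y # A))) (- 1 / y) = 0" using y by simp
  then have "poly (prod_list (map (\<lambda>y. [:1, y:]) B)) (- 1 / y) = 0" unfolding Cons.prems(3) .
  then have "y \<in> set B"
  proof (induction B)
    case (Cons b B)
    have "(1 + - 1 / y * b) * poly (prod_list (map (\<lambda>y. [:1, y:]) B)) (- 1 / y) = 0"
      using Cons.prems by (simp add: algebra_simps)
    then have "1 + - 1 / y * b = 0 \<or> poly (prod_list (map (\<lambda>y. [:1, y:]) B)) (- 1 / y) = 0"
      by (simp only: mult_eq_0_iff)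
    moreover have "1 + - 1 / y * b = 0 \<Longrightarrow> b = y" using y by (simp add: field_simps)
    ultimately show ?case using Cons.IH by auto
  qed simp
  then have B: "mset B = mset (y # remove1 y B)"
    and "prod_list (map (\<lambda>y. [:1, y:]) B) = [:1, y:] * prod_list (map (\<lambda>y. [:1, y:]) (remove1 y B))"
    by (simp, induction B) (auto simp only: list.map prod_list.Cons remove1.simps list.set insert_iff mult.left_commute split: if_splits)
  then have "[:1, y:] * prod_list (map (\<lambda>y. [:1, y:]) A) = [:1, y:] * prod_list (map (\<lambda>y. [:1, y:]) (remove1 y B))"
    using Cons.prems(3) by simp
  then have "prod_list (map (\<lambda>y. [:1, y:]) A) = prod_list (map (\<lambda>y. [:1, y:]) (remove1 y B))"
    by (subst (asm) mult_left_cancel) auto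
  then have "mset A = mset (remove1 y B)"
    using Cons.prems(1,2) notin_set_remove1[of 0 B y] by (intro Cons.IH) auto
  then show ?case unfolding B by simp
qed

lemma fps_prod_linear_factors:
  "prod_list (map (\<lambda>y. 1 + fps_const y * fps_X) A) = fps_of_poly (prod_list (map (\<lambda>y. [:1, y:]) A))" for A :: "complex list"
  by (induction A) (simp_all add: fps_of_poly_mult fps_of_poly_pCons mult.commute)

text \<open>Eliminating \<open>g\<close> gives one identity between products of linear factors, by
  which the difference of the multiplicities in \<open>s\<close> and in \<open>t\<close> is the same
  at \<open>a\<close> and at \<open>- a\<close>. Typicality forbids \<open>a\<close> and
  \<open>- a\<close> from occurring in one list, so this difference is zero.\<close>

lemma mset_eq_of_moments:
  fixes s t :: "complex list" and g :: "complex fps"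
  assumes s: "regular s" "typical s" and t: "regular t" "typical t" and g0: "g $ 0 = 0"
    and gs: "(1 + g) * prod_list (map (\<lambda>x. 1 - fps_const (2 * x) * fps_X) s) = (1 - g) * prod_list (map (\<lambda>x. 1 + fps_const (2 * x) * fps_X) s)"
    and gt: "(1 + g) * prod_list (map (\<lambda>x. 1 - fps_const (2 * x) * fps_X) t) = (1 - g) * prod_list (map (\<lambda>x. 1 + fps_const (2 * x) * fps_X) t)"
  shows "mset s = mset t"
proof -
  let ?m = "\<lambda>s. prod_list (map (\<lambda>x. 1 - fps_const (2 * x) * fps_X) s) :: complex fps"
  let ?p = "\<lambda>s. prod_list (map (\<lambda>x. 1 + fps_const (2 * x) * fps_X) s) :: complex fps"
  have "((1 + g) * (1 - g)) * (?m s * ?p t) = ((1 + g) * ?m s) * ((1 - g) * ?p t)" by (simp only: mult_ac)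
  also have "\<dots> = ((1 + g) * (1 - g)) * (?p s * ?m t)" unfolding gs gt[symmetric] by (simp only: mult_ac)
  finally have "((1 + g) * (1 - g)) * (?m s * ?p t) = ((1 + g) * (1 - g)) * (?p s * ?m t)" .
  moreover have "((1 + g) * (1 - g)) $ 0 \<noteq> 0" using g0 by simp
  then have "(1 + g) * (1 - g) \<noteq> 0" by (metis fps_zero_nth)
  ultimately have eq: "?m s * ?p t = ?p s * ?m t" by (subst (asm) mult_left_cancel)
  define A where "A = map (\<lambda>x. - (2 * x)) s @ map (\<lambda>x. 2 * x) t"
  define B where "B = map (\<lambda>x. 2 * x) s @ map (\<lambda>x. - (2 * x)) t"
  have ms: "?m s = prod_list (map (\<lambda>y. 1 + fps_const y * fps_X) (map (\<lambda>x. - (2 * x)) s))" for s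
    by (simp add: comp_def flip: fps_const_neg)
  have ps: "?p s = prod_list (map (\<lambda>y. 1 + fps_const y * fps_X) (map (\<lambda>x. 2 * x) s))" for s
    by (simp add: comp_def)
  have "prod_list (map (\<lambda>y. 1 + fps_const y * fps_X) A) = prod_list (map (\<lambda>y. 1 + fps_const y * fps_X) B)"
    using eq unfolding ms ps A_def B_def by (simp only: map_append prod_list.append)
  then have "prod_list (map (\<lambda>y. [:1, y:]) A) = prod_list (map (\<lambda>y. [:1, y:]) B)"
    unfolding fps_prod_linear_factors by (simp only: fps_of_poly_eq_iff)
  moreover have nz: "0 \<notin> set s" "0 \<notin> set t" using s t unfolding regular_def by (auto simp: in_set_conv_nth)
  ultimately have AB: "mset A = mset B"
    by (intro prod_linear_factors_mset) (auto simp: A_def B_def)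
  have inj: "inj (\<lambda>x::complex. 2 * x)" "inj (\<lambda>x::complex. - (2 * x))" by (auto intro!: injI)
  have ci: "count (mset (map f l)) (f a) = count (mset l) a" if "inj f" for f :: "complex \<Rightarrow> complex" and l a
    using that by (induction l) (auto dest: injD)
  have c1: "count (mset (map (\<lambda>x. 2 * x) l)) (2 * a) = count (mset l) a" for l and a :: complex
    by (rule ci[OF inj(1)])
  have c2: "count (mset (map (\<lambda>x. - (2 * x)) l)) (2 * a) = count (mset l) (- a)" for l and a :: complex
    using ci[OF inj(2), of l "- a"] by simp
  have cnt: "count (mset s) (- a) + count (mset t) a = count (mset s) a + count (mset t) (- a)" for a
    using arg_cong[OF AB, of "\<lambda>m. count m (2 * a)"] unfolding A_def B_def by (simp only: mset_append count_union c1 c2)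
  have ty: "count (mset l) a = 0 \<or> count (mset l) (- a) = 0" if l: "typical l" and a: "a \<noteq> 0" for l a
  proof (rule ccontr)
    assume "\<not> ?thesis"
    then have "a \<in> set l" "- a \<in> set l" by (metis count_mset_0_iff)+
    then obtain i j where ij: "i < length l" "l ! i = a" "j < length l" "l ! j = - a" by (metis in_set_conv_nth)
    have "i \<noteq> j" using ij a by auto
    then show False using l ij unfolding typical_def by (metis add.right_inverse)
  qed
  show ?thesis
  proof (rule multiset_eqI)
    fix a
    show "count (mset s) a = count (mset t) a"
    proof (cases "a = 0")
      case True
      then show ?thesis using nz by (simp add: count_mset_0_iff[THEN iffD2])
    next
      case False
      show ?thesis using cnt[of a] ty[OF s(2) False] ty[OF t(2) False] by linarith
    qed
  qed
qed

text \<open>Two consecutive factors enter the series only through \<open>x + y\<close>,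
  \<open>x * y - \<xi> * \<eta>\<close>, \<open>\<xi> + \<eta>\<close> and
  \<open>x * \<eta> - y * \<xi>\<close>. A change of generators preserving these four expressions
  preserves the series.\<close>

lemma two_step_expansion:
  fixes X x y E F \<xi> \<eta> :: "'r::ring_1"
  assumes X: "\<And>t. t * X = X * t" and x: "\<And>t. t * x = x * t" and y: "\<And>t. t * y = y * t"
  shows "E - X * (x * E) + X * (F * \<xi>) - X * (y * (E - X * (x * E) + X * (F * \<xi>))) + X * ((F + X * (x * F) - X * (E * \<xi>)) * \<eta>)
     = E * (1 - X * (x + y) + X * (X * (x * y - \<xi> * \<eta>))) + F * (X * (\<xi> + \<eta>) + X * (X * (x * \<eta> - y * \<xi>)))"
    and "F + X * (x * F) - X * (E * \<xi>) + X * (y * (F + X * (x * F) - X * (E * \<xi>))) - X * ((E - X * (x * E) + X * (F * \<xi>)) * \<eta>)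
     = F * (1 + X * (x + y) + X * (X * (x * y - \<xi> * \<eta>))) - E * (X * (\<xi> + \<eta>) - X * (X * (x * \<eta> - y * \<xi>)))"
proof -
  have l: "a * (X * b) = X * (a * b)" "a * (x * b) = x * (a * b)" "a * (y * b) = y * (a * b)" for a b
    by (metis X mult.assoc, metis x mult.assoc, metis y mult.assoc)
  note R = l(1)[of E] l(1)[of F] l(2)[of E] l(2)[of F] l(2)[of X] l(3)[of E] l(3)[of F] l(3)[of X] l(3)[of x]
    X[of E] X[of F] x[of E] x[of F] x[of X] y[of E] y[of F] y[of X] y[of x]
  show "E - X * (x * E) + X * (F * \<xi>) - X * (y * (E - X * (x * E) + X * (F * \<xi>))) + X * ((F + X * (x * F) - X * (E * \<xi>)) * \<eta>)
     = E * (1 - X * (x + y) + X * (X * (x * y - \<xi> * \<eta>))) + F * (X * (\<xi> + \<eta>) + X * (X * (x * \<eta> - y * \<xi>)))"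
    by (simp add: algebra_simps R)
  show "F + X * (x * F) - X * (E * \<xi>) + X * (y * (F + X * (x * F) - X * (E * \<xi>))) - X * ((E - X * (x * E) + X * (F * \<xi>)) * \<eta>)
     = F * (1 + X * (x + y) + X * (X * (x * y - \<xi> * \<eta>))) - E * (X * (\<xi> + \<eta>) - X * (X * (x * \<eta> - y * \<xi>)))"
    by (simp add: algebra_simps R)
qed

context calg
begin

lemma EV_step: "EV ((x, \<xi>) # L) = EV L - fps_X * (fps_const (sc x) * EV L) + fps_X * (OV L * fps_const \<xi>)"
  and OV_step: "OV ((x, \<xi>) # L) = OV L + fps_X * (fps_const (sc x) * OV L) - fps_X * (EV L * fps_const \<xi>)"
  by (simp_all add: EV_def OV_def algebra_simps)

text \<open>The new generators solve the linear system
  \<open>\<alpha>' + \<beta>' = \<alpha> + \<beta>\<close>, \<open>sc b * \<beta>' - sc a *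
  \<alpha>' = sc a * \<beta> - sc b * \<alpha>\<close>, whose determinant is \<open>a + b\<close> up
  to sign. Their product then equals that of the old ones, so all four expressions of the two-step
  expansion are kept.\<close>

lemma swap_generators:
  assumes c: "clif ((b, \<beta>) # (a, \<alpha>) # L)" and ab: "a + b \<noteq> 0"
  defines "\<alpha>' \<equiv> sc (2 * b / (a + b)) * \<alpha> + sc ((b - a) / (a + b)) * \<beta>"
    and "\<beta>' \<equiv> sc ((a - b) / (a + b)) * \<alpha> + sc (2 * a / (a + b)) * \<beta>"
  shows "clif ((a, \<beta>') # (b, \<alpha>') # L)"
    and "EV ((a, \<beta>') # (b, \<alpha>') # L) = EV ((b, \<beta>) # (a, \<alpha>) # L)"
    and "OV ((a, \<beta>') # (b, \<alpha>') # L) = OV ((b, \<beta>) # (a, \<alpha>) # L)"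
    and "vs.span (insert \<beta>' (insert \<alpha>' S)) = vs.span (insert \<beta> (insert \<alpha> S))"
proof -
  have bb: "\<beta> * \<beta> = sc b" and aa: "\<alpha> * \<alpha> = sc a" and ba: "\<beta> * \<alpha> = - (\<alpha> * \<beta>)"
    and aL: "\<forall>\<eta>\<in>snd ` set L. \<alpha> * \<eta> = - (\<eta> * \<alpha>)" and bL: "\<forall>\<eta>\<in>snd ` set L. \<beta> * \<eta> = - (\<eta> * \<beta>)" and cL: "clif L"
    using c by auto
  have prod: "(sc p * \<alpha> + sc q * \<beta>) * (sc u * \<alpha> + sc v * \<beta>) = sc (p * u * a + q * v * b) + sc (p * v - q * u) * (\<alpha> * \<beta>)" for p q u v
  proof -
    have "(sc p * \<alpha> + sc q * \<beta>) * (sc u * \<alpha> + sc v * \<beta>)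
      = sc (p * u) * (\<alpha> * \<alpha>) + sc (p * v) * (\<alpha> * \<beta>) + sc (q * u) * (\<beta> * \<alpha>) + sc (q * v) * (\<beta> * \<beta>)"
      by (simp only: distrib_left distrib_right mult.assoc sc_left_comm[of \<alpha>] sc_left_comm[of \<beta>] sc_mult add.assoc)
        (simp only: add_ac)
    then show ?thesis unfolding aa bb ba by (simp add: sc_add sc_diff algebra_simps flip: sc_mult)
  qed
  \<comment> \<open>With \<open>i\<close> in place of the fraction the identities become polynomial:
    three right-hand sides carry the factor \<open>(i * (a + b)) * (i * (a + b))\<close>, which is
    1, and the fourth is zero.\<close>
  define i where "i = inverse (a + b)"
  have ik: "i * (a + b) = 1" using ab by (simp add: i_def)
  have f1: "2 * b / (a + b) * (2 * b / (a + b)) * a + (b - a) / (a + b) * ((b - a) / (a + b)) * b = b"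
    and f2: "(a - b) / (a + b) * ((a - b) / (a + b)) * a + 2 * a / (a + b) * (2 * a / (a + b)) * b = a"
    and f3: "2 * b / (a + b) * ((a - b) / (a + b)) * a + (b - a) / (a + b) * (2 * a / (a + b)) * b = 0"
    and f4: "2 * b / (a + b) * (2 * a / (a + b)) - (b - a) / (a + b) * ((a - b) / (a + b)) = 1"
  proof -
    have "2 * b * i * (2 * b * i) * a + (b - a) * i * ((b - a) * i) * b = b * (i * (a + b)) * (i * (a + b))"
      "(a - b) * i * ((a - b) * i) * a + 2 * a * i * (2 * a * i) * b = a * (i * (a + b)) * (i * (a + b))"
      "2 * b * i * ((a - b) * i) * a + (b - a) * i * (2 * a * i) * b = 0"
      "2 * b * i * (2 * a * i) - (b - a) * i * ((a - b) * i) = (i * (a + b)) * (i * (a + b))"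
      by (simp_all add: algebra_simps)
    then show "2 * b / (a + b) * (2 * b / (a + b)) * a + (b - a) / (a + b) * ((b - a) / (a + b)) * b = b"
      "(a - b) / (a + b) * ((a - b) / (a + b)) * a + 2 * a / (a + b) * (2 * a / (a + b)) * b = a"
      "2 * b / (a + b) * ((a - b) / (a + b)) * a + (b - a) / (a + b) * (2 * a / (a + b)) * b = 0"
      "2 * b / (a + b) * (2 * a / (a + b)) - (b - a) / (a + b) * ((a - b) / (a + b)) = 1"
      unfolding divide_inverse i_def[symmetric] ik by simp_all
  qed
  have a'a': "\<alpha>' * \<alpha>' = sc b" unfolding \<alpha>'_def prod f1 by (simp add: mult.commute)
  have b'b': "\<beta>' * \<beta>' = sc a" unfolding \<beta>'_def prod f2 by (simp add: mult.commute)
  have a'b': "\<alpha>' * \<beta>' = \<alpha> * \<beta>" unfolding \<alpha>'_def \<beta>'_def prod f3 f4 by simp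
  have b'a': "\<beta>' * \<alpha>' = - (\<alpha>' * \<beta>')"
    unfolding \<alpha>'_def \<beta>'_def prod using f3 f4 by (simp add: sc_add sc_diff sc_minus algebra_simps flip: sc_mult)
  have sum1: "2 * b / (a + b) + (a - b) / (a + b) = 1" "(b - a) / (a + b) + 2 * a / (a + b) = 1"
    using ik unfolding divide_inverse i_def[symmetric] by (simp_all add: algebra_simps)
  have sum: "\<alpha>' + \<beta>' = \<alpha> + \<beta>"
  proof -
    have "\<alpha>' + \<beta>' = sc (2 * b / (a + b) + (a - b) / (a + b)) * \<alpha> + sc ((b - a) / (a + b) + 2 * a / (a + b)) * \<beta>"
      unfolding \<alpha>'_def \<beta>'_def sc_add by (simp only: distrib_right add_ac)
    then show ?thesis unfolding sum1 by simp
  qed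
  have dif: "sc b * \<beta>' - sc a * \<alpha>' = sc a * \<beta> - sc b * \<alpha>"
  proof -
    have "sc b * \<beta>' - sc a * \<alpha>' = sc (b * ((a - b) / (a + b)) - a * (2 * b / (a + b))) * \<alpha> + sc (b * (2 * a / (a + b)) - a * ((b - a) / (a + b))) * \<beta>"
      unfolding \<alpha>'_def \<beta>'_def sc_diff by (simp add: algebra_simps)
    also have "b * ((a - b) / (a + b)) - a * (2 * b / (a + b)) = - b * (i * (a + b))"
      unfolding divide_inverse i_def[symmetric] by (simp add: algebra_simps)
    also have "b * (2 * a / (a + b)) - a * ((b - a) / (a + b)) = a * (i * (a + b))"
      unfolding divide_inverse i_def[symmetric] by (simp add: algebra_simps)
    finally show ?thesis unfolding ik by (simp add: sc_minus)
  qed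
  have anti: "(sc p * \<alpha> + sc q * \<beta>) * \<eta> = - (\<eta> * (sc p * \<alpha> + sc q * \<beta>))" if "\<eta> \<in> snd ` set L" for p q \<eta>
  proof -
    have "\<alpha> * \<eta> = - (\<eta> * \<alpha>)" "\<beta> * \<eta> = - (\<eta> * \<beta>)" using aL bL that by blast+
    then show ?thesis by (simp add: distrib_left distrib_right mult.assoc sc_left_comm[of \<eta>])
  qed
  have aL': "\<forall>\<eta>\<in>snd ` set L. \<alpha>' * \<eta> = - (\<eta> * \<alpha>')" unfolding \<alpha>'_def using anti by blast
  have bL': "\<forall>\<eta>\<in>snd ` set L. \<beta>' * \<eta> = - (\<eta> * \<beta>')" unfolding \<beta>'_def using anti by blast
  show "clif ((a, \<beta>') # (b, \<alpha>') # L)"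
    unfolding clif.simps list.set image_insert snd_conv ball_simps
    by (intro conjI b'b' b'a' a'a' cL) (use aL' bL' in blast)+
  have two: "EV ((y, \<eta>) # (x, \<xi>) # L) = EV L * (1 - fps_X * fps_const (sc (x + y)) + fps_X * (fps_X * fps_const (sc (x * y) - \<xi> * \<eta>)))
       + OV L * (fps_X * fps_const (\<xi> + \<eta>) + fps_X * (fps_X * fps_const (sc x * \<eta> - sc y * \<xi>)))"
    "OV ((y, \<eta>) # (x, \<xi>) # L) = OV L * (1 + fps_X * fps_const (sc (x + y)) + fps_X * (fps_X * fps_const (sc (x * y) - \<xi> * \<eta>)))
       - EV L * (fps_X * fps_const (\<xi> + \<eta>) - fps_X * (fps_X * fps_const (sc x * \<eta> - sc y * \<xi>)))" for x y \<xi> \<eta>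
  proof -
    have ctr: "t * fps_const (sc c) = fps_const (sc c) * t" for t c by (rule fps_ext) (simp add: sc_comm)
    note st = two_step_expansion[OF fps_X_central ctr[where c = x] ctr[where c = y], where E = "EV L" and F = "OV L"
        and \<xi> = "fps_const \<xi>" and \<eta> = "fps_const \<eta>"]
    have k: "fps_const (sc (x + y)) = fps_const (sc x) + fps_const (sc y)"
      "fps_const (sc (x * y) - \<xi> * \<eta>) = fps_const (sc x) * fps_const (sc y) - fps_const \<xi> * fps_const \<eta>"
      "fps_const (\<xi> + \<eta>) = fps_const \<xi> + fps_const \<eta>"
      "fps_const (sc x * \<eta> - sc y * \<xi>) = fps_const (sc x) * fps_const \<eta> - fps_const (sc y) * fps_const \<xi>"
      by (simp_all add: sc_add sc_mult del: vs.scale_scale)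
    show "EV ((y, \<eta>) # (x, \<xi>) # L) = EV L * (1 - fps_X * fps_const (sc (x + y)) + fps_X * (fps_X * fps_const (sc (x * y) - \<xi> * \<eta>)))
       + OV L * (fps_X * fps_const (\<xi> + \<eta>) + fps_X * (fps_X * fps_const (sc x * \<eta> - sc y * \<xi>)))"
      unfolding EV_step OV_step k by (rule st(1))
    show "OV ((y, \<eta>) # (x, \<xi>) # L) = OV L * (1 + fps_X * fps_const (sc (x + y)) + fps_X * (fps_X * fps_const (sc (x * y) - \<xi> * \<eta>)))
       - EV L * (fps_X * fps_const (\<xi> + \<eta>) - fps_X * (fps_X * fps_const (sc x * \<eta> - sc y * \<xi>)))"
      unfolding EV_step OV_step k by (rule st(2))
  qed
  show "EV ((a, \<beta>') # (b, \<alpha>') # L) = EV ((b, \<beta>) # (a, \<alpha>) # L)" "OV ((a, \<beta>') # (b, \<alpha>') # L) = OV ((b, \<beta>) # (a, \<alpha>) # L)"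
    unfolding two a'b' sum dif add.commute[of b a] mult.commute[of b a] by (rule refl)+
  have in1: "\<alpha>' \<in> vs.span (insert \<beta> (insert \<alpha> S))" "\<beta>' \<in> vs.span (insert \<beta> (insert \<alpha> S))"
  proof -
    have m: "\<alpha> \<in> vs.span (insert \<beta> (insert \<alpha> S))" "\<beta> \<in> vs.span (insert \<beta> (insert \<alpha> S))"
      by (rule vs.span_base, simp)+
    show "\<alpha>' \<in> vs.span (insert \<beta> (insert \<alpha> S))" "\<beta>' \<in> vs.span (insert \<beta> (insert \<alpha> S))"
      unfolding \<alpha>'_def \<beta>'_def by (intro vs.span_add vs.span_scale m)+
  qed
  have m': "\<alpha>' \<in> vs.span (insert \<beta>' (insert \<alpha>' S))" "\<beta>' \<in> vs.span (insert \<beta>' (insert \<alpha>' S))"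
    by (rule vs.span_base, simp)+
  have inv1: "sc (2 * a / (a + b)) * \<alpha>' - sc ((b - a) / (a + b)) * \<beta>' = \<alpha>"
  proof -
    have "sc (2 * a / (a + b)) * \<alpha>' - sc ((b - a) / (a + b)) * \<beta>' =
      sc (2 * b / (a + b) * (2 * a / (a + b)) - (b - a) / (a + b) * ((a - b) / (a + b))) * \<alpha>
      + sc (2 * a / (a + b) * ((b - a) / (a + b)) - (b - a) / (a + b) * (2 * a / (a + b))) * \<beta>"
      unfolding \<alpha>'_def \<beta>'_def sc_diff by (simp add: algebra_simps)
    then show ?thesis unfolding f4 by (simp add: mult.commute)
  qed
  have in2: "\<alpha> \<in> vs.span (insert \<beta>' (insert \<alpha>' S))"
    using vs.span_diff[OF vs.span_scale[OF m'(1)] vs.span_scale[OF m'(2)], of "2 * a / (a + b)" "(b - a) / (a + b)"]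
    unfolding inv1 .
  have "\<beta> = (\<alpha>' + \<beta>') - \<alpha>" using sum by simp
  then have in3: "\<beta> \<in> vs.span (insert \<beta>' (insert \<alpha>' S))"
    using vs.span_diff[OF vs.span_add[OF m'] in2] by simp
  show "vs.span (insert \<beta>' (insert \<alpha>' S)) = vs.span (insert \<beta> (insert \<alpha> S))"
    by (intro subset_antisym vs.span_minimal vs.subspace_span subsetI) (use in1 in2 in3 in \<open>auto intro: vs.span_base\<close>)
qed

lemma anti_span:
  assumes "\<forall>\<eta>\<in>S. \<xi> * \<eta> = - (\<eta> * \<xi>)" "y \<in> vs.span S"
  shows "\<xi> * y = - (y * \<xi>)"
  using assms(2)
proof (rule vs.span_induct)
  show "vs.subspace {y. \<xi> * y = - (y * \<xi>)}"
    by (auto simp: vs.subspace_def algebra_simps sc_left_comm[of \<xi>])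
qed (use assms(1) in blast)

text \<open>The tail enters the longer series only through its own \<open>EV\<close> and
  \<open>OV\<close>, and anticommutation with the head depends only on the span of its
  generators.\<close>

lemma Cons_replace:
  assumes c: "clif ((x, \<xi>) # L)" and L': "clif L'" "EV L' = EV L" "OV L' = OV L" "vs.span (snd ` set L') = vs.span (snd ` set L)"
  shows "clif ((x, \<xi>) # L')" "EV ((x, \<xi>) # L') = EV ((x, \<xi>) # L)" "OV ((x, \<xi>) # L') = OV ((x, \<xi>) # L)"
    "vs.span (snd ` set ((x, \<xi>) # L')) = vs.span (snd ` set ((x, \<xi>) # L))"
proof -
  have an: "\<forall>\<eta>\<in>snd ` set L. \<xi> * \<eta> = - (\<eta> * \<xi>)" and xx: "\<xi> * \<xi> = sc x" using c by auto
  have "\<forall>\<eta>\<in>snd ` set L'. \<xi> * \<eta> = - (\<eta> * \<xi>)"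
  proof
    fix \<eta> assume "\<eta> \<in> snd ` set L'"
    then have "\<eta> \<in> vs.span (snd ` set L)" using L'(4) vs.span_base by blast
    then show "\<xi> * \<eta> = - (\<eta> * \<xi>)" by (rule anti_span[OF an])
  qed
  then show "clif ((x, \<xi>) # L')" using xx L'(1) by simp
  show "EV ((x, \<xi>) # L') = EV ((x, \<xi>) # L)" "OV ((x, \<xi>) # L') = OV ((x, \<xi>) # L)"
    unfolding EV_step OV_step L' by (rule refl)+
  show "vs.span (snd ` set ((x, \<xi>) # L')) = vs.span (snd ` set ((x, \<xi>) # L))"
    by (simp only: list.set image_insert snd_conv vs.span_insert L'(4))
qed

text \<open>The weight \<open>y\<close> passes each weight of \<open>L1\<close> by an adjacent
  exchange, for which its sum with that weight must be nonzero. The generators change, but their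
  span and the two series do not.\<close>

lemma bring_to_front:
  assumes "clif (L1 @ (y, \<eta>) # L2)" "\<forall>x\<in>fst ` set L1. x + y \<noteq> 0"
  shows "\<exists>\<eta>' L. map fst L = map fst (L1 @ L2) \<and> clif ((y, \<eta>') # L) \<and> EV ((y, \<eta>') # L) = EV (L1 @ (y, \<eta>) # L2)
    \<and> OV ((y, \<eta>') # L) = OV (L1 @ (y, \<eta>) # L2) \<and> vs.span (snd ` set ((y, \<eta>') # L)) = vs.span (snd ` set (L1 @ (y, \<eta>) # L2))"
  using assms
proof (induction L1)
  case Nil
  then show ?case by (intro exI[of _ \<eta>] exI[of _ L2]) simp
next
  case (Cons a L1)
  obtain x \<xi> where a: "a = (x, \<xi>)" by force
  have c: "clif ((x, \<xi>) # (L1 @ (y, \<eta>) # L2))" using Cons.prems(1) by (simp add: a)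
  then have "clif (L1 @ (y, \<eta>) # L2)" by simp
  then obtain \<eta>' L where IH: "map fst L = map fst (L1 @ L2)" "clif ((y, \<eta>') # L)" "EV ((y, \<eta>') # L) = EV (L1 @ (y, \<eta>) # L2)"
    "OV ((y, \<eta>') # L) = OV (L1 @ (y, \<eta>) # L2)" "vs.span (snd ` set ((y, \<eta>') # L)) = vs.span (snd ` set (L1 @ (y, \<eta>) # L2))"
    using Cons.IH Cons.prems(2) by (auto simp del: clif.simps)
  note R = Cons_replace[OF c IH(2-5)]
  have xy: "y + x \<noteq> 0" using Cons.prems(2) by (simp add: a add.commute)
  define \<eta>'' where "\<eta>'' = sc (2 * x / (y + x)) * \<eta>' + sc ((x - y) / (y + x)) * \<xi>"
  define \<xi>'' where "\<xi>'' = sc ((y - x) / (y + x)) * \<eta>' + sc (2 * y / (y + x)) * \<xi>"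
  note Sw = swap_generators[OF R(1) xy, folded \<eta>''_def \<xi>''_def]
  show ?case unfolding a
    by (rule exI[of _ \<xi>''], rule exI[of _ "(x, \<eta>'') # L"])
      (use R IH(1) Sw(1-3) Sw(4)[of "snd ` set L"] in \<open>simp del: clif.simps\<close>)
qed

lemma clif_permute:
  assumes "clif L" "\<forall>x\<in>fst ` set L. \<forall>y\<in>fst ` set L. x + y \<noteq> 0" "mset t = mset (map fst L)"
  shows "\<exists>L'. map fst L' = t \<and> clif L' \<and> EV L' = EV L \<and> OV L' = OV L \<and> vs.span (snd ` set L') = vs.span (snd ` set L)"
  using assms
proof (induction t arbitrary: L)
  case Nil
  then show ?case by (intro exI[of _ "[]"]) simp
next
  case (Cons y t)
  have "y \<in> set (map fst L)" using Cons.prems(3) by (metis list.set_intros(1) mset_eq_setD)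
  then obtain \<eta> where "(y, \<eta>) \<in> set L" by auto
  then obtain L1 L2 where L: "L = L1 @ (y, \<eta>) # L2" by (meson split_list)
  obtain \<eta>' L0 where F: "map fst L0 = map fst (L1 @ L2)" "clif ((y, \<eta>') # L0)" "EV ((y, \<eta>') # L0) = EV L"
    "OV ((y, \<eta>') # L0) = OV L" "vs.span (snd ` set ((y, \<eta>') # L0)) = vs.span (snd ` set L)"
    using bring_to_front[of L1 y \<eta> L2] Cons.prems(1,2) unfolding L by (auto simp del: clif.simps)
  have m: "mset t = mset (map fst L0)" using Cons.prems(3) unfolding F(1) L by simp
  have sub: "fst ` set L0 \<subseteq> fst ` set L" using arg_cong[OF F(1), of set] unfolding L by auto
  have "clif L0" using F(2) by simp
  moreover have "\<forall>x\<in>fst ` set L0. \<forall>y\<in>fst ` set L0. x + y \<noteq> 0" using Cons.prems(2) sub by blast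
  ultimately obtain L' where L': "map fst L' = t" "clif L'" "EV L' = EV L0" "OV L' = OV L0" "vs.span (snd ` set L') = vs.span (snd ` set L0)"
    using Cons.IH[OF _ _ m] by blast
  note R = Cons_replace[OF F(2) L'(2-5)]
  show ?case
    by (rule exI[of _ "(y, \<eta>') # L'"]) (use R F L'(1) in \<open>simp del: clif.simps\<close>)
qed

end

section \<open>Isomorphisms\<close>

text \<open>An intertwiner is corrected for one generator at a time, starting from \<open>p\<close>.
  The condition \<open>z * p = z\<close> keeps it supported on the image of \<open>p\<close>, so
  that in the application a nonzero operator is seen on a finite-dimensional block.\<close>

lemma (in calg) clifford_intertwiner:
  fixes n j :: nat
  assumes X: "\<And>i. i < n \<Longrightarrow> X i * X i = sc (c i)" "\<And>i j. i < n \<Longrightarrow> j < n \<Longrightarrow> i \<noteq> j \<Longrightarrow> X i * X j = - (X j * X i)"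
    and Y: "\<And>i. i < n \<Longrightarrow> Y i * Y i = sc (c i)" "\<And>i j. i < n \<Longrightarrow> j < n \<Longrightarrow> i \<noteq> j \<Longrightarrow> Y i * Y j = - (Y j * Y i)"
    and c: "\<And>i. i < n \<Longrightarrow> c i \<noteq> 0" and g: "\<gamma> * \<gamma> = 1" "\<And>i. i < n \<Longrightarrow> \<gamma> * X i = - (X i * \<gamma>)"
    and p: "p * p = p" "p \<noteq> 0" "p * \<gamma> = \<gamma> * p" "\<And>i. i < n \<Longrightarrow> p * X i = X i * p"
  shows "j \<le> n \<Longrightarrow> \<exists>z. z \<noteq> 0 \<and> z * p = z \<and> (\<forall>i<j. z * X i = Y i * z)"
proof (induction j)
  case 0
  then show ?case using p by (intro exI[of _ p]) simp
next
  case (Suc j)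
  then obtain z where z: "z \<noteq> 0" "z * p = z" "\<And>i. i < j \<Longrightarrow> z * X i = Y i * z" by auto
  have j: "j < n" using Suc.prems by simp
  \<comment> \<open>Since X_j has inverse X_j / c_j, this is c_j times the average-type sum of
    \<open>z\<close> and Y_j z X_j^{-1}.\<close>
  define y where "y = sc (c j) * z + Y j * (z * X j)"
  show ?case
  proof (cases "y = 0")
    case False
    have "y * p = y"
      unfolding y_def using z(2) p(4)[OF j] by (simp add: distrib_right mult.assoc) (metis mult.assoc)
    moreover have "y * X i = Y i * y" if i: "i < Suc j" for i
    proof (cases "i = j")
      case True
      have 1: "z * X j * X j = sc (c j) * z" using X(1)[OF j] by (simp add: mult.assoc sc_comm)
      have 2: "Y j * (Y j * (z * X j)) = sc (c j) * (z * X j)" using Y(1)[OF j] by (simp flip: mult.assoc)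
      have "y * X j = sc (c j) * (z * X j) + Y j * (z * X j * X j)" unfolding y_def by (simp add: distrib_right mult.assoc)
      also have "\<dots> = sc (c j) * (z * X j) + sc (c j) * (Y j * z)" unfolding 1 sc_left_comm[of "Y j"] ..
      also have "\<dots> = Y j * y" unfolding y_def distrib_left 2 sc_left_comm[of "Y j"] by (rule add.commute)
      finally show ?thesis using True by simp
    next
      case False
      then have ij: "i < j" "i < n" using i j by auto
      have "Y j * (z * X j) * X i = Y j * (z * (X j * X i))" by (simp add: mult.assoc)
      also have "\<dots> = - (Y j * (z * X i * X j))" using X(2)[OF j ij(2)] ij by (simp add: mult.assoc)
      also have "\<dots> = - (Y j * Y i * (z * X j))" unfolding z(3)[OF ij(1)] by (simp add: mult.assoc)
      also have "\<dots> = Y i * (Y j * (z * X j))" using Y(2)[OF j ij(2)] ij by (simp add: mult.assoc)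
      finally show ?thesis unfolding y_def using z(3)[OF ij(1)]
        by (simp add: distrib_left distrib_right mult.assoc sc_left_comm[of "Y i"])
    qed
    ultimately show ?thesis using False by (intro exI[of _ y]) blast
  next
    case True
    then have yz: "Y j * (z * X j) = - (sc (c j) * z)" unfolding y_def by (simp add: eq_neg_iff_add_eq_0 add.commute)
    have "sc (c j) * (Y j * z) = Y j * (z * X j) * X j"
      using X(1)[OF j] by (simp add: mult.assoc sc_comm[of "z"] sc_left_comm[of "Y j"])
    also have "\<dots> = sc (c j) * - (z * X j)" unfolding yz by (simp add: mult.assoc)
    finally have anti: "Y j * z = - (z * X j)" using c[OF j] vs.scale_cancel_left[of "c j"] by blast
    \<comment> \<open>When the average vanishes, \<open>z\<close> intertwines the j-th generators up
      to a sign. The grading operator \<gamma> repairs that sign, and the extra factor X_j keeps the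
      relations for earlier generators.\<close>
    define u where "u = z * \<gamma> * X j"
    have "u * X j * \<gamma> = sc (c j) * z"
      unfolding u_def using X(1)[OF j] g(1) by (simp add: mult.assoc sc_comm[of z] sc_left_comm[of z] sc_left_comm[of \<gamma>])
    moreover have "sc (c j) * z \<noteq> 0" using c[OF j] z(1) by simp
    ultimately have "u \<noteq> 0" by auto
    moreover have "u * p = u"
    proof -
      have "u * p = z * p * \<gamma> * X j" unfolding u_def using p(3) p(4)[OF j] by (metis mult.assoc)
      then show ?thesis unfolding u_def z(2) .
    qed
    moreover have "u * X i = Y i * u" if i: "i < Suc j" for i
    proof (cases "i = j")
      case True
      have "Y j * u = - (z * (X j * \<gamma>) * X j)" unfolding u_def by (simp add: anti flip: mult.assoc)
      also have "\<dots> = u * X j" unfolding u_def using g(2)[OF j] by (simp add: mult.assoc)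
      finally show ?thesis using True by simp
    next
      case False
      then have ij: "i < j" "i < n" using i j by auto
      have "Y i * u = z * (X i * \<gamma>) * X j" unfolding u_def by (simp add: z(3)[OF ij(1)] flip: mult.assoc)
      also have "\<dots> = - (z * \<gamma> * (X i * X j))" using g(2)[OF ij(2)] by (metis (no_types) minus_minus minus_mult_left minus_mult_right mult.assoc)
      also have "\<dots> = u * X i" unfolding u_def using X(2)[OF ij(2) j] ij by (simp add: mult.assoc)
      finally show ?thesis by simp
    qed
    ultimately show ?thesis by (intro exI[of _ u]) blast
  qed
qed

lemma lapp_sum_fun: "lapp t (\<lambda>k. \<Sum>c\<in>S. f c k) = (\<lambda>k. \<Sum>c\<in>S. lapp t (f c) k)"
  by (induction S rule: infinite_finite_induct) (simp_all add: lapp_zero lapp_add)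

lemma lapp_ext_expand:
  assumes N: "N > 0" and v: "v \<in> carrier_vec N"
  shows "lapp t (ext v) = (\<lambda>k. \<Sum>c<N. vec_index v c * lapp t (ext (unit_vec N c)) k)"
proof -
  have "ext v = (\<lambda>k. \<Sum>c<N. vec_index v c * ext (unit_vec N c) k)"
  proof
    fix k
    have "(\<Sum>c<N. vec_index v c * ext (unit_vec N c) k) = (\<Sum>c<N. if c = k then vec_index v c else 0)"
      by (intro sum.cong refl) (auto simp: ext_def[OF N])
    then show "ext v k = (\<Sum>c<N. vec_index v c * ext (unit_vec N c) k)" using v by (simp add: ext_def[OF N])
  qed
  then have "lapp t (ext v) = lapp t (\<lambda>k. \<Sum>c<N. vec_index v c * ext (unit_vec N c) k)" by simp
  then show ?thesis unfolding lapp_sum_fun lapp_scale .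
qed

text \<open>Projection to block 0. It commutes with all embedded matrices and serves as
  \<open>p\<close> for the intertwiner.\<close>

definition fstproj :: "nat \<Rightarrow> lop" where
  "fstproj N = Lop (\<lambda>x k. if k < N then x k else 0)"

lemma lapp_fstproj: "lapp (fstproj N) = (\<lambda>x k. if k < N then x k else 0)"
  unfolding fstproj_def by (rule lapp_Lop) auto

lemma fstproj_comm:
  assumes N: "N > 0"
  shows "fstproj N * emb N A = emb N A * fstproj N"
proof (rule lop_eqI)
  fix x k
  have "k div N * N + j < N \<longleftrightarrow> k < N" if "j < N" for j
  proof (cases "k < N")
    case False
    then have "k div N \<ge> 1" using N by (simp add: div_greater_zero_iff Suc_le_eq)
    then have "k div N * N \<ge> N" by simp
    then show ?thesis using False by linarith
  qed (use that in simp)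
  then show "lapp (fstproj N * emb N A) x k = lapp (emb N A * fstproj N) x k"
    unfolding lapp_simps lapp_fstproj lapp_emb by (auto intro!: sum.cong)
qed

definition hcomp :: "nat \<Rightarrow> nat \<Rightarrow> (nat \<Rightarrow> bool) \<Rightarrow> (nat \<Rightarrow> bool) \<Rightarrow> bool \<Rightarrow> complex mat \<Rightarrow> complex mat" where
  "hcomp N' N pr' pr b T = mat N' N (\<lambda>(a, c). if (pr' a = pr c) = b then T $$ (a, c) else 0)"

lemma simple_h_module_pos: "simple_h_module s H \<Longrightarrow> hdim H > 0"
  unfolding simple_h_module_def simple_graded_def by blast

lemma simple_h_module_carrier: "simple_h_module s H \<Longrightarrow> i < length s \<Longrightarrow> xi H i \<in> carrier_mat (hdim H) (hdim H)"
  unfolding simple_h_module_def homog_def by blast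

lemma h_module_emb:
  assumes G: "simple_h_module s G" and i: "i < length s"
  shows "emb (hdim G) (xi G i) * emb (hdim G) (xi G i) = scl (s ! i)"
    and "j < length s \<Longrightarrow> i \<noteq> j \<Longrightarrow> emb (hdim G) (xi G i) * emb (hdim G) (xi G j) = - (emb (hdim G) (xi G j) * emb (hdim G) (xi G i))"
proof -
  let ?M = "hdim G"
  note M = simple_h_module_pos[OF G] and cc = simple_h_module_carrier[OF G]
  have "xi G i * xi G i = (s ! i) \<cdot>\<^sub>m 1\<^sub>m ?M" using G i unfolding simple_h_module_def by blast
  then have "emb ?M (xi G i * xi G i) = scl (s ! i)" by (simp add: emb_smult[OF M] emb_one[OF M])
  then show "emb ?M (xi G i) * emb ?M (xi G i) = scl (s ! i)" unfolding emb_mult[OF M cc[OF i] cc[OF i]] .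
  show "emb ?M (xi G i) * emb ?M (xi G j) = - (emb ?M (xi G j) * emb ?M (xi G i))" if j: "j < length s" "i \<noteq> j"
  proof -
    have "xi G i * xi G j + xi G j * xi G i = 0\<^sub>m ?M ?M" using G i j unfolding simple_h_module_def by blast
    then have "emb ?M (xi G i * xi G j + xi G j * xi G i) = 0" by (simp add: emb_zero[OF M])
    moreover have "emb ?M (xi G i * xi G j + xi G j * xi G i) = emb ?M (xi G i * xi G j) + emb ?M (xi G j * xi G i)"
      by (rule emb_add[OF M]) (use cc[OF i] cc[OF j(1)] in auto)
    ultimately show ?thesis
      unfolding emb_mult[OF M cc[OF i] cc[OF j(1)]] emb_mult[OF M cc[OF j(1)] cc[OF i]] by (simp add: eq_neg_iff_add_eq_0)
  qed
qed

lemma simple_h_module_intertwiner: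
  assumes H: "simple_h_module s H" and H': "simple_h_module s H'" and reg: "regular s"
  shows "\<exists>T b. T \<in> carrier_mat (hdim H') (hdim H) \<and> T \<noteq> 0\<^sub>m (hdim H') (hdim H)
    \<and> (\<forall>a<hdim H'. \<forall>c<hdim H. T $$ (a, c) \<noteq> 0 \<longrightarrow> (hpar H' a = hpar H c) = b)
    \<and> (\<forall>i<length s. T * xi H i = xi H' i * T)"
proof -
  let ?N = "hdim H" and ?N' = "hdim H'" and ?n = "length s"
  have N: "?N > 0" and N': "?N' > 0" using H H' unfolding simple_h_module_def simple_graded_def by blast+
  have hX: "homog ?N (hpar H) True (xi H i)" and hY: "homog ?N' (hpar H') True (xi H' i)" if "i < ?n" for i
    using H H' that unfolding simple_h_module_def by blast+
  have cX: "xi H i \<in> carrier_mat ?N ?N" and cY: "xi H' i \<in> carrier_mat ?N' ?N'" if "i < ?n" for i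
    using homog_carrier[OF N hX[OF that]] homog_carrier[OF N' hY[OF that]] .
  \<comment> \<open>The parity operator, which plays the part of \<gamma>: it squares to 1 and
    anticommutes with odd matrices.\<close>
  define Gm where "Gm = mat ?N ?N (\<lambda>(a, c). if a = c then (if hpar H a then - 1 else 1 :: complex) else 0)"
  have cG: "Gm \<in> carrier_mat ?N ?N" by (simp add: Gm_def)
  have Gl: "(Gm * A) $$ (a, c) = (if hpar H a then - 1 else 1) * A $$ (a, c)" "(A * Gm) $$ (a, c) = (if hpar H c then - 1 else 1) * A $$ (a, c)"
    if A: "A \<in> carrier_mat ?N ?N" and ac: "a < ?N" "c < ?N" for A a c
  proof -
    have "(Gm * A) $$ (a, c) = (\<Sum>k<?N. Gm $$ (a, k) * A $$ (k, c))"
      using A ac cG by (simp add: scalar_prod_def lessThan_atLeast0)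
    also have "\<dots> = (\<Sum>k<?N. if k = a then (if hpar H a then - 1 else 1) * A $$ (a, c) else 0)"
      using ac by (intro sum.cong refl) (auto simp: Gm_def)
    finally show "(Gm * A) $$ (a, c) = (if hpar H a then - 1 else 1) * A $$ (a, c)" using ac by simp
    have "(A * Gm) $$ (a, c) = (\<Sum>k<?N. A $$ (a, k) * Gm $$ (k, c))"
      using A ac cG by (simp add: scalar_prod_def lessThan_atLeast0)
    also have "\<dots> = (\<Sum>k<?N. if k = c then (if hpar H c then - 1 else 1) * A $$ (a, c) else 0)"
      using ac by (intro sum.cong refl) (auto simp: Gm_def)
    finally show "(A * Gm) $$ (a, c) = (if hpar H c then - 1 else 1) * A $$ (a, c)" using ac by simp
  qed
  have "Gm * Gm = 1\<^sub>m ?N"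
  proof (rule eq_matI)
    fix a c assume "a < dim_row (1\<^sub>m ?N :: complex mat)" "c < dim_col (1\<^sub>m ?N :: complex mat)"
    then have ac: "a < ?N" "c < ?N" by auto
    show "(Gm * Gm) $$ (a, c) = 1\<^sub>m ?N $$ (a, c)" unfolding Gl(1)[OF cG ac] using ac by (simp add: Gm_def)
  qed (use cG in auto)
  then have gg: "emb ?N Gm * emb ?N Gm = 1" using emb_mult[OF N cG cG] by (simp add: emb_one[OF N])
  have gX: "emb ?N Gm * emb ?N (xi H i) = - (emb ?N (xi H i) * emb ?N Gm)" if i: "i < ?n" for i
  proof -
    have "Gm * xi H i = - (xi H i * Gm)"
    proof (rule eq_matI)
      fix a c assume "a < dim_row (- (xi H i * Gm))" "c < dim_col (- (xi H i * Gm))"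
      then have ac: "a < ?N" "c < ?N" using cX[OF i] cG by auto
      have "(xi H i * Gm) $$ (a, c) = (if hpar H c then - 1 else 1) * xi H i $$ (a, c)" by (rule Gl(2)[OF cX[OF i] ac])
      moreover have "(Gm * xi H i) $$ (a, c) = (if hpar H a then - 1 else 1) * xi H i $$ (a, c)" by (rule Gl(1)[OF cX[OF i] ac])
      moreover have "xi H i $$ (a, c) \<noteq> 0 \<Longrightarrow> hpar H a \<noteq> hpar H c" using hX[OF i] ac unfolding homog_def by auto
      moreover have "(- (xi H i * Gm)) $$ (a, c) = - ((xi H i * Gm) $$ (a, c))" using ac cX[OF i] cG by (intro index_uminus_mat) auto
      ultimately show "(Gm * xi H i) $$ (a, c) = (- (xi H i * Gm)) $$ (a, c)" by (cases "xi H i $$ (a, c) = 0") auto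
    qed (use cX[OF i] cG in auto)
    then have "emb ?N (Gm * xi H i) = emb ?N (- (xi H i * Gm))" by simp
    then show ?thesis using cX[OF i] cG by (simp add: emb_mult[OF N] emb_uminus[OF N, of "xi H i * Gm"])
  qed
  have p0: "fstproj ?N \<noteq> 0"
  proof
    assume "fstproj ?N = 0"
    then have "lapp (fstproj ?N) (\<lambda>k. 1) 0 = lapp 0 (\<lambda>k. 1) 0" by simp
    then show False using N by (simp add: lapp_fstproj lapp_simps)
  qed
  have pp: "fstproj ?N * fstproj ?N = fstproj ?N" by (rule lop_eqI) (simp add: lapp_fstproj lapp_simps)
  have "\<exists>z. z \<noteq> 0 \<and> z * fstproj ?N = z \<and> (\<forall>i<?n. z * emb ?N (xi H i) = emb ?N' (xi H' i) * z)"
  proof (rule op.clifford_intertwiner[where X = "\<lambda>i. emb ?N (xi H i)" and Y = "\<lambda>i. emb ?N' (xi H' i)" and c = "\<lambda>i. s ! i"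
        and \<gamma> = "emb ?N Gm" and n = ?n])
    show "s ! i \<noteq> 0" if "i < ?n" for i using reg that unfolding regular_def by blast
    show "emb ?N (xi H i) * emb ?N (xi H i) = scl (s ! i)" "emb ?N' (xi H' i) * emb ?N' (xi H' i) = scl (s ! i)" if "i < ?n" for i
      by (rule h_module_emb(1)[OF H that], rule h_module_emb(1)[OF H' that])
    show "emb ?N (xi H i) * emb ?N (xi H j) = - (emb ?N (xi H j) * emb ?N (xi H i))"
      "emb ?N' (xi H' i) * emb ?N' (xi H' j) = - (emb ?N' (xi H' j) * emb ?N' (xi H' i))" if "i < ?n" "j < ?n" "i \<noteq> j" for i j
      by (rule h_module_emb(2)[OF H that], rule h_module_emb(2)[OF H' that])
    show "emb ?N Gm * emb ?N (xi H i) = - (emb ?N (xi H i) * emb ?N Gm)" if "i < ?n" for i by (rule gX[OF that])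
  qed (fact gg pp p0 order_refl | rule fstproj_comm[OF N])+
  then obtain z where z: "z \<noteq> 0" "z * fstproj ?N = z" "\<And>i. i < ?n \<Longrightarrow> z * emb ?N (xi H i) = emb ?N' (xi H' i) * z" by blast
  have "\<exists>b k. b < ?N \<and> lapp z (ext (unit_vec ?N b)) k \<noteq> 0"
  proof (rule ccontr)
    assume no: "\<not> ?thesis"
    have "lapp z x k = 0" for x k
    proof -
      have "lapp z x = lapp z (lapp (fstproj ?N) x)" using arg_cong[OF z(2), of "\<lambda>t. lapp t x"] by (simp add: lapp_simps)
      also have "lapp (fstproj ?N) x = ext (vec ?N x)" unfolding lapp_fstproj ext_def[OF N] by auto
      also have "lapp z (ext (vec ?N x)) = (\<lambda>k. \<Sum>c<?N. vec_index (vec ?N x) c * lapp z (ext (unit_vec ?N c)) k)"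
        by (rule lapp_ext_expand[OF N]) simp
      finally show ?thesis using no by simp
    qed
    then have "z = 0" by (intro lop_eqI) (simp add: lapp_simps)
    then show False using z(1) by simp
  qed
  then obtain b0 k0 where b0: "b0 < ?N" "lapp z (ext (unit_vec ?N b0)) k0 \<noteq> 0" by blast
  \<comment> \<open>The output is cut to the block containing \<open>k0\<close>, where
    \<open>z\<close> has a nonzero entry. Embedded matrices act blockwise, so the cut still
    intertwines.\<close>
  define q where "q = k0 div ?N' * ?N'"
  define T where "T = mat ?N' ?N (\<lambda>(a, c). lapp z (ext (unit_vec ?N c)) (q + a))"
  have cT: "T \<in> carrier_mat ?N' ?N" by (simp add: T_def)
  have qdiv: "(q + a) mod ?N' = a" "(q + a) div ?N' * ?N' = q" if "a < ?N'" for a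
    using that N' unfolding q_def by simp_all
  have Tnz: "T $$ (k0 mod ?N', b0) \<noteq> 0" using b0 N' unfolding T_def q_def by simp
  have ent: "(T * xi H i) $$ (a, c) = (\<Sum>k<?N. T $$ (a, k) * xi H i $$ (k, c))"
    "(xi H' i * T) $$ (a, c) = (\<Sum>k<?N'. xi H' i $$ (a, k) * T $$ (k, c))" if "a < ?N'" "c < ?N" "i < ?n" for a c i
    using that cX[OF that(3)] cY[OF that(3)] cT by (simp_all add: scalar_prod_def lessThan_atLeast0)
  have Tint: "(\<Sum>k<?N. T $$ (a, k) * xi H i $$ (k, c)) = (\<Sum>k<?N'. xi H' i $$ (a, k) * T $$ (k, c))"
    if ac: "a < ?N'" "c < ?N" and i: "i < ?n" for a c i
  proof -
    have "lapp (z * emb ?N (xi H i)) (ext (unit_vec ?N c)) (q + a) = (\<Sum>k<?N. T $$ (a, k) * xi H i $$ (k, c))"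
    proof -
      have cv: "xi H i *\<^sub>v unit_vec ?N c \<in> carrier_vec ?N" using cX[OF i] by simp
      have "lapp (z * emb ?N (xi H i)) (ext (unit_vec ?N c)) = lapp z (ext (xi H i *\<^sub>v unit_vec ?N c))"
        by (simp add: lapp_simps lapp_emb_ext[OF N cX[OF i]])
      then show ?thesis unfolding lapp_ext_expand[OF N cv] using cX[OF i] ac
        by (auto simp: T_def mult.commute intro!: sum.cong)
    qed
    moreover have "lapp (emb ?N' (xi H' i) * z) (ext (unit_vec ?N c)) (q + a) = (\<Sum>k<?N'. xi H' i $$ (a, k) * T $$ (k, c))"
      unfolding lapp_simps lapp_emb using ac qdiv[OF ac(1)] by (simp add: T_def)
    ultimately show ?thesis using z(3)[OF i] by simp
  qed
  define b where "b = (hpar H' (k0 mod ?N') = hpar H b0)"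
  \<comment> \<open>The generators are odd on both sides, so each homogeneous component of
    \<open>T\<close> intertwines; the one containing the nonzero entry is chosen.\<close>
  define S where "S = hcomp ?N' ?N (hpar H') (hpar H) b T"
  have cS: "S \<in> carrier_mat ?N' ?N" by (simp add: S_def hcomp_def)
  have S_ent: "S $$ (a, c) = (if (hpar H' a = hpar H c) = b then T $$ (a, c) else 0)" if "a < ?N'" "c < ?N" for a c
    using that by (simp add: S_def hcomp_def)
  have "S $$ (k0 mod ?N', b0) \<noteq> 0" using Tnz b0 N' by (simp add: S_ent b_def)
  then have "S \<noteq> 0\<^sub>m ?N' ?N" using b0 N' by auto
  moreover have "S * xi H i = xi H' i * S" if i: "i < ?n" for i
  proof (rule eq_matI)
    fix a c assume "a < dim_row (xi H' i * S)" "c < dim_col (xi H' i * S)"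
    then have ac: "a < ?N'" "c < ?N" using cY[OF i] cS by auto
    have "(S * xi H i) $$ (a, c) = (\<Sum>k<?N. S $$ (a, k) * xi H i $$ (k, c))"
      using ac cX[OF i] cS by (simp add: scalar_prod_def lessThan_atLeast0)
    also have "\<dots> = (\<Sum>k<?N. if (hpar H' a = hpar H c) \<noteq> b then T $$ (a, k) * xi H i $$ (k, c) else 0)"
      using ac hX[OF i] unfolding homog_def by (intro sum.cong refl) (auto simp: S_ent)
    also have "\<dots> = (if (hpar H' a = hpar H c) \<noteq> b then (\<Sum>k<?N. T $$ (a, k) * xi H i $$ (k, c)) else 0)" by simp
    also have "\<dots> = (if (hpar H' a = hpar H c) \<noteq> b then (\<Sum>k<?N'. xi H' i $$ (a, k) * T $$ (k, c)) else 0)"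
      by (simp only: Tint[OF ac i])
    also have "\<dots> = (\<Sum>k<?N'. if (hpar H' a = hpar H c) \<noteq> b then xi H' i $$ (a, k) * T $$ (k, c) else 0)" by simp
    also have "\<dots> = (\<Sum>k<?N'. xi H' i $$ (a, k) * S $$ (k, c))"
      using ac hY[OF i] unfolding homog_def by (intro sum.cong refl) (auto simp: S_ent)
    also have "\<dots> = (xi H' i * S) $$ (a, c)"
      using ac cY[OF i] cS by (simp add: scalar_prod_def lessThan_atLeast0)
    finally show "(S * xi H i) $$ (a, c) = (xi H' i * S) $$ (a, c)" .
  qed (use cX[OF i] cY[OF i] cS in auto)
  moreover have "\<forall>a<?N'. \<forall>c<?N. S $$ (a, c) \<noteq> 0 \<longrightarrow> (hpar H' a = hpar H c) = b" by (simp add: S_ent)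
  ultimately show ?thesis using cS by blast
qed

lemma length_hL: "length (hL s H) = length s"
  by (simp add: hL_def)

lemma map_fst_hL: "map fst (hL s H) = rev s"
  by (simp add: hL_def rev_map[symmetric] o_def map_nth)

lemma hL_nth: "k < length s \<Longrightarrow> hL s H ! k = (s ! (length s - Suc k), emb (hdim H) (xi H (length s - Suc k)))"
  using nth_upt[of 0 "length s - Suc k" "length s"] diff_less[of "Suc k" "length s"] by (simp add: hL_def rev_nth del: nth_upt)

lemma clif_hL:
  assumes "simple_h_module s H"
  shows "op.clif (hL s H)"
  unfolding op.clif_nth length_hL
proof (intro conjI allI impI)
  fix i assume i: "i < length s"
  then have "length s - Suc i < length s" by simp
  from h_module_emb(1)[OF assms this] show "snd (hL s H ! i) * snd (hL s H ! i) = scl (fst (hL s H ! i))"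
    by (simp add: hL_nth[OF i])
next
  fix i j assume ij: "i < length s" "j < length s" "i \<noteq> j"
  then have *: "length s - Suc i < length s" "length s - Suc j < length s" "length s - Suc i \<noteq> length s - Suc j" by auto
  from h_module_emb(2)[OF assms *] show "acomm (snd (hL s H ! i)) (snd (hL s H ! j)) = 0"
    unfolding hL_nth[OF ij(1)] hL_nth[OF ij(2)] snd_conv acomm_def by (simp only: eq_neg_iff_add_eq_0)
qed

lemma homog_mult_even_proj:
  assumes T: "T \<in> carrier_mat N' N" and b: "\<forall>a<N'. \<forall>c<N. T $$ (a, c) \<noteq> 0 \<longrightarrow> (pr' a = pr c) = b"
    and v: "v \<in> carrier_vec N" and a: "a < N'"
  shows "vec_index (T *\<^sub>v even_proj N pr v) a = (if pr' a = b then 0 else vec_index (T *\<^sub>v v) a)"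
proof -
  have e: "vec_index (T *\<^sub>v x) a = (\<Sum>c<N. T $$ (a, c) * vec_index x c)" if "x \<in> carrier_vec N" for x
    using T a that by (simp add: scalar_prod_def lessThan_atLeast0)
  have "vec_index (T *\<^sub>v even_proj N pr v) a = (\<Sum>c<N. if pr' a = b then 0 else T $$ (a, c) * vec_index v c)"
    unfolding e[OF even_proj_carrier] using b a by (intro sum.cong refl) (auto simp: even_proj_def)
  also have "\<dots> = (if pr' a = b then 0 else vec_index (T *\<^sub>v v) a)" using e[OF v] by simp
  finally show ?thesis .
qed

text \<open>For homogeneous \<open>T\<close>, kernel and image are graded invariant subspaces, so
  simplicity of the source makes \<open>T\<close> injective and simplicity of the target makes it
  surjective.\<close>

lemma intertwiner_invertible:
  assumes sX: "simple_graded N pr {X i | i. i < (n::nat)}" and sY: "simple_graded N' pr' {Y i | i. i < n}"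
    and X: "\<forall>i<n. X i \<in> carrier_mat N N" and Y: "\<forall>i<n. Y i \<in> carrier_mat N' N'"
    and T: "T \<in> carrier_mat N' N" "T \<noteq> 0\<^sub>m N' N" and b: "\<forall>a<N'. \<forall>c<N. T $$ (a, c) \<noteq> 0 \<longrightarrow> (pr' a = pr c) = b"
    and int: "\<forall>i<n. T * X i = Y i * T"
  shows "N' = N \<and> (\<exists>R\<in>carrier_mat N N'. T * R = 1\<^sub>m N' \<and> R * T = 1\<^sub>m N)"
proof -
  have Tv: "T *\<^sub>v x \<in> carrier_vec N'" if "x \<in> carrier_vec N" for x using T that by simp
  have Tadd: "T *\<^sub>v (x + y) = T *\<^sub>v x + T *\<^sub>v y" if "x \<in> carrier_vec N" "y \<in> carrier_vec N" for x y
    by (rule mult_add_distrib_mat_vec[OF T(1) that])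
  have Tsm: "T *\<^sub>v (c \<cdot>\<^sub>v x) = c \<cdot>\<^sub>v (T *\<^sub>v x)" if "x \<in> carrier_vec N" for c x
    by (rule mult_mat_vec[OF T(1) that])
  have Tdiff: "T *\<^sub>v (x - y) = T *\<^sub>v x - T *\<^sub>v y" if "x \<in> carrier_vec N" "y \<in> carrier_vec N" for x y
    by (rule mult_minus_distrib_mat_vec[OF T(1) that])
  have T0: "T *\<^sub>v 0\<^sub>v N = 0\<^sub>v N'" using T by (intro eq_vecI) (auto simp: scalar_prod_def)
  have Tint: "T *\<^sub>v (X i *\<^sub>v x) = Y i *\<^sub>v (T *\<^sub>v x)" if "x \<in> carrier_vec N" "i < n" for x i
    using int X Y T(1) that by (metis assoc_mult_mat_vec)
  define K where "K = {v \<in> carrier_vec N. T *\<^sub>v v = 0\<^sub>v N'}"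
  have "graded_inv_subspace N pr {X i | i. i < n} K"
    unfolding graded_inv_subspace_def
  proof (intro conjI ballI allI)
    show "K \<subseteq> carrier_vec N" unfolding K_def by blast
    show "0\<^sub>v N \<in> K" unfolding K_def using T0 by simp
    show "x + y \<in> K" if "x \<in> K" "y \<in> K" for x y using that unfolding K_def by (simp add: Tadd)
    show "c \<cdot>\<^sub>v x \<in> K" if "x \<in> K" for c x
    proof -
      have "c \<cdot>\<^sub>v 0\<^sub>v N' = (0\<^sub>v N' :: complex vec)" by (intro eq_vecI) auto
      then show ?thesis using that unfolding K_def by (simp add: Tsm)
    qed
    show "even_proj N pr x \<in> K" if "x \<in> K" for x
    proof -
      have x: "x \<in> carrier_vec N" "T *\<^sub>v x = 0\<^sub>v N'" using that unfolding K_def by auto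
      have "T *\<^sub>v even_proj N pr x = 0\<^sub>v N'"
      proof (rule eq_vecI)
        fix a assume "a < dim_vec (0\<^sub>v N' :: complex vec)"
        then have a: "a < N'" by simp
        show "vec_index (T *\<^sub>v even_proj N pr x) a = vec_index (0\<^sub>v N') a"
          unfolding homog_mult_even_proj[where pr' = pr', OF T(1) b x(1) a] using x(2) a by simp
      qed (use T in simp)
      then show ?thesis unfolding K_def by (simp add: even_proj_carrier)
    qed
    show "G *\<^sub>v x \<in> K" if G: "G \<in> {X i | i. i < n}" and xK: "x \<in> K" for G x
    proof -
      obtain i where i: "i < n" "G = X i" using G by blast
      have x: "x \<in> carrier_vec N" "T *\<^sub>v x = 0\<^sub>v N'" using xK unfolding K_def by auto
      have cXi: "X i \<in> carrier_mat N N" and cYi: "Y i \<in> carrier_mat N' N'" using X Y i by blast+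
      have "T *\<^sub>v (X i *\<^sub>v x) = Y i *\<^sub>v 0\<^sub>v N'" using Tint[OF x(1) i(1)] x(2) by simp
      also have "\<dots> = 0\<^sub>v N'" using cYi by (intro eq_vecI) (auto simp: scalar_prod_def)
      finally show ?thesis unfolding K_def i(2) using x(1) cXi by simp
    qed
  qed
  then have "K = {0\<^sub>v N} \<or> K = carrier_vec N" using sX unfolding simple_graded_def by blast
  moreover have "K \<noteq> carrier_vec N"
  proof
    assume "K = carrier_vec N"
    then have z: "T *\<^sub>v v = 0\<^sub>v N'" if "v \<in> carrier_vec N" for v using that unfolding K_def by blast
    have "T = 0\<^sub>m N' N"
    proof (rule mat_eq_by_vec[OF T(1)])
      fix v :: "complex vec" assume v: "v \<in> carrier_vec N"
      have "0\<^sub>m N' N *\<^sub>v v = 0\<^sub>v N'" using v by (intro eq_vecI) (auto simp: scalar_prod_def)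
      then show "T *\<^sub>v v = 0\<^sub>m N' N *\<^sub>v v" using z[OF v] by simp
    qed simp
    then show False using T(2) by simp
  qed
  ultimately have ker: "v = 0\<^sub>v N" if "v \<in> carrier_vec N" "T *\<^sub>v v = 0\<^sub>v N'" for v using that unfolding K_def by blast
  define I where "I = (\<lambda>v. T *\<^sub>v v) ` carrier_vec N"
  have "graded_inv_subspace N' pr' {Y i | i. i < n} I"
    unfolding graded_inv_subspace_def
  proof (intro conjI ballI allI)
    show "I \<subseteq> carrier_vec N'" unfolding I_def using Tv by blast
    show "0\<^sub>v N' \<in> I" unfolding I_def using T0 by (metis image_eqI zero_carrier_vec)
    show "x + y \<in> I" if "x \<in> I" "y \<in> I" for x y
      using that unfolding I_def by (auto simp flip: Tadd)
    show "c \<cdot>\<^sub>v x \<in> I" if "x \<in> I" for c x using that unfolding I_def by (auto simp flip: Tsm)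
    show "even_proj N' pr' y \<in> I" if yI: "y \<in> I" for y
    proof -
      obtain x where x: "x \<in> carrier_vec N" "y = T *\<^sub>v x" using yI unfolding I_def by blast
      \<comment> \<open>An odd \<open>T\<close> produces the even part of the image from the odd
        part of \<open>x\<close>.\<close>
      have e: "even_proj N' pr' y = T *\<^sub>v (if b then even_proj N pr x else x - even_proj N pr x)"
      proof (rule eq_vecI)
        fix a assume "a < dim_vec (T *\<^sub>v (if b then even_proj N pr x else x - even_proj N pr x))"
        then have a: "a < N'" using T by simp
        have "vec_index (T *\<^sub>v (x - even_proj N pr x)) a = vec_index (T *\<^sub>v x) a - vec_index (T *\<^sub>v even_proj N pr x) a"
          unfolding Tdiff[OF x(1) even_proj_carrier] using a T by (intro index_minus_vec) simp
        then show "vec_index (even_proj N' pr' y) a = vec_index (T *\<^sub>v (if b then even_proj N pr x else x - even_proj N pr x)) a"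
          using homog_mult_even_proj[where pr' = pr', OF T(1) b x(1) a] a unfolding even_proj_def[of N'] x(2) by auto
      qed (use T in \<open>simp add: even_proj_def\<close>)
      show ?thesis unfolding e I_def using x(1) by (intro imageI) (simp add: even_proj_carrier)
    qed
    show "G *\<^sub>v y \<in> I" if G: "G \<in> {Y i | i. i < n}" and y: "y \<in> I" for G y
    proof -
      obtain i where i: "i < n" "G = Y i" using G by blast
      obtain x where x: "x \<in> carrier_vec N" "y = T *\<^sub>v x" using y unfolding I_def by blast
      have "X i *\<^sub>v x \<in> carrier_vec N" using X i x by auto
      then show ?thesis unfolding I_def i(2) x(2) Tint[OF x(1) i(1), symmetric] by (rule imageI)
    qed
  qed
  then have "I = {0\<^sub>v N'} \<or> I = carrier_vec N'" using sY unfolding simple_graded_def by blast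
  moreover have "I \<noteq> {0\<^sub>v N'}"
  proof
    assume "I = {0\<^sub>v N'}"
    then have "T *\<^sub>v unit_vec N 0 = 0\<^sub>v N'" unfolding I_def by auto
    then have "unit_vec N 0 = (0\<^sub>v N :: complex vec)" by (intro ker) auto
    then have "vec_index (unit_vec N 0) 0 = (vec_index (0\<^sub>v N) 0 :: complex)" by simp
    moreover have "N > 0" using sX unfolding simple_graded_def by blast
    ultimately show False by simp
  qed
  ultimately have I: "I = carrier_vec N'" by blast
  have "\<exists>v\<in>carrier_vec N. T *\<^sub>v v = unit_vec N' a" for a
  proof -
    have "unit_vec N' a \<in> I" unfolding I by simp
    then show ?thesis unfolding I_def by auto
  qed
  then obtain r where r: "\<And>a. r a \<in> carrier_vec N" "\<And>a. T *\<^sub>v r a = unit_vec N' a" by metis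
  define R where "R = mat N N' (\<lambda>(c, a). vec_index (r a) c)"
  have cR: "R \<in> carrier_mat N N'" by (simp add: R_def)
  have TR: "T * R = 1\<^sub>m N'"
  proof (rule eq_matI)
    fix i a assume "i < dim_row (1\<^sub>m N' :: complex mat)" "a < dim_col (1\<^sub>m N' :: complex mat)"
    then have ia: "i < N'" "a < N'" by auto
    have "col R a = r a" using ia r(1)[of a] by (intro eq_vecI) (auto simp: R_def)
    then have "(T * R) $$ (i, a) = vec_index (T *\<^sub>v r a) i" using ia T(1) cR by simp
    then show "(T * R) $$ (i, a) = 1\<^sub>m N' $$ (i, a)" unfolding r(2) using ia by simp
  qed (use T cR in auto)
  have RT: "R * T = 1\<^sub>m N"
  proof (rule mat_eq_by_vec[of _ N N])
    fix v :: "complex vec" assume v: "v \<in> carrier_vec N"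
    have c: "(R * T) *\<^sub>v v \<in> carrier_vec N" using cR T v by simp
    have "T *\<^sub>v ((R * T) *\<^sub>v v) = (T * R) *\<^sub>v (T *\<^sub>v v)"
      using assoc_mult_mat_vec[OF cR T(1) v] assoc_mult_mat_vec[OF T(1) cR Tv[OF v]] by simp
    also have "\<dots> = T *\<^sub>v v" unfolding TR using Tv[OF v] by simp
    finally have "T *\<^sub>v ((R * T) *\<^sub>v v - v) = 0\<^sub>v N'" unfolding Tdiff[OF c v] using Tv[OF v] by simp
    then have z: "(R * T) *\<^sub>v v - v = 0\<^sub>v N" using c v by (intro ker) auto
    have "(R * T) *\<^sub>v v = v"
    proof (rule eq_vecI)
      fix i assume i: "i < dim_vec v"
      have "vec_index ((R * T) *\<^sub>v v - v) i = 0" unfolding z using i v by simp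
      moreover have "vec_index ((R * T) *\<^sub>v v - v) i = vec_index ((R * T) *\<^sub>v v) i - vec_index v i"
        by (rule index_minus_vec(1)[OF i])
      ultimately show "vec_index ((R * T) *\<^sub>v v) i = vec_index v i" by simp
    qed (use cR v in simp)
    then show "(R * T) *\<^sub>v v = 1\<^sub>m N *\<^sub>v v" using v by simp
  qed (use cR T in auto)
  \<comment> \<open>The identity matrices \<open>T * R\<close> and \<open>R * T\<close> have equal
    trace, which equates the two dimensions.\<close>
  have "mtr (1\<^sub>m k) = of_nat k" for k by (simp add: mtr_def)
  then have "(of_nat N' :: complex) = of_nat N" using mtr_comm[OF T(1) cR] unfolding TR RT by simp
  then show ?thesis using cR TR RT by auto
qed

section \<open>Transport of the series and invariants of isomorphism\<close>

context calg
begin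

lemma EV_intertwine:
  assumes "list_all2 (\<lambda>a b. fst a = fst b \<and> p * snd a = snd b * p) L L'"
  shows "p * EV L $ n = EV L' $ n * p \<and> p * OV L $ n = OV L' $ n * p"
  using assms
proof (induction arbitrary: n rule: list_all2_induct)
  case Nil
  then show ?case by (auto simp: EV_def OV_def)
next
  case (Cons a L b L')
  obtain x \<xi> \<eta> where ab: "a = (x, \<xi>)" "b = (x, \<eta>)" "p * \<xi> = \<eta> * p" using Cons.hyps by (cases a; cases b) auto
  show ?case
  proof (cases n)
    case 0
    then show ?thesis by (simp add: EV_0 OV_0)
  next
    case (Suc m)
    have IH: "p * EV L $ n = EV L' $ n * p" "p * OV L $ n = OV L' $ n * p" for n using Cons.IH by blast+
    have 1: "p * (sc x * EV L $ m) = sc x * EV L' $ m * p" "p * (sc x * OV L $ m) = sc x * OV L' $ m * p"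
      unfolding sc_left_comm[of p] IH by (simp_all add: mult.assoc)
    have 2: "p * (EV L $ m * \<xi>) = EV L' $ m * \<eta> * p" "p * (OV L $ m * \<xi>) = OV L' $ m * \<eta> * p"
      unfolding mult.assoc[of _ \<eta> p] ab(3)[symmetric] by (simp_all add: IH flip: mult.assoc)
    show ?thesis unfolding ab(1,2) Suc EV_Cons OV_Cons
      by (simp add: distrib_left distrib_right left_diff_distrib right_diff_distrib 1 2 IH)
  qed
qed

lemma lift_intertwine:
  assumes "\<And>n. p * F $ n = G $ n * p"
  shows "p * (lift f * F) $ n = (lift f * G) $ n * p"
proof -
  have "p * (sc c * F $ k) = sc c * G $ k * p" for c k
    unfolding sc_left_comm[of p] assms by (simp add: mult.assoc)
  then show ?thesis unfolding fps_mult_nth sum_distrib_left sum_distrib_right by (simp add: lift_def)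
qed

text \<open>The scalar \<open>d\<close> accounts for the factors \<Gamma>_f and \<Gamma>_g, which
  shift the coefficient of degree 2; a shift of this kind is invisible to
  \<open>der\<close>.\<close>

lemma moments_transport:
  fixes p q e e' w w' :: 'a
  assumes pq: "p * q = 1" and e: "p * e = (e' + sc d) * p" and w: "p * w = w' * p"
    and m: "acomm w ((der e ^^ n) w) = sc c"
  shows "acomm w' ((der e' ^^ n) w') = sc c"
proof -
  have D: "p * (der e ^^ n) w = (der e' ^^ n) w' * p" for n
  proof (induction n)
    case 0
    show ?case using w by simp
  next
    case (Suc n)
    let ?y = "(der e ^^ n) w" and ?y' = "(der e' ^^ n) w'"
    have 1: "p * (e * ?y) = (e' + sc d) * ?y' * p" "p * (?y * e) = ?y' * (e' + sc d) * p"
      by (metis Suc.IH e mult.assoc)+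
    have 2: "(e' + sc d) * ?y' - ?y' * (e' + sc d) = der e' ?y'"
      unfolding der_def distrib_left distrib_right sc_comm[of ?y'] by simp
    have "p * der e ?y = ((e' + sc d) * ?y' - ?y' * (e' + sc d)) * p"
      unfolding der_def right_diff_distrib 1 left_diff_distrib ..
    then show ?case unfolding 2 by simp
  qed
  let ?y = "(der e ^^ n) w" and ?y' = "(der e' ^^ n) w'"
  have "p * (w * ?y) = w' * ?y' * p" "p * (?y * w) = ?y' * w' * p" by (metis D w mult.assoc)+
  then have "acomm w' ?y' * p = p * acomm w ?y" by (simp add: acomm_def distrib_left distrib_right)
  then have "acomm w' ?y' * (p * q) = sc c * (p * q)" unfolding m sc_comm[of p] by (simp flip: mult.assoc)
  then show ?thesis by (simp add: pq)
qed

lemma lift_gam_low: "(lift (gam f) * EV L) $ 2 = ve L + sc (f 1)" "(lift (gam f) * OV L) $ 1 = vw L"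
proof -
  have g: "gam f 0 = 1" "gam f (Suc 0) = 0" "gam f (Suc (Suc 0)) = f 1" by (simp_all add: gam_def)
  have v: "vB L $ Suc (Suc 0) = 0" "vP L $ Suc 0 = 0" by (simp_all add: v_parity)
  show "(lift (gam f) * EV L) $ 2 = ve L + sc (f 1)" "(lift (gam f) * OV L) $ 1 = vw L"
    using v_nth_low[of L] by (simp_all add: fps_mult_nth numeral_2_eq_2 lift_def g EV_def OV_def v)
qed

context
  fixes \<tau> :: "'a \<Rightarrow> complex" and S :: "'a set"
  assumes \<tau>: "\<And>x y. \<tau> (x + y) = \<tau> x + \<tau> y" "\<And>c x. \<tau> (sc c * x) = c * \<tau> x"
    and S: "vs.subspace S" "1 \<in> S" "\<And>x y. x \<in> S \<Longrightarrow> y \<in> S \<Longrightarrow> x * y \<in> S"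
    and cyc: "\<And>x y. x \<in> S \<Longrightarrow> y \<in> S \<Longrightarrow> \<tau> (x * y) = \<tau> (y * x)"
begin

text \<open>In the recursion for \<open>EV\<close> the term with \<xi> is traceless: \<xi>
  anticommutes with \<open>OV L\<close>, while \<tau> is cyclic. What remains is the scalar
  recursion of the product.\<close>

lemma trace_EV:
  assumes "clif L" "snd ` set L \<subseteq> S"
  shows "\<tau> (EV L $ n) = \<tau> 1 * prod_list (map (\<lambda>x. 1 - fps_const x * fps_X) (map fst L)) $ n"
  using assms
proof (induction L arbitrary: n)
  case Nil
  have "\<tau> 0 = 0" using \<tau>(2)[of 0 0] by simp
  then show ?case by (simp add: EV_def)
next
  case (Cons a L)
  obtain x \<xi> where a: "a = (x, \<xi>)" by force
  let ?P = "prod_list (map (\<lambda>x. 1 - fps_const x * fps_X) (map fst L)) :: complex fps"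
  have IH: "\<tau> (EV L $ n) = \<tau> 1 * ?P $ n" for n using Cons unfolding a by simp
  have P: "prod_list (map (\<lambda>x. 1 - fps_const x * fps_X) (map fst (a # L))) = ?P - fps_const x * (fps_X * ?P)"
    unfolding a by (simp add: left_diff_distrib mult.assoc)
  have neg: "\<tau> (- y) = - \<tau> y" for y using \<tau>(2)[of "-1" y] by (simp add: sc_minus)
  have diff: "\<tau> (y - z) = \<tau> y - \<tau> z" for y z using \<tau>(1)[of y "- z"] by (simp add: neg)
  show ?case
  proof (cases n)
    case 0
    then show ?thesis using IH[of 0] unfolding P by (simp add: EV_0)
  next
    case (Suc m)
    have \<xi>S: "\<xi> \<in> S" and anti: "\<forall>\<eta>\<in>snd ` set L. \<xi> * \<eta> = - (\<eta> * \<xi>)" using Cons.prems unfolding a by auto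
    have OS: "OV L $ m \<in> S" by (rule v_in_subalgebra(2)[OF S]) (use Cons.prems in auto)
    have "fps_const \<xi> * OV L = - (OV L * fps_const \<xi>)"
      using v_commute[OF anti] unfolding OV_def by (simp add: distrib_left distrib_right)
    then have "(fps_const \<xi> * OV L) $ m = (- (OV L * fps_const \<xi>)) $ m" by simp
    then have "\<xi> * OV L $ m = - (OV L $ m * \<xi>)" by simp
    then have "\<tau> (OV L $ m * \<xi>) = - \<tau> (OV L $ m * \<xi>)" using cyc[OF OS \<xi>S] by (simp only: neg)
    then have "\<tau> (OV L $ m * \<xi>) = 0" by simp
    then show ?thesis unfolding P unfolding a Suc EV_Cons by (simp add: \<tau> diff IH algebra_simps)
  qed
qed

lemma trace_lift_EV:
  assumes "clif L" "snd ` set L \<subseteq> S"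
  shows "\<tau> ((lift f * EV L) $ n) = \<tau> 1 * (Abs_fps f * prod_list (map (\<lambda>x. 1 - fps_const x * fps_X) (map fst L))) $ n"
proof -
  have "\<tau> 0 = 0" using \<tau>(2)[of 0 0] by simp
  then have sum: "\<tau> (sum h A) = (\<Sum>i\<in>A. \<tau> (h i))" for h and A :: "nat set"
    by (induction A rule: infinite_finite_induct) (simp_all add: \<tau>(1))
  show ?thesis unfolding fps_mult_nth sum
    by (simp add: lift_def \<tau>(2) trace_EV[OF assms] sum_distrib_left mult.left_commute)
qed

end

end

text \<open>The trace over block 0, defined for every operator so that linearity holds without side
  conditions.\<close>

definition trl :: "nat \<Rightarrow> lop \<Rightarrow> complex" where
  "trl N t = (\<Sum>i<N. lapp t (ext (unit_vec N i)) i)"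

lemma trl_linear: "trl N (x + y) = trl N x + trl N y" "trl N (scl c * x) = c * trl N x"
  by (simp_all add: trl_def lapp_simps lapp_scl sum.distrib sum_distrib_left)

lemma trl_emb:
  assumes N: "N > 0" and A: "A \<in> carrier_mat N N"
  shows "trl N (emb N A) = mtr A"
proof -
  have "lapp (emb N A) (ext (unit_vec N i)) i = A $$ (i, i)" if "i < N" for i
    unfolding lapp_emb_ext[OF N A unit_vec_carrier] using that A by (simp add: ext_def[OF N])
  then show ?thesis using A by (simp add: trl_def mtr_def)
qed

lemma emb_carrier_subalgebra:
  assumes N: "N > 0"
  shows "op.vs.subspace (emb N ` carrier_mat N N)" "1 \<in> emb N ` carrier_mat N N"
    "x \<in> emb N ` carrier_mat N N \<Longrightarrow> y \<in> emb N ` carrier_mat N N \<Longrightarrow> x * y \<in> emb N ` carrier_mat N N"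
    "x \<in> emb N ` carrier_mat N N \<Longrightarrow> y \<in> emb N ` carrier_mat N N \<Longrightarrow> trl N (x * y) = trl N (y * x)"
proof -
  show "op.vs.subspace (emb N ` carrier_mat N N)"
  proof (rule op.vs.subspaceI)
    show "0 \<in> emb N ` carrier_mat N N" using emb_zero[OF N] by (metis image_eqI zero_carrier_mat)
    show "x + y \<in> emb N ` carrier_mat N N" if "x \<in> emb N ` carrier_mat N N" "y \<in> emb N ` carrier_mat N N" for x y
      using that by (auto simp flip: emb_add[OF N])
    show "scl c * x \<in> emb N ` carrier_mat N N" if "x \<in> emb N ` carrier_mat N N" for c x
      using that by (auto simp flip: emb_smult[OF N])
  qed
  show "1 \<in> emb N ` carrier_mat N N" using emb_one[OF N] by (metis image_eqI one_carrier_mat)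
  show "x * y \<in> emb N ` carrier_mat N N" if "x \<in> emb N ` carrier_mat N N" "y \<in> emb N ` carrier_mat N N"
    using that by (auto simp flip: emb_mult[OF N])
  show "trl N (x * y) = trl N (y * x)" if xy: "x \<in> emb N ` carrier_mat N N" "y \<in> emb N ` carrier_mat N N"
  proof -
    obtain A B where AB: "x = emb N A" "A \<in> carrier_mat N N" "y = emb N B" "B \<in> carrier_mat N N" using xy by blast
    have "trl N (emb N (A * B)) = trl N (emb N (B * A))"
      using mtr_comm[OF AB(2,4)] AB(2,4) by (simp add: trl_emb[OF N])
    then show ?thesis unfolding AB(1,3) emb_mult[OF N AB(2,4)] emb_mult[OF N AB(4,2)] .
  qed
qed

lemma prod_list_map_cong_mset:
  fixes h :: "'a \<Rightarrow> 'b::comm_monoid_mult"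
  shows "mset xs = mset ys \<Longrightarrow> prod_list (map h xs) = prod_list (map h ys)"
  by (metis mset_map prod_mset_prod_list)

text \<open>Stated for a bare invertible intertwiner, so that it covers both alternatives of
  \<open>iso_up_to_parity\<close>. Moments give the weights, and traces then give
  \<open>f\<close>.\<close>

lemma tensor_iso_invariants:
  assumes H: "simple_h_module s H" and H': "simple_h_module s' H'" and s: "regular s" "typical s" and s': "regular s'" "typical s'"
    and P: "P \<in> carrier_mat (hdim H') (hdim H)" "invertible_mat P"
    and act: "\<forall>m\<ge>1. \<forall>i\<in>idx. \<forall>j\<in>idx. P * act (tensor (V_mod s H) (Gamma_mod f)) m i j = act (tensor (V_mod s' H') (Gamma_mod g)) m i j * P"
  shows "mset s' = mset s \<and> (\<forall>k>0. f k = g k)"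
proof -
  let ?N = "hdim H" and ?L = "hL s H" and ?L' = "hL s' H'"
  note N = simple_h_module_pos[OF H]
  have hx: "\<forall>i<length s. homog (hdim H) (hpar H) True (xi H i)" "\<forall>i<length s'. homog (hdim H') (hpar H') True (xi H' i)"
    using H H' unfolding simple_h_module_def by blast+
  have NN: "hdim H' = ?N" using P unfolding invertible_mat_def square_mat.simps by auto
  have cP: "P \<in> carrier_mat ?N ?N" using P(1) NN by simp
  obtain Q where Q0: "P * Q = 1\<^sub>m (dim_row P)" "Q * P = 1\<^sub>m (dim_row Q)" using P(2) unfolding invertible_mat_def inverts_mat_def by blast
  have "dim_col Q = dim_row P" "dim_col P = dim_row Q"
    using arg_cong[OF Q0(1), of dim_col] arg_cong[OF Q0(2), of dim_col] by simp_all
  then have Q: "Q \<in> carrier_mat ?N ?N" "P * Q = 1\<^sub>m ?N" "Q * P = 1\<^sub>m ?N" using cP Q0 by auto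
  define p q where "p = emb ?N P" and "q = emb ?N Q"
  have pq: "p * q = 1" "q * p = 1"
    unfolding p_def q_def by (simp_all add: Q emb_one[OF N] flip: emb_mult[OF N cP Q(1)] emb_mult[OF N Q(1) cP])
  note M = tensor_V_mod_emb[where f = f, OF N hx(1)]
  note M' = tensor_V_mod_emb[where f = g, OF simple_h_module_pos[OF H'] hx(2), unfolded NN]
  have conj: "p * emb ?N (act (tensor (V_mod s H) (Gamma_mod f)) m i 1) = emb ?N (act (tensor (V_mod s' H') (Gamma_mod g)) m i 1) * p"
    if "m \<ge> 1" "i \<in> idx" for m i
  proof -
    have 1: "1 \<in> idx" by (simp add: idx_def)
    show ?thesis unfolding p_def emb_mult[OF N cP M(7)[OF that(2) 1], symmetric] emb_mult[OF N M'(7)[OF that(2) 1] cP, symmetric]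
      using act that 1 by simp
  qed
  have idx: "1 \<in> idx" "- 1 \<in> idx" by (simp_all add: idx_def)
  have E: "p * (op.lift (gam f) * op.EV ?L) $ m = (op.lift (gam g) * op.EV ?L') $ m * p" if "m \<ge> 1" for m
    using conj[OF that idx(1)] unfolding M(3) M'(3) .
  have W: "p * op.vw ?L = op.vw ?L' * p"
    using conj[OF order_refl idx(2)] unfolding M(4) M'(4) op.lift_gam_low(2) .
  \<comment> \<open>Degree 2 of the even series is \<open>op.ve\<close> plus the scalar
    \<open>f 1\<close> or \<open>g 1\<close>, so the two derivations still correspond under
    \<open>p\<close>.\<close>
  have "p * (op.ve ?L + scl (f 1)) = (op.ve ?L' + scl (g 1)) * p" using E[of 2] unfolding op.lift_gam_low(1) by simp
  then have e: "p * op.ve ?L = (op.ve ?L' + scl (g 1 - f 1)) * p"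
    unfolding distrib_left distrib_right op.sc_comm[of p] op.sc_diff left_diff_distrib by (simp add: algebra_simps)
  obtain h where h: "\<forall>n. acomm (op.vw ?L) ((op.der (op.ve ?L) ^^ n) (op.vw ?L)) = scl (h $ Suc n)" "h $ 0 = 0"
    "(1 + h) * op.\<Pi>m ?L = (1 - h) * op.\<Pi>p ?L" using op.moments[OF clif_hL[OF H]] by blast
  obtain h' where h': "\<forall>n. acomm (op.vw ?L') ((op.der (op.ve ?L') ^^ n) (op.vw ?L')) = scl (h' $ Suc n)" "h' $ 0 = 0"
    "(1 + h') * op.\<Pi>m ?L' = (1 - h') * op.\<Pi>p ?L'" using op.moments[OF clif_hL[OF H']] by blast
  have "h $ n = h' $ n" for n
  proof (cases n)
    case (Suc k)
    have "scl (h' $ Suc k) = scl (h $ Suc k)"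
      using op.moments_transport[OF pq(1) e W h(1)[rule_format, of k]] h'(1) by metis
    then show ?thesis unfolding Suc op.sc_inj by simp
  qed (use h(2) h'(2) in simp)
  then have hh: "h' = h" by (simp add: fps_eq_iff)
  have fst: "mset (map fst ?L) = mset s" "mset (map fst ?L') = mset s'" unfolding map_fst_hL by simp_all
  have ms: "mset s = mset s'"
    by (rule mset_eq_of_moments[OF s s' h(2)])
      (use h(3) h'(3) in \<open>simp_all only: hh prod_list_map_cong_mset[OF fst(1)] prod_list_map_cong_mset[OF fst(2)]\<close>)
  let ?S = "emb ?N ` carrier_mat ?N ?N" and ?c = "prod_list (map (\<lambda>x. 1 - fps_const x * fps_X) s) :: complex fps"
  have sub: "snd ` set (hL t G) \<subseteq> ?S" if "simple_h_module t G" "hdim G = ?N" for t G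
    using simple_h_module_carrier[OF that(1)] that(2) unfolding hL_def by auto
  have trE: "trl ?N ((op.lift k * op.EV (hL t G)) $ m) = trl ?N 1 * (Abs_fps k * ?c) $ m"
    if G: "simple_h_module t G" "hdim G = ?N" and t: "mset t = mset s" for t G k m
  proof -
    have "trl ?N ((op.lift k * op.EV (hL t G)) $ m) = trl ?N 1 * (Abs_fps k * prod_list (map (\<lambda>x. 1 - fps_const x * fps_X) (map fst (hL t G)))) $ m"
      by (rule op.trace_lift_EV[where S = ?S, OF trl_linear emb_carrier_subalgebra[OF N] clif_hL[OF G(1)] sub[OF G]])
    also have "mset (map fst (hL t G)) = mset s" unfolding map_fst_hL using t by simp
    note prod_list_map_cong_mset[OF this, of "\<lambda>x. 1 - fps_const x * fps_X :: complex fps"]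
    finally show ?thesis .
  qed
  have inS: "(op.lift k * op.EV (hL t G)) $ m \<in> ?S" if "simple_h_module t G" "hdim G = ?N" for t G k m
    unfolding fps_mult_nth
    by (intro op.vs.subspace_sum[OF emb_carrier_subalgebra(1)[OF N]])
      (simp add: op.lift_def op.vs.subspace_scale[OF emb_carrier_subalgebra(1)[OF N]] op.v_in_subalgebra(1)[OF emb_carrier_subalgebra(1,2,3)[OF N] sub[OF that]])
  have t1: "trl ?N 1 \<noteq> 0" using trl_emb[OF N one_carrier_mat] N by (simp add: emb_one[OF N] mtr_def)
  \<comment> \<open>Conjugation by \<open>p\<close> preserves the trace. Both traces contain the
    same product over the weights, whose constant term 1 allows it to be cancelled.\<close>
  have "(Abs_fps (gam f) * ?c) $ m = (Abs_fps (gam g) * ?c) $ m" for m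
  proof (cases "m = 0")
    case True
    then show ?thesis by (simp add: gam_def)
  next
    case False
    let ?x = "(op.lift (gam f) * op.EV ?L) $ m" and ?y = "(op.lift (gam g) * op.EV ?L') $ m"
    have y: "?y \<in> ?S" by (rule inS[OF H' NN])
    have pS: "p \<in> ?S" "q \<in> ?S" unfolding p_def q_def using cP Q(1) by blast+
    have "trl ?N ?y = trl ?N (?y * p * q)" using pq(1) by (simp add: mult.assoc)
    also have "\<dots> = trl ?N (q * (?y * p))" by (rule emb_carrier_subalgebra(4)[OF N emb_carrier_subalgebra(3)[OF N y pS(1)] pS(2)])
    also have "?y * p = p * ?x" using E[of m] False by simp
    also have "q * (p * ?x) = ?x" using pq(2) by (simp flip: mult.assoc)
    finally have "trl ?N 1 * (Abs_fps (gam g) * ?c) $ m = trl ?N 1 * (Abs_fps (gam f) * ?c) $ m"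
      unfolding trE[OF H refl refl] trE[OF H' NN ms[symmetric]] .
    then show ?thesis using t1 by simp
  qed
  then have "Abs_fps (gam f) * ?c = Abs_fps (gam g) * ?c" by (rule fps_ext)
  moreover have "?c $ 0 = 1" by (induction s) simp_all
  then have "?c \<noteq> 0" by auto
  ultimately have gg: "Abs_fps (gam f) = Abs_fps (gam g)" using mult_right_cancel by blast
  have "f k = g k" if "k > 0" for k
    using arg_cong[OF gg, of "\<lambda>F. F $ (2 * k)"] that by (simp add: gam_def)
  then show ?thesis using ms by simp
qed

text \<open>An intertwiner of the generators intertwines every polynomial in them, hence the two
  series. Whether it is even or odd decides between isomorphism and isomorphism up to parity
  change.\<close>

lemma tensor_iso_same_weights:
  assumes H: "simple_h_module s H" and H': "simple_h_module s H'" and reg: "regular s" and fg: "gam f = gam g"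
  shows "iso_up_to_parity (tensor (V_mod s H) (Gamma_mod f)) (tensor (V_mod s H') (Gamma_mod g))"
proof -
  let ?N = "hdim H" and ?L = "hL s H" and ?L' = "hL s H'"
  let ?M = "tensor (V_mod s H) (Gamma_mod f)" and ?M' = "tensor (V_mod s H') (Gamma_mod g)"
  note N = simple_h_module_pos[OF H]
  have hx: "\<forall>i<length s. homog (hdim H) (hpar H) True (xi H i)" "\<forall>i<length s. homog (hdim H') (hpar H') True (xi H' i)"
    using H H' unfolding simple_h_module_def by blast+
  obtain T b where T: "T \<in> carrier_mat (hdim H') ?N" "T \<noteq> 0\<^sub>m (hdim H') ?N"
    "\<forall>a<hdim H'. \<forall>c<hdim H. T $$ (a, c) \<noteq> 0 \<longrightarrow> (hpar H' a = hpar H c) = b"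
    "\<forall>i<length s. T * xi H i = xi H' i * T"
    using simple_h_module_intertwiner[OF H H' reg] by blast
  have sg: "simple_graded ?N (hpar H) {xi H i | i. i < length s}" "simple_graded (hdim H') (hpar H') {xi H' i | i. i < length s}"
    using H H' unfolding simple_h_module_def by blast+
  have cx: "\<forall>i<length s. xi H i \<in> carrier_mat ?N ?N" "\<forall>i<length s. xi H' i \<in> carrier_mat (hdim H') (hdim H')"
    using simple_h_module_carrier[OF H] simple_h_module_carrier[OF H'] by blast+
  obtain R where NN: "hdim H' = ?N" and R: "R \<in> carrier_mat ?N (hdim H')" "T * R = 1\<^sub>m (hdim H')" "R * T = 1\<^sub>m ?N"
    using intertwiner_invertible[OF sg cx T] by blast
  have cT: "T \<in> carrier_mat ?N ?N" using T(1) NN by simp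
  define p where "p = emb ?N T"
  have px: "p * emb ?N (xi H i) = emb ?N (xi H' i) * p" if i: "i < length s" for i
  proof -
    have "xi H' i \<in> carrier_mat ?N ?N" "xi H i \<in> carrier_mat ?N ?N" using cx i NN by auto
    then show ?thesis unfolding p_def using T(4) i cT by (simp flip: emb_mult[OF N])
  qed
  have "list_all2 (\<lambda>a b. fst a = fst b \<and> p * snd a = snd b * p) ?L ?L'"
    unfolding list_all2_conv_all_nth length_hL using px by (auto simp: hL_nth NN)
  note EO = op.EV_intertwine[OF this]
  have E: "p * (op.lift (gam f) * op.EV ?L) $ m = (op.lift (gam g) * op.EV ?L') $ m * p"
    and O: "p * (op.lift (gam f) * op.OV ?L) $ m = (op.lift (gam g) * op.OV ?L') $ m * p" for m
    unfolding fg by (rule op.lift_intertwine, simp add: EO)+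
  note M = tensor_V_mod_emb[where f = f, OF N hx(1)]
  note M' = tensor_V_mod_emb[where f = g, OF simple_h_module_pos[OF H'] hx(2), unfolded NN]
  have act: "T * act ?M m i j = act ?M' m i j * T" if m: "m \<ge> 1" and ij: "i \<in> idx" "j \<in> idx" for m i j
  proof -
    have c: "act ?M m i j \<in> carrier_mat ?N ?N" "act ?M' m i j \<in> carrier_mat ?N ?N" using M(7)[OF ij] M'(7)[OF ij] by blast+
    have "p * emb ?N (act ?M m i j) = emb ?N (act ?M' m i j) * p"
    proof -
      have sg: "p * (sgl m * x) = sgl m * y * p" if "p * x = y * p" for x y using that by (cases "even m") (simp_all add: sgl_def)
      have "(i = 1 \<or> i = - 1) \<and> (j = 1 \<or> j = - 1)" using ij unfolding idx_def by auto
      then show ?thesis by (elim conjE disjE) (simp_all only: M(3-6) M'(3-6) E O sg[OF E] sg[OF O])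
    qed
    then have "emb ?N (T * act ?M m i j) = emb ?N (act ?M' m i j * T)" unfolding p_def using c cT by (simp add: emb_mult[OF N])
    then show ?thesis using emb_inj[OF N mult_carrier_mat[OF cT c(1)] mult_carrier_mat[OF c(2) cT]] by simp
  qed
  have inv: "invertible_mat T"
    unfolding invertible_mat_def inverts_mat_def square_mat.simps using cT R NN by auto
  show ?thesis
  proof (cases b)
    case True
    then have "iso_YQ1 ?M ?M'" unfolding iso_YQ1_def using cT inv T(3) act by (intro exI[of _ T]) (auto simp: M(1,2) M'(1,2) NN)
    then show ?thesis unfolding iso_up_to_parity_def by blast
  next
    case False
    then have "iso_YQ1 ?M (parity_change ?M')" unfolding iso_YQ1_def parity_change_def
      using cT inv T(3) act by (intro exI[of _ T]) (auto simp: M(1,2) M'(1,2) NN)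
    then show ?thesis unfolding iso_up_to_parity_def by blast
  qed
qed

text \<open>The space stays the same and only the generators are replaced. Old and new generators
  span the same subspace, so they have the same invariant subspaces and simplicity carries
  over.\<close>

lemma h_module_permute:
  assumes H: "simple_h_module s H" and s: "regular s" "typical s" and ms: "mset s' = mset s"
  shows "\<exists>G. simple_h_module s' G \<and> hdim G = hdim H \<and> hpar G = hpar H \<and> op.EV (hL s' G) = op.EV (hL s H) \<and> op.OV (hL s' G) = op.OV (hL s H)"
proof -
  let ?N = "hdim H" and ?L = "hL s H"
  note N = simple_h_module_pos[OF H]
  have Lodd: "snd ` set ?L \<subseteq> Odop ?N (hpar H)"
    by (rule homog_hL[OF N]) (use H in \<open>auto simp: simple_h_module_def\<close>)
  have fs: "fst ` set ?L = set s" using arg_cong[OF map_fst_hL[of s H], of set] by simp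
  have "x + y \<noteq> 0" if xy: "x \<in> set s" "y \<in> set s" for x y
  proof -
    obtain i j where ij: "i < length s" "x = s ! i" "j < length s" "y = s ! j" using xy unfolding in_set_conv_nth by blast
    show ?thesis
    proof (cases "i = j")
      case True
      then have "x + y = 2 * s ! i" using ij by simp
      then show ?thesis using s(1) ij(1) unfolding regular_def by simp
    next
      case False
      then show ?thesis using s(2) ij unfolding typical_def by blast
    qed
  qed
  then have sums: "\<forall>x\<in>fst ` set ?L. \<forall>y\<in>fst ` set ?L. x + y \<noteq> 0" unfolding fs by blast
  have "mset (rev s') = mset (map fst ?L)" unfolding map_fst_hL using ms by simp
  then obtain L' where L': "map fst L' = rev s'" "op.clif L'" "op.EV L' = op.EV ?L" "op.OV L' = op.OV ?L"
    "op.vs.span (snd ` set L') = op.vs.span (snd ` set ?L)" using op.clif_permute[OF clif_hL[OF H] sums] by blast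
  interpret graded_algebra scl "Evop ?N (hpar H)" "Odop ?N (hpar H)" by (rule graded_algebra_op[OF N])
  have "snd ` set L' \<subseteq> op.vs.span (snd ` set ?L)" unfolding L'(5)[symmetric] by (rule op.vs.span_superset)
  also have "\<dots> \<subseteq> Odop ?N (hpar H)" by (rule op.vs.span_minimal[OF Lodd Od_sub])
  finally have L'odd: "snd ` set L' \<subseteq> Odop ?N (hpar H)" .
  have s'e: "s' = map fst (rev L')" using L'(1) by (simp flip: rev_map)
  obtain G where G: "hdim G = ?N" "hpar G = hpar H" and hL: "hL s' G = L'"
    and xiG: "\<forall>i<length s'. homog (hdim G) (hpar G) True (xi G i)"
    and anti: "\<forall>i<length s'. \<forall>j<length s'. i \<noteq> j \<longrightarrow> xi G i * xi G j + xi G j * xi G i = 0\<^sub>m (hdim G) (hdim G)"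
    and sq: "\<forall>i<length s'. xi G i * xi G i = (s' ! i) \<cdot>\<^sub>m 1\<^sub>m (hdim G)"
    using hmod_of_clif[OF N L'(2) L'odd s'e] by (elim exE conjE) (rule that; assumption)
  have "simple_graded (hdim G) (hpar G) {xi G i | i. i < length s'}"
    unfolding simple_graded_def G
  proof (intro conjI allI impI)
    show "?N > 0" by (rule N)
    fix U assume U: "graded_inv_subspace ?N (hpar H) {xi G i | i. i < length s'} U"
    have Uc: "U \<subseteq> carrier_vec ?N" and U0: "0\<^sub>v ?N \<in> U" and Ua: "\<And>x y. x \<in> U \<Longrightarrow> y \<in> U \<Longrightarrow> x + y \<in> U"
      and Us: "\<And>c x. x \<in> U \<Longrightarrow> c \<cdot>\<^sub>v x \<in> U" and Ui: "\<And>i x. i < length s' \<Longrightarrow> x \<in> U \<Longrightarrow> xi G i *\<^sub>v x \<in> U"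
      using U unfolding graded_inv_subspace_def by blast+
    define Sg where "Sg = {t. \<forall>v\<in>U. \<exists>u\<in>U. lapp t (ext v) = ext u}"
    have Ssub: "op.vs.subspace Sg" unfolding Sg_def by (rule stabiliser_subspace[OF N Uc U0 Ua Us])
    have "snd ` set L' \<subseteq> Sg"
    proof
      fix x assume "x \<in> snd ` set L'"
      then obtain i where i: "i < length s'" "x = emb ?N (xi G i)" unfolding hL[symmetric] hL_def G by auto
      have ci: "xi G i \<in> carrier_mat ?N ?N" using xiG[rule_format, OF i(1)] unfolding homog_def G by blast
      show "x \<in> Sg" unfolding Sg_def i(2) using lapp_emb_ext[OF N ci] Ui[OF i(1)] Uc by blast
    qed
    then have "op.vs.span (snd ` set ?L) \<subseteq> Sg" unfolding L'(5)[symmetric] by (rule op.vs.span_minimal[OF _ Ssub])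
    then have LS: "snd ` set ?L \<subseteq> Sg" using op.vs.span_superset by blast
    have "xi H i *\<^sub>v v \<in> U" if i: "i < length s" and v: "v \<in> U" for i v
    proof -
      have ci: "xi H i \<in> carrier_mat ?N ?N" by (rule simple_h_module_carrier[OF H i])
      have vc: "v \<in> carrier_vec ?N" using v Uc by blast
      have "emb ?N (xi H i) \<in> snd ` set ?L" unfolding hL_def using i by force
      then have "emb ?N (xi H i) \<in> Sg" using LS by blast
      then obtain u where u: "u \<in> U" "lapp (emb ?N (xi H i)) (ext v) = ext u" unfolding Sg_def using v by blast
      have "u \<in> carrier_vec ?N" "xi H i *\<^sub>v v \<in> carrier_vec ?N" using u Uc ci vc by auto
      then show ?thesis using u lapp_emb_ext[OF N ci vc] ext_inj[OF N] by simp
    qed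
    then have "graded_inv_subspace ?N (hpar H) {xi H i | i. i < length s} U"
      using U unfolding graded_inv_subspace_def by blast
    then show "U = {0\<^sub>v ?N} \<or> U = carrier_vec ?N" using H unfolding simple_h_module_def simple_graded_def by blast
  qed
  then have "simple_h_module s' G" unfolding simple_h_module_def using xiG anti sq by blast
  then show ?thesis using G L'(3,4) hL by (intro exI[of _ G]) simp
qed

text \<open>After permuting, \<open>G\<close> carries literally the same YQ(1)-action as
  \<open>H\<close>, which reduces the claim to modules with identical weight lists.\<close>

lemma tensor_iso_of_mset:
  assumes H: "simple_h_module s H" and H': "simple_h_module s' H'" and s: "regular s" "typical s" and s': "regular s'"
    and ms: "mset s' = mset s" and fg: "gam f = gam g"
  shows "iso_up_to_parity (tensor (V_mod s H) (Gamma_mod f)) (tensor (V_mod s' H') (Gamma_mod g))"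
proof -
  obtain G where G: "simple_h_module s' G" "hdim G = hdim H" "hpar G = hpar H" "op.EV (hL s' G) = op.EV (hL s H)" "op.OV (hL s' G) = op.OV (hL s H)"
    using h_module_permute[OF H s ms] by blast
  let ?M = "tensor (V_mod s H) (Gamma_mod f)" and ?K = "tensor (V_mod s' G) (Gamma_mod f)"
  note N = simple_h_module_pos[OF H]
  have hx: "\<forall>i<length s. homog (hdim H) (hpar H) True (xi H i)" "\<forall>i<length s'. homog (hdim G) (hpar G) True (xi G i)"
    using H G(1) unfolding simple_h_module_def by blast+
  note M = tensor_V_mod_emb[where f = f, OF N hx(1)]
  note K = tensor_V_mod_emb[where f = f, OF simple_h_module_pos[OF G(1)] hx(2), unfolded G(2-5)]
  have act: "act ?M m i j = act ?K m i j" if ij: "i \<in> idx" "j \<in> idx" for m i j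
  proof -
    have "emb (hdim H) (act ?M m i j) = emb (hdim H) (act ?K m i j)"
      using ij unfolding idx_def by (auto simp: M(3-6) K(3-6))
    then show ?thesis using emb_inj[OF N M(7)[OF ij] K(7)[OF ij]] by simp
  qed
  have "iso_YQ1 ?M X = iso_YQ1 ?K X" for X unfolding iso_YQ1_def M(1,2) K(1,2) using act by auto
  then show ?thesis using tensor_iso_same_weights[OF G(1) H' s' fg] unfolding iso_up_to_parity_def by simp
qed

theorem theorem5p14:
  shows "(\<forall>M. is_YQ1_module M \<and> simple_YQ1 M \<longrightarrow>
            (\<exists>s H f. regular s \<and> typical s \<and> simple_h_module s H \<and>
                     iso_YQ1 M (tensor (V_mod s H) (Gamma_mod f))))
       \<and> (\<forall>s H s' H' f g. regular s \<and> typical s \<and> simple_h_module s H \<and>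
                          regular s' \<and> typical s' \<and> simple_h_module s' H' \<longrightarrow>
            (iso_up_to_parity (tensor (V_mod s H) (Gamma_mod f)) (tensor (V_mod s' H') (Gamma_mod g))
             \<longleftrightarrow> mset s' = mset s \<and> (\<forall>k>0. f k = g k)))"
proof (rule conjI; intro allI impI; (elim conjE)?)
  fix M assume "is_YQ1_module M" "simple_YQ1 M"
  then show "\<exists>s H f. regular s \<and> typical s \<and> simple_h_module s H \<and> iso_YQ1 M (tensor (V_mod s H) (Gamma_mod f))"
    by (rule simple_module_realisation)
next
  fix s s' :: "complex list" and H H' :: hmod and f g :: "nat \<Rightarrow> complex"
  assume s: "regular s" "typical s" and H: "simple_h_module s H" and s': "regular s'" "typical s'" and H': "simple_h_module s' H'"
  let ?M = "tensor (V_mod s H) (Gamma_mod f)" and ?M' = "tensor (V_mod s' H') (Gamma_mod g)"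
  show "iso_up_to_parity ?M ?M' \<longleftrightarrow> mset s' = mset s \<and> (\<forall>k>0. f k = g k)"
  proof
    assume iso: "iso_up_to_parity ?M ?M'"
    have hx: "\<forall>i<length s. homog (hdim H) (hpar H) True (xi H i)" "\<forall>i<length s'. homog (hdim H') (hpar H') True (xi H' i)"
      using H H' unfolding simple_h_module_def by blast+
    have dims: "dim ?M = hdim H" "dim ?M' = hdim H'"
      by (rule tensor_V_mod_emb(1)[OF simple_h_module_pos[OF H] hx(1)], rule tensor_V_mod_emb(1)[OF simple_h_module_pos[OF H'] hx(2)])
    \<comment> \<open>Parity change leaves the matrices untouched, so either alternative provides an
      invertible intertwiner of the actions.\<close>
    have "dim (parity_change ?M') = dim ?M'" "act (parity_change ?M') = act ?M'" by (simp_all add: parity_change_def)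
    then obtain P where "P \<in> carrier_mat (hdim H') (hdim H)" "invertible_mat P"
      "\<forall>m\<ge>1. \<forall>i\<in>idx. \<forall>j\<in>idx. P * act ?M m i j = act ?M' m i j * P"
      using iso unfolding iso_up_to_parity_def iso_YQ1_def dims by (auto simp: dims)
    then show "mset s' = mset s \<and> (\<forall>k>0. f k = g k)" by (rule tensor_iso_invariants[OF H H' s s'])
  next
    assume r: "mset s' = mset s \<and> (\<forall>k>0. f k = g k)"
    have "gam f = gam g"
    proof
      fix n :: nat
      have "n div 2 > 0" if "even n" "n \<noteq> 0" using that by (elim evenE) simp
      then show "gam f n = gam g n" using r by (simp add: gam_def)
    qed
    then show "iso_up_to_parity ?M ?M'" using r by (intro tensor_iso_of_mset[OF H H' s s'(1)]) auto
  qed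
qed

end
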